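(* Let $G=SL(2,\mathbf{Z})$ and let $h\in G$ be a hyperbolic element which is not conjugate to its inverse in $G$. Then there exists $\epsilon>0$ such that the ball of radius $\epsilon$ centered at $\{h^k\}_{k\in\mathbf{N}}\in G^\infty$, with respect to the metric $\bar\rho$, consists of mixing sequences with exponential decay of correlations on H\"older observables.
   Context: An element of $G=SL(2,\mathbf{Z})$ is hyperbolic, parabolic or elliptic according to whether $|\operatorname{trace}|>2$; $|\operatorname{trace}|=2$ and the element is not $\pm I$; $|\operatorname{trace}|<2$. $\mathbf{N}$ denotes the positive integers. Biinvariant metric $\rho$ on $G$: every $g\in G$ can be decomposed as $g=a_1\cdots a_d$ where every $a_i$ is either elliptic, or parabolic, or a simple commutator $aba^{-1}b^{-1}$ with $a,b\in G$. Put $\rho(1,g)=\inf d$, the infimum over all such presentations (with $\rho(1,1)=0$), and $\rho(f,g)=\rho(1,fg^{-1})$ for $f,g\in G$. $G^\infty$ is the set of all infinite sequences $\{g^{(k)}\}_{k\in\mathbf{N}}$ in $G$ with $\sup_{k\in\mathbf{N}}\rho(1,g^{(k)})/k<\infty$. The metric $\bar\rho$ on $G^\infty$ is $$\bar\rho(\{f^{(k)}\},\{g^{(k)}\})=\sup_{k\in\mathbf{N}}\frac{\rho(f^{(k)},g^{(k)})}{k}.$$ $G$ acts on $\mathbf{T}=\mathbf{R}^2/\mathbf{Z}^2$ by its linear action. For a sequence $\{f^{(k)}\}$ in $G$ and $F_1,F_2\in L^2(\mathbf{T})$, $$C(F_1,F_2;f^{(k)})=\int_{\mathbf{T}}F_1(f^{(k)}(x))F_2(x)\,dx-\int_{\mathbf{T}}F_1(x)\,dx\int_{\mathbf{T}}F_2(x)\,dx.$$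 The sequence is mixing if $C(F_1,F_2;f^{(k)})\to0$ as $k\to\infty$ for all $F_1,F_2\in L^2(\mathbf{T})$. It has exponential decay of correlations on H\"older observables if for all H\"older functions $F_1,F_2$ on $\mathbf{T}$ there are $c,\gamma>0$ with $|C(F_1,F_2;f^{(k)})|\le c\,e^{-\gamma k}$ for all $k\in\mathbf{N}$. A function $F$ on $\mathbf{T}$ is H\"older if for some $\gamma'>0$ there is $c'>0$ with $|F(x)-F(y)|\le c'\|x-y\|^{\gamma'}$ for all $x,y\in\mathbf{T}$, where $\|x-y\|$ is the distance on the torus. *)

theory Defs
  imports "HOL-Analysis.Analysis" "HOL-Algebra.Group"
begin

section \<open>The modular group\<close>

definition SL2Z :: "(int^2^2) monoid" where
  "SL2Z = \<lparr>carrier = {A. det A = 1}, mult = (**), one = mat 1\<rparr>"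

lemma SL2Z_simps [simp]:
  "A \<in> carrier SL2Z \<longleftrightarrow> det A = 1"
  "A \<otimes>\<^bsub>SL2Z\<^esub> B = A ** B"
  "\<one>\<^bsub>SL2Z\<^esub> = mat 1"
  by (simp_all add: SL2Z_def)

lemma matrix2_eq_iff:
  fixes A B :: "'a^2^2"
  shows "A = B \<longleftrightarrow> A$1$1 = B$1$1 \<and> A$1$2 = B$1$2 \<and> A$2$1 = B$2$1 \<and> A$2$2 = B$2$2"
  by (auto simp: vec_eq_iff forall_2)

lemma group_SL2Z: "group SL2Z"
proof (rule groupI)
  fix A assume A: "A \<in> carrier SL2Z"
  define B :: "int^2^2" where "B = vector [vector [A$2$2, - A$1$2], vector [- A$2$1, A$1$1]]"
  have "det B = 1" "B ** A = mat 1"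
    using A by (simp_all add: B_def det_2 matrix2_eq_iff matrix_matrix_mult_def sum_2 mat_def
        algebra_simps)
  then show "\<exists>B\<in>carrier SL2Z. B \<otimes>\<^bsub>SL2Z\<^esub> A = \<one>\<^bsub>SL2Z\<^esub>"
    by (auto intro!: bexI[of _ B])
qed (auto simp: det_mul matrix_mul_assoc)

interpretation SL2Z: group SL2Z
  by (rule group_SL2Z)

definition hyperbolic :: "int^2^2 \<Rightarrow> bool" where
  "hyperbolic A \<longleftrightarrow> A \<in> carrier SL2Z \<and> \<bar>trace A\<bar> > 2"

definition parabolic :: "int^2^2 \<Rightarrow> bool" where
  "parabolic A \<longleftrightarrow> A \<in> carrier SL2Z \<and> \<bar>trace A\<bar> = 2 \<and> A \<noteq> mat 1 \<and> A \<noteq> - mat 1"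

definition elliptic :: "int^2^2 \<Rightarrow> bool" where
  "elliptic A \<longleftrightarrow> A \<in> carrier SL2Z \<and> \<bar>trace A\<bar> < 2"

definition simple_commutator :: "int^2^2 \<Rightarrow> bool" where
  "simple_commutator g \<longleftrightarrow> (\<exists>a\<in>carrier SL2Z. \<exists>b\<in>carrier SL2Z.
     g = a \<otimes>\<^bsub>SL2Z\<^esub> b \<otimes>\<^bsub>SL2Z\<^esub> inv\<^bsub>SL2Z\<^esub> a \<otimes>\<^bsub>SL2Z\<^esub> inv\<^bsub>SL2Z\<^esub> b)"

definition conjugate :: "int^2^2 \<Rightarrow> int^2^2 \<Rightarrow> bool" where
  "conjugate g h \<longleftrightarrow> (\<exists>a\<in>carrier SL2Z. a \<otimes>\<^bsub>SL2Z\<^esub> g \<otimes>\<^bsub>SL2Z\<^esub> inv\<^bsub>SL2Z\<^esub> a = h)"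


section \<open>The biinvariant metric and the space of sequences\<close>

definition decompositions :: "int^2^2 \<Rightarrow> (int^2^2) list set" where
  "decompositions g = {as. (\<forall>a\<in>set as. elliptic a \<or> parabolic a \<or> simple_commutator a)
     \<and> foldr (mult SL2Z) as \<one>\<^bsub>SL2Z\<^esub> = g}"

text \<open>
  The length and the distances below take values in the extended reals, so that infima and suprema
  are never those of an empty or unbounded set of reals. The values are in fact finite, see
  \<open>decompositions_nonempty\<close>. The empty decomposition gives the unit length 0.
\<close>

definition rho_one :: "int^2^2 \<Rightarrow> ereal" where
  "rho_one g = (INF as\<in>decompositions g. ereal (real (length as)))"

definition rho :: "int^2^2 \<Rightarrow> int^2^2 \<Rightarrow> ereal" where
  "rho f g = rho_one (f \<otimes>\<^bsub>SL2Z\<^esub> inv\<^bsub>SL2Z\<^esub> g)"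

text \<open>
  Sequences are indexed by the positive integers; the value at index 0 is irrelevant throughout.
\<close>

definition G_infinity :: "(nat \<Rightarrow> int^2^2) set" where
  "G_infinity = {g. (\<forall>k\<ge>1. g k \<in> carrier SL2Z) \<and>
     (SUP k\<in>{1..}. rho_one (g k) / ereal (real k)) < \<infinity>}"

definition rho_bar :: "(nat \<Rightarrow> int^2^2) \<Rightarrow> (nat \<Rightarrow> int^2^2) \<Rightarrow> ereal" where
  "rho_bar f g = (SUP k\<in>{1..}. rho (f k) (g k) / ereal (real k))"

lemma decompositions_mult:
  assumes "as \<in> decompositions g" "bs \<in> decompositions h"
  shows "as @ bs \<in> decompositions (g \<otimes>\<^bsub>SL2Z\<^esub> h)"
proof -
  have M: "mult SL2Z = (**)"
    by (simp add: SL2Z_def)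
  have "foldr (**) as C = foldr (**) as (mat 1) ** C" for C :: "int^2^2"
    by (induction as) (simp_all add: matrix_mul_assoc)
  from this[of h] have "foldr (**) (as @ bs) (mat 1) = g ** h"
    using assms by (simp add: decompositions_def M)
  then show ?thesis
    using assms by (auto simp: decompositions_def M)
qed

lemma decompositions_singleton:
  "elliptic g \<or> parabolic g \<or> simple_commutator g \<Longrightarrow> [g] \<in> decompositions g"
  by (auto simp: decompositions_def)

lemma decompositions_nonempty:
  assumes "g \<in> carrier SL2Z"
  shows "decompositions g \<noteq> {}"
  using assms
proof (induction "nat \<bar>g$2$1\<bar>" arbitrary: g rule: less_induct)
  case less
  define S :: "int^2^2" where "S = vector [vector [0, -1], vector [1, 0]]"
  have S: "[S] \<in> decompositions S"
    by (rule decompositions_singleton) (simp add: elliptic_def S_def det_2 trace_def sum_2)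
  have triangular: "decompositions A \<noteq> {}" if A: "det A = 1" "A$2$1 = 0" for A
  proof -
    have "A$1$1 * A$2$2 = 1"
      using A by (simp add: det_2)
    then have tr: "A$1$1 = 1 \<and> A$2$2 = 1 \<or> A$1$1 = -1 \<and> A$2$2 = -1"
      by (auto simp: zmult_eq_1_iff)
    consider "A = mat 1" | "A = - mat 1" | "A \<noteq> mat 1" "A \<noteq> - mat 1"
      by blast
    then show ?thesis
    proof cases
      case 1
      then have "[] \<in> decompositions A"
        by (simp add: decompositions_def)
      then show ?thesis by blast
    next
      case 2
      then have "A = S \<otimes>\<^bsub>SL2Z\<^esub> S"
        by (simp add: S_def matrix2_eq_iff matrix_matrix_mult_def sum_2 mat_def)
      then show ?thesis
        using decompositions_mult[OF S S] by auto
    next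
      case 3
      then have "parabolic A"
        using A tr by (auto simp: parabolic_def trace_def sum_2)
      then show ?thesis
        using decompositions_singleton by blast
    qed
  qed
  show ?case
  proof (cases "g$2$1 = 0")
    case True
    then show ?thesis
      using triangular less.prems by simp
  next
    case False
    define q where "q = g$1$1 div g$2$1"
    define T :: "int^2^2" where "T = vector [vector [1, q], vector [0, 1]]"
    define B :: "int^2^2" where
      "B = vector [vector [g$2$1, g$2$2], vector [q * g$2$1 - g$1$1, q * g$2$2 - g$1$2]]"
    have "q * g$2$1 - g$1$1 = - (g$1$1 mod g$2$1)"
      by (simp add: q_def minus_mod_eq_div_mult [symmetric])
    then have "nat \<bar>B$2$1\<bar> < nat \<bar>g$2$1\<bar>"
      using False by (simp add: B_def abs_mod_less)
    moreover have "B \<in> carrier SL2Z"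
      using less.prems by (simp add: B_def det_2 algebra_simps)
    ultimately obtain bs where bs: "bs \<in> decompositions B"
      using less.hyps by blast
    obtain ts where ts: "ts \<in> decompositions T"
      using triangular[of T] by (auto simp: T_def det_2)
    have "g = T \<otimes>\<^bsub>SL2Z\<^esub> (S \<otimes>\<^bsub>SL2Z\<^esub> B)"
      by (simp add: T_def S_def B_def matrix2_eq_iff matrix_matrix_mult_def sum_2)
    then show ?thesis
      using decompositions_mult[OF ts decompositions_mult[OF S bs]] by auto
  qed
qed

lemma powers_in_G_infinity:
  assumes "h \<in> carrier SL2Z"
  shows "(\<lambda>k::nat. h [^]\<^bsub>SL2Z\<^esub> k) \<in> G_infinity"
proof -
  obtain as where as: "as \<in> decompositions h"
    using decompositions_nonempty[OF assms] by blast
  have "\<exists>bs\<in>decompositions (h [^]\<^bsub>SL2Z\<^esub> k). length bs = k * length as" for k :: nat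
  proof (induction k)
    case 0
    show ?case by (auto simp: decompositions_def)
  next
    case (Suc k)
    then show ?case
      using decompositions_mult[OF _ as] by (fastforce simp del: SL2Z_simps intro: rev_bexI)
  qed
  then have *: "rho_one (h [^]\<^bsub>SL2Z\<^esub> k) \<le> ereal (real (k * length as))" for k :: nat
    unfolding rho_one_def by (metis INF_lower)
  have "(SUP k\<in>{1..}. rho_one (h [^]\<^bsub>SL2Z\<^esub> k) / ereal (real k)) \<le> ereal (real (length as))"
  proof (rule SUP_least)
    fix k :: nat assume "k \<in> {1..}"
    then show "rho_one (h [^]\<^bsub>SL2Z\<^esub> k) / ereal (real k) \<le> ereal (real (length as))"
      using *[of k] by (subst ereal_divide_le_pos) auto
  qed
  then have "(SUP k\<in>{1..}. rho_one (h [^]\<^bsub>SL2Z\<^esub> k) / ereal (real k)) < \<infinity>"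
    by (rule order.strict_trans1) simp
  then show ?thesis
    using assms SL2Z.nat_pow_closed unfolding G_infinity_def by blast
qed


section \<open>The torus\<close>

definition same_mod_Z2 :: "real^2 \<Rightarrow> real^2 \<Rightarrow> bool" where
  "same_mod_Z2 x y \<longleftrightarrow> (\<forall>i. x$i - y$i \<in> \<int>)"

quotient_type torus = "real^2" / same_mod_Z2
proof (rule equivpI)
  show "reflp same_mod_Z2"
    by (simp add: reflp_def same_mod_Z2_def)
  show "symp same_mod_Z2"
    unfolding symp_def same_mod_Z2_def by (metis Ints_minus minus_diff_eq)
  show "transp same_mod_Z2"
  proof (rule transpI)
    fix x y z assume "same_mod_Z2 x y" "same_mod_Z2 y z"
    then have "x$i - y$i + (y$i - z$i) \<in> \<int>" for i
      unfolding same_mod_Z2_def by (blast intro: Ints_add)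
    then show "same_mod_Z2 x z"
      by (simp add: same_mod_Z2_def)
  qed
qed

lift_definition torus_action :: "int^2^2 \<Rightarrow> torus \<Rightarrow> torus"
  is "\<lambda>A x. map_matrix real_of_int A *v x"
proof -
  fix A :: "int^2^2" and x y :: "real^2"
  assume "same_mod_Z2 x y"
  then have "real_of_int (A$i$1) * (x$1 - y$1) + real_of_int (A$i$2) * (x$2 - y$2) \<in> \<int>" for i
    unfolding same_mod_Z2_def by (intro Ints_add Ints_mult) auto
  then show "same_mod_Z2 (map_matrix real_of_int A *v x) (map_matrix real_of_int A *v y)"
    unfolding same_mod_Z2_def by (simp add: matrix_vector_mult_def sum_2 algebra_simps)
qed

definition torus_dist :: "torus \<Rightarrow> torus \<Rightarrow> real" where
  "torus_dist p q = Inf {dist x y |x y. abs_torus x = p \<and> abs_torus y = q}"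

text \<open>
  Normalized Lebesgue measure on the Borel sets of the torus (the sets with Borel preimage in the
  plane), as the image of Lebesgue measure on a fundamental domain.
\<close>

definition torus_measure :: "torus measure" where
  "torus_measure = distr (restrict_space lborel {x. \<forall>i. 0 \<le> x$i \<and> x$i < 1})
     (sigma UNIV {A. abs_torus -` A \<in> sets borel}) abs_torus"

definition L2_torus :: "(torus \<Rightarrow> complex) set" where
  "L2_torus = {F. F \<in> borel_measurable torus_measure \<and>
     integrable torus_measure (\<lambda>x. (cmod (F x))\<^sup>2)}"

definition hoelder_torus :: "(torus \<Rightarrow> complex) set" where
  "hoelder_torus = {F. \<exists>\<gamma>>0. \<exists>c>0. \<forall>x y. cmod (F x - F y) \<le> c * torus_dist x y powr \<gamma>}"

lemma sets_torus_measure: "sets torus_measure = {A. abs_torus -` A \<in> sets borel}"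
proof -
  have "sigma_algebra UNIV {A. abs_torus -` A \<in> sets (borel :: (real^2) measure)}"
    by (auto simp: sigma_algebra_iff2 vimage_Diff vimage_Union Compl_eq_Diff_UNIV[symmetric]
        vimage_Compl vimage_UN intro!: sets.countable_UN)
  then show ?thesis
    unfolding torus_measure_def sets_distr by (simp add: sigma_algebra.sigma_sets_eq)
qed

lemma emeasure_torus_measure:
  assumes "A \<in> sets torus_measure"
  shows "emeasure torus_measure A =
    emeasure lborel (abs_torus -` A \<inter> {x. \<forall>i. 0 \<le> x$i \<and> x$i < 1})"
proof -
  let ?Q = "{x :: real^2. \<forall>i. 0 \<le> x$i \<and> x$i < 1}"
  let ?S = "sigma UNIV {A. abs_torus -` A \<in> sets borel}"
  have S: "sets ?S = sets torus_measure"
    by (simp add: torus_measure_def)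
  have Q: "?Q \<in> sets borel"
    by measurable
  have "abs_torus \<in> measurable (restrict_space lborel ?Q) ?S"
    using Q by (intro measurable_restrict_space1 measurableI)
      (auto simp: S sets_torus_measure space_measure_of_conv)
  moreover have "A \<in> sets ?S"
    using assms S by simp
  ultimately show ?thesis
    using Q unfolding torus_measure_def
    by (simp add: emeasure_distr space_restrict_space emeasure_restrict_space)
qed

lemma emeasure_torus_measure_UNIV: "emeasure torus_measure UNIV = 1"
proof -
  let ?Q = "{x :: real^2. \<forall>i. 0 \<le> x$i \<and> x$i < 1}"
  have one: "(1::real^2) \<bullet> b = 1" if "b \<in> Basis" for b
    using that by (auto simp: Basis_vec_def inner_axis)
  have Q: "?Q \<in> sets lborel"
    by measurable
  have "emeasure lborel (box 0 (1::real^2)) \<le> emeasure lborel ?Q"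
    using Q by (intro emeasure_mono) (auto simp: mem_box_cart less_imp_le)
  moreover have "emeasure lborel ?Q \<le> emeasure lborel (cbox 0 (1::real^2))"
    by (intro emeasure_mono) (auto simp: mem_box_cart less_imp_le)
  ultimately have "emeasure lborel ?Q = 1"
    by (simp add: one)
  then show ?thesis
    by (simp add: emeasure_torus_measure sets_torus_measure)
qed


section \<open>Correlations\<close>

definition correlation :: "(torus \<Rightarrow> complex) \<Rightarrow> (torus \<Rightarrow> complex) \<Rightarrow> int^2^2 \<Rightarrow> complex" where
  "correlation F1 F2 g =
     (\<integral>x. F1 (torus_action g x) * F2 x \<partial>torus_measure)
     - (\<integral>x. F1 x \<partial>torus_measure) * (\<integral>x. F2 x \<partial>torus_measure)"

definition mixing :: "(nat \<Rightarrow> int^2^2) \<Rightarrow> bool" where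
  "mixing f \<longleftrightarrow>
     (\<forall>F1\<in>L2_torus. \<forall>F2\<in>L2_torus. (\<lambda>k. correlation F1 F2 (f k)) \<longlonglongrightarrow> 0)"

definition exponential_decay_hoelder :: "(nat \<Rightarrow> int^2^2) \<Rightarrow> bool" where
  "exponential_decay_hoelder f \<longleftrightarrow>
     (\<forall>F1\<in>hoelder_torus. \<forall>F2\<in>hoelder_torus. \<exists>c>0. \<exists>\<gamma>>0. \<forall>k\<ge>1.
        cmod (correlation F1 F2 (f k)) \<le> c * exp (- \<gamma> * real k))"

end

theory Submission
  imports Defs
begin

text \<open>
  The proof combines a quasimorphism on \<open>SL(2,Z)\<close> with Fourier analysis on the torus.

  Modulo sign, \<open>SL(2,Z)\<close> is the free product of a group of order 2, generated by \<open>S\<close>, and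
  a group of order 3, generated by \<open>U\<close> with inverse \<open>V\<close>, so every element has a unique reduced
  word (\<open>reduced_unique\<close>, \<open>ex_represents\<close>). The products \<open>SU\<close> and \<open>SV\<close> are the two elementary
  matrices with nonnegative entries, and a hyperbolic element is conjugate up to sign to a product
  \<open>w\<close> of such factors, unique up to rotation. If \<open>h\<close> is not conjugate to its inverse, the
  inverse word of \<open>w\<close> is not a rotation of \<open>w\<close>, hence never occurs in a power of \<open>w\<close>. Therefore the
  number of occurrences of \<open>w\<close> minus that of the inverse of \<open>w\<close> (a counting quasimorphism in the
  sense of Brooks) is a quasimorphism \<open>\<phi>\<close> that grows linearly along the powers of \<open>h\<close>. It is
  bounded on elliptic elements, which are conjugate to words of length at most 1 up to sign, and on
  parabolic elements: up to sign these are conjugate to powers of \<open>SU\<close>, whose words cannot contain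
  \<open>w\<close>, as \<open>w\<close> contains both \<open>U\<close> and \<open>V\<close> (\<open>ex_quasimorphism_unbounded_on_powers\<close>).

  A quasimorphism is bounded on commutators, so \<open>\<phi>\<close> is Lipschitz on a large scale for the
  biinvariant metric, and it still grows linearly along every sequence close to the powers of \<open>h\<close>. On
  the other hand, suppose that \<open>A\<close> maps a nonzero integral row vector \<open>l\<close> to \<open>m\<close>, both with
  entries below \<open>2^j\<close>. Up to a common factor, \<open>l\<close> and \<open>m\<close> are the bottom rows of matrices \<open>X\<close> and \<open>Y\<close>
  obtained by at most \<open>j\<close> steps of the Euclidean algorithm, and \<open>X A\<close> differs from \<open>Y\<close> by a unipotent
  factor; each of these steps costs a bounded amount, so \<open>\<bar>\<phi> A\<bar>\<close> is \<open>O(j)\<close>. It follows that the \<open>k\<close>-th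
  element of the sequence maps no nonzero frequency below \<open>exp (c k)\<close> to another such frequency, for
  some \<open>c > 0\<close> (\<open>ball_separates_frequencies\<close>).

  For such matrices the correlation of two trigonometric polynomials of degree below \<open>exp (c k)\<close>
  vanishes. A Hoelder function is approximated uniformly by trigonometric polynomials of degree \<open>N\<close>
  with an error bounded by a negative power of \<open>N\<close> (\<open>hoelder_approximation\<close>), and this gives the
  exponential decay. Mixing follows, because Hoelder functions are dense in \<open>L\<^sup>2\<close> and because the
  correlations are controlled by \<open>L\<^sup>2\<close> norms uniformly in the matrix, the action being measure
  preserving.
\<close>

section \<open>Integral two-by-two matrices up to sign\<close>

definition mat2 :: "int \<Rightarrow> int \<Rightarrow> int \<Rightarrow> int \<Rightarrow> int^2^2" where
  "mat2 a b c d = vector [vector [a, b], vector [c, d]]"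

lemma mat2_nth [simp]:
  "mat2 a b c d $ 1 $ 1 = a" "mat2 a b c d $ 1 $ 2 = b"
  "mat2 a b c d $ 2 $ 1 = c" "mat2 a b c d $ 2 $ 2 = d"
  by (simp_all add: mat2_def)

lemma mat2_cases [cases type]: obtains a b c d where "A = mat2 a b c d"
  by (metis mat2_nth matrix2_eq_iff)

lemma mat2_eq_iff [simp]:
  "mat2 a b c d = mat2 a' b' c' d' \<longleftrightarrow> a = a' \<and> b = b' \<and> c = c' \<and> d = d'"
  by (simp add: matrix2_eq_iff)

lemma mat2_mult [simp]:
  "mat2 a b c d ** mat2 a' b' c' d' =
     mat2 (a * a' + b * c') (a * b' + b * d') (c * a' + d * c') (c * b' + d * d')"
  by (simp add: matrix2_eq_iff matrix_matrix_mult_def sum_2)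

lemma mat2_uminus [simp]: "- mat2 a b c d = mat2 (-a) (-b) (-c) (-d)"
  by (simp add: matrix2_eq_iff)

lemma mat_1_eq_mat2: "mat 1 = mat2 1 0 0 1"
  by (simp add: matrix2_eq_iff mat_def)

lemma det_mat2 [simp]: "det (mat2 a b c d) = a * d - b * c"
  by (simp add: det_2)

lemma trace_mat2 [simp]: "trace (mat2 a b c d) = a + d"
  by (simp add: trace_def sum_2)

lemma matrix_mult_uminus_left: "(- A) ** B = - (A ** B)" for A B :: "int^2^2"
  by (cases A, cases B) (simp)

lemma matrix_mult_uminus_right: "A ** (- B) = - (A ** B)" for A B :: "int^2^2"
  by (cases A, cases B) (simp)

lemma inv_SL2Z_mat2:
  assumes "a * d - b * c = 1"
  shows "inv\<^bsub>SL2Z\<^esub> (mat2 a b c d) = mat2 d (-b) (-c) a"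
  by (rule SL2Z.inv_equality) (use assms in \<open>simp_all add: mat_1_eq_mat2 algebra_simps\<close>)

lemma det_inv_SL2Z: "det A = 1 \<Longrightarrow> det (inv\<^bsub>SL2Z\<^esub> A) = 1"
  using SL2Z.inv_closed[of A] by simp

text \<open>
  Working up to sign avoids the passage to the quotient \<open>PSL(2,Z)\<close>, in which the reduced words live.
\<close>
definition eq_up_to_sign :: "int^2^2 \<Rightarrow> int^2^2 \<Rightarrow> bool" (infix "=\<^sub>\<plusminus>" 50) where
  "A =\<^sub>\<plusminus> B \<longleftrightarrow> A = B \<or> A = - B"

lemma eq_up_to_sign_refl [simp, intro]: "A =\<^sub>\<plusminus> A"
  by (simp add: eq_up_to_sign_def)

lemma eq_up_to_sign_sym: "A =\<^sub>\<plusminus> B \<Longrightarrow> B =\<^sub>\<plusminus> A"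
  by (auto simp: eq_up_to_sign_def)

lemma eq_up_to_sign_trans [trans]: "A =\<^sub>\<plusminus> B \<Longrightarrow> B =\<^sub>\<plusminus> C \<Longrightarrow> A =\<^sub>\<plusminus> C"
  by (auto simp: eq_up_to_sign_def)

lemma eq_up_to_sign_mult: "A =\<^sub>\<plusminus> A' \<Longrightarrow> B =\<^sub>\<plusminus> B' \<Longrightarrow> A ** B =\<^sub>\<plusminus> A' ** B'"
  by (auto simp: eq_up_to_sign_def matrix_mult_uminus_left matrix_mult_uminus_right)

section \<open>Reduced words\<close>

datatype letter = S | U | V

primrec inv_letter :: "letter \<Rightarrow> letter" where
  "inv_letter S = S"
| "inv_letter U = V"
| "inv_letter V = U"

text \<open>
  The matrices are chosen such that \<open>SU\<close> and \<open>SV\<close> have nonnegative entries, namely \<open>1,1,0,1\<close> and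
  \<open>1,0,1,1\<close>. Up to sign \<open>S\<close> has order 2 and \<open>U\<close> has order 3 with inverse \<open>V\<close>; the inverse matrix
  of \<open>S\<close> is \<open>-S\<close>.
\<close>
primrec letter_matrix :: "letter \<Rightarrow> int^2^2" where
  "letter_matrix S = mat2 0 (-1) 1 0"
| "letter_matrix U = mat2 0 1 (-1) (-1)"
| "letter_matrix V = mat2 1 1 (-1) 0"

definition word_matrix :: "letter list \<Rightarrow> int^2^2" where
  "word_matrix u = foldr (\<lambda>x. (**) (letter_matrix x)) u (mat 1)"

definition inv_word :: "letter list \<Rightarrow> letter list" where
  "inv_word u = rev (map inv_letter u)"

text \<open>
  Since \<open>UU\<close> equals \<open>V\<close> up to sign, and conversely, adjacent letters from the same factor can always be merged.
\<close>
definition reduced :: "letter list \<Rightarrow> bool" where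
  "reduced = successively (\<lambda>x y. (x = S) \<noteq> (y = S))"

lemma inv_letter_inv_letter [simp]: "inv_letter (inv_letter x) = x"
  by (cases x) auto

lemma inv_letter_eq_S [simp]: "inv_letter x = S \<longleftrightarrow> x = S"
  by (cases x) auto

lemma word_matrix_simps [simp]:
  "word_matrix [] = mat 1"
  "word_matrix (x # u) = letter_matrix x ** word_matrix u"
  by (simp_all add: word_matrix_def)

lemma word_matrix_append: "word_matrix (u @ v) = word_matrix u ** word_matrix v"
  by (induction u) (auto simp: matrix_mul_assoc)

lemma inv_word_simps [simp]:
  "inv_word [] = []"
  "inv_word [x] = [inv_letter x]"
  "inv_word (u @ v) = inv_word v @ inv_word u"
  "inv_word (inv_word u) = u"
  "length (inv_word u) = length u"
  by (simp_all add: inv_word_def rev_map o_def)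

lemma inv_word_Cons: "inv_word (x # u) = inv_word u @ [inv_letter x]"
  by (simp add: inv_word_def)

lemma det_word_matrix [simp]: "det (word_matrix u) = 1"
proof (induction u)
  case (Cons x u)
  then show ?case by (cases x) (auto simp: det_mul)
qed simp

lemma letter_inv_letter: "letter_matrix x ** letter_matrix (inv_letter x) =\<^sub>\<plusminus> mat 1"
  by (cases x) (auto simp: eq_up_to_sign_def mat_1_eq_mat2)

lemma letter_square: "x \<noteq> S \<Longrightarrow> letter_matrix x ** letter_matrix x =\<^sub>\<plusminus> letter_matrix (inv_letter x)"
  by (cases x) (auto simp: eq_up_to_sign_def)

lemma word_inv_word: "word_matrix u ** word_matrix (inv_word u) =\<^sub>\<plusminus> mat 1"
proof (induction u)
  case (Cons x u)
  have "word_matrix (x # u) ** word_matrix (inv_word (x # u)) =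
      letter_matrix x ** ((word_matrix u ** word_matrix (inv_word u)) ** letter_matrix (inv_letter x))"
    by (simp add: inv_word_Cons word_matrix_append matrix_mul_assoc)
  also have "\<dots> =\<^sub>\<plusminus> letter_matrix x ** (mat 1 ** letter_matrix (inv_letter x))"
    by (intro eq_up_to_sign_mult Cons eq_up_to_sign_refl)
  also have "\<dots> =\<^sub>\<plusminus> mat 1"
    by (simp add: letter_inv_letter)
  finally show ?case .
qed simp

lemma word_matrix_inv_word:
  assumes "A \<in> carrier SL2Z" "word_matrix u =\<^sub>\<plusminus> A"
  shows "word_matrix (inv_word u) =\<^sub>\<plusminus> inv\<^bsub>SL2Z\<^esub> A"
proof -
  let ?B = "inv\<^bsub>SL2Z\<^esub> A"
  have BA: "?B ** A = mat 1"
    using SL2Z.l_inv[OF assms(1)] by simp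
  have "word_matrix (inv_word u) = ?B ** A ** word_matrix (inv_word u)"
    unfolding BA matrix_mul_lid ..
  also have "\<dots> =\<^sub>\<plusminus> ?B ** word_matrix u ** word_matrix (inv_word u)"
    by (intro eq_up_to_sign_mult eq_up_to_sign_refl eq_up_to_sign_sym[OF assms(2)])
  also have "\<dots> = ?B ** (word_matrix u ** word_matrix (inv_word u))"
    by (simp add: matrix_mul_assoc)
  also have "\<dots> =\<^sub>\<plusminus> ?B ** mat 1"
    by (intro eq_up_to_sign_mult eq_up_to_sign_refl word_inv_word)
  finally show ?thesis by simp
qed

lemma reduced_inv_word: "reduced u \<Longrightarrow> reduced (inv_word u)"
  unfolding reduced_def inv_word_def successively_rev successively_map inv_letter_eq_S
  by (erule successively_mono) auto

text \<open>
  What happens when two reduced words are concatenated: a common part \<open>c\<close> cancels, and then either the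
  rest is reduced or two equal letters \<open>x\<close> of order 3 meet, which merge into the inverse of \<open>x\<close> and
  stop the cancellation.
\<close>
inductive cancels :: "letter list \<Rightarrow> letter list \<Rightarrow> bool" where
  cut: "reduced (a @ b) \<Longrightarrow> cancels (a @ c) (inv_word c @ b)"
| merge: "x \<noteq> S \<Longrightarrow> reduced (a @ inv_letter x # b) \<Longrightarrow> cancels (a @ x # c) (inv_word c @ x # b)"

lemma cancels_snoc_Cons:
  assumes "cancels u v"
  shows "cancels (u @ [x]) (inv_letter x # v)"
  using assms
proof cases
  case (cut a b c)
  then show ?thesis using cancels.cut[of a b "c @ [x]"] by simp
next
  case (merge y a b c)
  then show ?thesis using cancels.merge[of y a b "c @ [x]"] by simp
qed

lemma cancellation:
  assumes "reduced u" "reduced v"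
  shows "cancels u v"
  using assms
proof (induction u arbitrary: v rule: rev_induct)
  case Nil
  then show ?case using cut[of "[]" v "[]"] by simp
next
  case (snoc x u)
  show ?case
  proof (cases v)
    case Nil
    with snoc.prems show ?thesis using cut[of "u @ [x]" "[]" "[]"] by simp
  next
    case (Cons y w)
    consider "y = inv_letter x" | "(x = S) \<noteq> (y = S)" | "x = y" "x \<noteq> S"
      by (cases x; cases y) auto
    then show ?thesis
    proof cases
      case 1
      have "reduced u" "reduced w"
        using snoc.prems Cons by (auto simp: reduced_def successively_append_iff successively_Cons)
      then show ?thesis
        using cancels_snoc_Cons snoc.IH by (simp add: Cons 1)
    next
      case 2
      then have "reduced ((u @ [x]) @ v)"
        using snoc.prems Cons by (auto simp: reduced_def successively_append_iff)
      from cut[OF this, of "[]"] show ?thesis by simp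
    next
      case 3
      then have "reduced (u @ inv_letter x # w)"
        using snoc.prems Cons by (auto simp: reduced_def successively_append_iff successively_Cons)
      from merge[OF \<open>x \<noteq> S\<close> this, of "[]"] show ?thesis by (simp add: Cons 3)
    qed
  qed
qed

text \<open>
  The words that spell products of the two elementary matrices \<open>SU\<close> and \<open>SV\<close>.
\<close>
fun positive_word :: "bool list \<Rightarrow> letter list" where
  "positive_word [] = []"
| "positive_word (b # bs) = S # (if b then U else V) # positive_word bs"

lemma positive_word_append: "positive_word (bs @ cs) = positive_word bs @ positive_word cs"
  by (induction bs) auto

lemma reduced_positive_word: "reduced (positive_word bs)"
proof (induction bs)
  case (Cons b bs)
  then show ?case by (cases bs) (auto simp: reduced_def)
qed (simp add: reduced_def)

lemma reduced_starting_with_S: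
  assumes "reduced u" "u \<noteq> []" "hd u = S"
  shows "\<exists>bs. u = positive_word bs \<or> u = positive_word bs @ [S]"
  using assms
proof (induction u rule: induct_list012)
  case (2 x)
  then show ?case by (intro exI[of _ "[]"]) simp
next
  case (3 x y zs)
  have y: "y \<noteq> S" and x: "x = S" and z: "zs \<noteq> [] \<Longrightarrow> hd zs = S" and "reduced zs"
    using "3.prems" by (cases zs; auto simp: reduced_def)+
  then have "\<exists>bs. zs = positive_word bs \<or> zs = positive_word bs @ [S]"
    using "3.IH" by (cases "zs = []") (auto intro: exI[of _ "[]"])
  then obtain bs where bs: "zs = positive_word bs \<or> zs = positive_word bs @ [S]"
    by blast
  show ?case
    by (rule exI[of _ "(y = U) # bs"]) (use bs x y in \<open>cases y; auto\<close>)
qed auto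

text \<open>
  Nonnegative matrices are what makes words detectable: a nonempty product of \<open>SU\<close> and \<open>SV\<close> has a
  nonnegative matrix with a positive off-diagonal entry, so it is none of \<open>1\<close>, \<open>-1\<close>, \<open>S\<close>, \<open>-S\<close>.
\<close>
lemma positive_word_matrix:
  "\<exists>a b c d. word_matrix (positive_word bs) = mat2 a b c d \<and>
     a \<ge> 1 \<and> b \<ge> 0 \<and> c \<ge> 0 \<and> d \<ge> 1 \<and> (bs = [] \<or> b + c \<ge> 1)"
proof (induction bs)
  case Nil
  show ?case by (simp add: mat_1_eq_mat2)
next
  case (Cons e bs)
  then show ?case by (cases e) auto
qed

text \<open>
  Prefixing \<open>S\<close> if necessary gives a word that starts with \<open>S\<close>, hence a positive word followed by at most
  one \<open>S\<close>. If the original word is trivial, the positive part equals \<open>1\<close> or \<open>S\<close> up to sign and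
  must therefore be empty.
\<close>
lemma reduced_trivial:
  assumes "reduced u" "word_matrix u =\<^sub>\<plusminus> mat 1"
  shows "u = []"
proof (rule ccontr)
  assume "u \<noteq> []"
  define v where "v = (if hd u = S then u else S # u)"
  have v: "reduced v" "v \<noteq> []" "hd v = S"
    using assms(1) \<open>u \<noteq> []\<close> by (auto simp: v_def reduced_def successively_Cons)
  have wv: "word_matrix v =\<^sub>\<plusminus> mat 1 \<or> word_matrix v =\<^sub>\<plusminus> letter_matrix S"
  proof (cases "hd u = S")
    case True
    then show ?thesis using assms by (simp add: v_def)
  next
    case False
    then have "word_matrix v =\<^sub>\<plusminus> letter_matrix S ** mat 1"
      unfolding v_def using assms(2) by (simp only: if_False word_matrix_simps)
        (intro eq_up_to_sign_mult eq_up_to_sign_refl)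
    then show ?thesis by simp
  qed
  obtain bs where bs: "v = positive_word bs \<or> v = positive_word bs @ [S]"
    using reduced_starting_with_S[OF v] by blast
  obtain a b c d where m: "word_matrix (positive_word bs) = mat2 a b c d"
    "a \<ge> 1" "b \<ge> 0" "c \<ge> 0" "d \<ge> 1" "bs = [] \<or> b + c \<ge> 1"
    using positive_word_matrix by blast
  have "bs = [] \<and> v = [S]"
    using bs wv m v(2) by (cases "bs = []") (auto simp: word_matrix_append eq_up_to_sign_def mat_1_eq_mat2)
  then have "u = [S]"
    using \<open>u \<noteq> []\<close> by (auto simp: v_def split: if_splits)
  then show False
    using assms(2) by (simp add: eq_up_to_sign_def mat_1_eq_mat2)
qed

lemma word_matrix_cancel: "word_matrix (a @ c) ** word_matrix (inv_word c @ b) =\<^sub>\<plusminus> word_matrix (a @ b)"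
proof -
  have "word_matrix (a @ c) ** word_matrix (inv_word c @ b) =
      word_matrix a ** (word_matrix c ** word_matrix (inv_word c)) ** word_matrix b"
    by (simp add: word_matrix_append matrix_mul_assoc)
  also have "\<dots> =\<^sub>\<plusminus> word_matrix a ** mat 1 ** word_matrix b"
    by (intro eq_up_to_sign_mult eq_up_to_sign_refl word_inv_word)
  finally show ?thesis
    by (simp add: word_matrix_append)
qed

lemma word_matrix_merge:
  assumes "x \<noteq> S"
  shows "word_matrix (a @ x # c) ** word_matrix (inv_word c @ x # b) =\<^sub>\<plusminus>
    word_matrix (a @ inv_letter x # b)"
proof -
  have "word_matrix (a @ x # c) ** word_matrix (inv_word c @ x # b) =\<^sub>\<plusminus> word_matrix (a @ x # x # b)"
    using word_matrix_cancel[of "a @ [x]" c "x # b"] by simp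
  also have "\<dots> = word_matrix a ** (letter_matrix x ** letter_matrix x) ** word_matrix b"
    by (simp add: word_matrix_append matrix_mul_assoc)
  also have "\<dots> =\<^sub>\<plusminus> word_matrix a ** letter_matrix (inv_letter x) ** word_matrix b"
    by (intro eq_up_to_sign_mult eq_up_to_sign_refl letter_square assms)
  finally show ?thesis
    by (simp add: word_matrix_append matrix_mul_assoc)
qed

text \<open>
  If \<open>u\<close> and \<open>v\<close> represent the same element, then \<open>u\<close> times the inverse of \<open>v\<close> is trivial; its
  reduced form is therefore empty, which means that everything cancels.
\<close>
lemma reduced_unique:
  assumes "reduced u" "reduced v" "word_matrix u =\<^sub>\<plusminus> word_matrix v"
  shows "u = v"
proof -
  have "word_matrix u ** word_matrix (inv_word v) =\<^sub>\<plusminus> word_matrix v ** word_matrix (inv_word v)"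
    using assms(3) by (intro eq_up_to_sign_mult eq_up_to_sign_refl)
  also have "\<dots> =\<^sub>\<plusminus> mat 1"
    by (rule word_inv_word)
  finally have uv: "word_matrix u ** word_matrix (inv_word v) =\<^sub>\<plusminus> mat 1" .
  from cancellation[OF assms(1) reduced_inv_word[OF assms(2)]] show ?thesis
  proof cases
    case (cut a b c)
    have "word_matrix (a @ b) =\<^sub>\<plusminus> word_matrix u ** word_matrix (inv_word v)"
      unfolding cut(1,2) by (rule eq_up_to_sign_sym[OF word_matrix_cancel])
    also note uv
    finally have "a @ b = []"
      by (rule reduced_trivial[OF cut(3)])
    then have "inv_word (inv_word v) = inv_word (inv_word u)"
      unfolding cut(1,2) by simp
    then show ?thesis by simp
  next
    case (merge x a b c)
    have "word_matrix (a @ inv_letter x # b) =\<^sub>\<plusminus> word_matrix u ** word_matrix (inv_word v)"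
      unfolding merge(1,2) by (rule eq_up_to_sign_sym[OF word_matrix_merge[OF merge(3)]])
    also note uv
    finally have "a @ inv_letter x # b = []"
      by (rule reduced_trivial[OF merge(4)])
    then show ?thesis by simp
  qed
qed

section \<open>Counting occurrences of a word\<close>

definition positions :: "letter list \<Rightarrow> letter list \<Rightarrow> nat set" where
  "positions w u = {p. \<exists>a b. u = a @ w @ b \<and> length a = p}"

text \<open>
  The Brooks counting function of the word \<open>w\<close>, counting overlapping occurrences. Subtracting the
  occurrences of the inverse word makes it odd under inversion (\<open>signed_count_inv_word\<close>).
\<close>
definition signed_count :: "letter list \<Rightarrow> letter list \<Rightarrow> int" where
  "signed_count w u = int (card (positions w u)) - int (card (positions (inv_word w) u))"

lemma positions_subset: "positions w u \<subseteq> {..length u - length w}"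
  by (auto simp: positions_def)

lemma finite_positions [simp]: "finite (positions w u)"
  using positions_subset by (rule finite_subset) simp

lemma card_positions_inv_word_le: "card (positions w u) \<le> card (positions (inv_word w) (inv_word u))"
proof (rule card_inj_on_le)
  show "inj_on (\<lambda>p. length u - length w - p) (positions w u)"
  proof (rule inj_onI)
    fix p q assume "p \<in> positions w u" "q \<in> positions w u"
      and "length u - length w - p = length u - length w - q"
    moreover have "p \<le> length u - length w" "q \<le> length u - length w"
      using calculation positions_subset[of w u] by blast+
    ultimately show "p = q" by linarith
  qed
  show "(\<lambda>p. length u - length w - p) ` positions w u \<subseteq> positions (inv_word w) (inv_word u)"
  proof clarify
    fix p assume "p \<in> positions w u"
    then obtain a b where "u = a @ w @ b" "length a = p"
      by (auto simp: positions_def)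
    then have "inv_word u = inv_word b @ inv_word w @ inv_word a"
      "length (inv_word b) = length u - length w - p"
      by simp_all
    then show "length u - length w - p \<in> positions (inv_word w) (inv_word u)"
      unfolding positions_def by blast
  qed
qed simp

lemma card_positions_inv_word:
  "card (positions (inv_word w) (inv_word u)) = card (positions w u)"
  using card_positions_inv_word_le[of w u] card_positions_inv_word_le[of "inv_word w" "inv_word u"]
  by simp

lemma signed_count_inv_word: "signed_count w (inv_word u) = - signed_count w u"
  using card_positions_inv_word[of w u] card_positions_inv_word[of "inv_word w" u]
  by (simp add: signed_count_def)

text \<open>
  An occurrence in a concatenation lies in one of the two parts or straddles the junction, and at most
  \<open>length w\<close> starting positions do the latter.
\<close>
lemma card_positions_append:
  assumes "w \<noteq> []"
  shows "card (positions w u) + card (positions w v) \<le> card (positions w (u @ v))"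
    and "card (positions w (u @ v)) \<le> card (positions w u) + card (positions w v) + length w"
proof -
  let ?Q = "(+) (length u) ` positions w v"
  have Q: "card ?Q = card (positions w v)"
    by (rule card_image) simp
  have "positions w u \<inter> ?Q = {}"
    using assms by (fastforce simp: positions_def)
  then have "card (positions w u) + card (positions w v) = card (positions w u \<union> ?Q)"
    by (subst card_Un_disjoint) (simp_all add: Q)
  also have "\<dots> \<le> card (positions w (u @ v))"
  proof (intro card_mono Un_least subsetI finite_positions)
    fix p assume "p \<in> positions w u"
    then obtain a b where "u = a @ w @ b" "length a = p"
      by (auto simp: positions_def)
    then have "u @ v = a @ w @ (b @ v)" "length a = p"
      by auto
    then show "p \<in> positions w (u @ v)"
      unfolding positions_def by blast
  next
    fix p assume "p \<in> ?Q"
    then obtain a b where "v = a @ w @ b" "p = length u + length a"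
      by (auto simp: positions_def)
    then have "u @ v = (u @ a) @ w @ b" "length (u @ a) = p"
      by auto
    then show "p \<in> positions w (u @ v)"
      unfolding positions_def by blast
  qed
  finally show "card (positions w u) + card (positions w v) \<le> card (positions w (u @ v))" .
  have "positions w (u @ v) \<subseteq> positions w u \<union> ?Q \<union> {length u - length w..<length u}"
  proof
    fix p assume "p \<in> positions w (u @ v)"
    then obtain a b where ab: "u @ v = a @ w @ b" "length a = p"
      by (auto simp: positions_def)
    consider "p + length w \<le> length u" | "length u \<le> p" | "p \<in> {length u - length w..<length u}"
      by fastforce
    then show "p \<in> positions w u \<union> ?Q \<union> {length u - length w..<length u}"
    proof cases
      case 1
      then have "take (p + length w) u = take (p + length w) (u @ v)"
        by simp
      also have "\<dots> = a @ w"
        unfolding ab(1) using ab(2) by simp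
      finally have "take (p + length w) u = a @ w" .
      then have "u = a @ w @ drop (p + length w) u"
        by (metis append.assoc append_take_drop_id)
      then show ?thesis
        using ab(2) unfolding positions_def by blast
    next
      case 2
      have "v = drop (length u) (u @ v)"
        by simp
      also have "\<dots> = drop (length u) a @ w @ b"
        unfolding ab(1) using 2 ab(2) by simp
      finally have "v = drop (length u) a @ w @ b" .
      then have "p - length u \<in> positions w v"
        using ab(2) unfolding positions_def by auto
      then show ?thesis
        using 2 by (metis UnI1 UnI2 image_eqI le_add_diff_inverse)
    qed simp
  qed
  then have "card (positions w (u @ v)) \<le> card (positions w u \<union> ?Q \<union> {length u - length w..<length u})"
    by (intro card_mono) auto
  also have "\<dots> \<le> card (positions w u) + card ?Q + card {length u - length w..<length u}"
    by (intro order.trans[OF card_Un_le] add_mono card_Un_le order.refl)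
  finally show "card (positions w (u @ v)) \<le> card (positions w u) + card (positions w v) + length w"
    by (simp add: Q)
qed

lemma signed_count_append:
  assumes "w \<noteq> []"
  shows "\<bar>signed_count w (u @ v) - signed_count w u - signed_count w v\<bar> \<le> int (length w)"
proof -
  have "inv_word w \<noteq> []"
    using assms by (simp add: inv_word_def)
  from card_positions_append[OF this, of u v] card_positions_append[OF assms, of u v]
  show ?thesis
    unfolding signed_count_def inv_word_simps by linarith
qed

lemma signed_count_letter:
  assumes "w \<noteq> []"
  shows "\<bar>signed_count w [x]\<bar> \<le> 1"
proof -
  have *: "card (positions v [x]) \<le> 1" if "v \<noteq> []" for v
  proof -
    have "positions v [x] \<subseteq> {..length [x] - length v}"
      by (rule positions_subset)
    also have "\<dots> \<subseteq> {0}"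
      using that by (cases v) auto
    finally show ?thesis
      using card_mono[of "{0::nat}"] by fastforce
  qed
  have "inv_word w \<noteq> []"
    using assms by (simp add: inv_word_def)
  then show ?thesis
    using *[OF assms] *[of "inv_word w"] by (simp add: signed_count_def)
qed

section \<open>Reduced words of elements of the modular group\<close>

definition represents :: "letter list \<Rightarrow> int^2^2 \<Rightarrow> bool" where
  "represents u g \<longleftrightarrow> reduced u \<and> word_matrix u =\<^sub>\<plusminus> g"

lemma represents_unique: "represents u g \<Longrightarrow> represents v g \<Longrightarrow> u = v"
  unfolding represents_def
  by (metis eq_up_to_sign_sym eq_up_to_sign_trans reduced_unique)

text \<open>
  The quasimorphism inequality. In the notation of \<open>cancels\<close>, the counts of \<open>u\<close> and \<open>v\<close> are, up to
  boundary effects, those of \<open>a\<close> plus \<open>c\<close> and of the inverse of \<open>c\<close> plus \<open>b\<close>. The contributions of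
  \<open>c\<close> cancel because the count is odd under inversion.
\<close>
lemma represents_mult:
  assumes "w \<noteq> []" "represents u g" "represents v h"
  shows "\<exists>z. represents z (g ** h) \<and>
    \<bar>signed_count w z - signed_count w u - signed_count w v\<bar> \<le> 6 * int (length w) + 3"
proof -
  have uv: "word_matrix u ** word_matrix v =\<^sub>\<plusminus> g ** h"
    using assms by (simp add: represents_def eq_up_to_sign_mult)
  let ?f = "signed_count w"
  note app = signed_count_append[OF assms(1)]
  have "cancels u v"
    using assms by (intro cancellation) (simp_all add: represents_def)
  then show ?thesis
  proof cases
    case (cut a b c)
    have "word_matrix (a @ b) =\<^sub>\<plusminus> word_matrix u ** word_matrix v"
      unfolding cut(1,2) by (rule eq_up_to_sign_sym[OF word_matrix_cancel])
    also note uv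
    finally have "represents (a @ b) (g ** h)"
      using cut by (simp add: represents_def)
    moreover have "\<bar>?f (a @ b) - ?f u - ?f v\<bar> \<le> 6 * int (length w) + 3"
      unfolding cut(1,2)
      using app[of a b] app[of a c] app[of "inv_word c" b] signed_count_inv_word[of w c]
      unfolding abs_le_iff by linarith
    ultimately show ?thesis by blast
  next
    case (merge x a b c)
    have "word_matrix (a @ inv_letter x # b) =\<^sub>\<plusminus> word_matrix u ** word_matrix v"
      unfolding merge(1,2) by (rule eq_up_to_sign_sym[OF word_matrix_merge[OF merge(3)]])
    also note uv
    finally have "represents (a @ inv_letter x # b) (g ** h)"
      using merge by (simp add: represents_def)
    moreover have "\<bar>?f (a @ inv_letter x # b) - ?f u - ?f v\<bar> \<le> 6 * int (length w) + 3"
      unfolding merge(1,2)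
      using app[of a "[x] @ c"] app[of "[x]" c] app[of "inv_word c" "[x] @ b"] app[of "[x]" b]
        app[of a "[inv_letter x] @ b"] app[of "[inv_letter x]" b]
        signed_count_letter[OF assms(1), of x] signed_count_letter[OF assms(1), of "inv_letter x"]
        signed_count_inv_word[of w c]
      unfolding abs_le_iff append.simps by linarith
    ultimately show ?thesis by blast
  qed
qed

lemma represents_inv_word:
  "det g = 1 \<Longrightarrow> represents u g \<Longrightarrow> represents (inv_word u) (inv\<^bsub>SL2Z\<^esub> g)"
  by (simp add: represents_def reduced_inv_word word_matrix_inv_word)

text \<open>
  Only one of the letters \<open>U\<close> and \<open>V\<close> is needed for a power of \<open>SU\<close>. A counting function of a word with
  both letters therefore vanishes on these matrices.
\<close>
lemma represents_shear:
  "\<exists>u. represents u (mat2 1 n 0 1) \<and> (U \<notin> set u \<or> V \<notin> set u)"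
proof -
  have pos: "word_matrix (positive_word (replicate m True)) = mat2 1 (int m) 0 1" for m
    by (induction m) (simp_all add: mat_1_eq_mat2)
  have V: "V \<notin> set (positive_word (replicate m True))" for m
    by (induction m) simp_all
  have rep: "represents (positive_word (replicate m True)) (mat2 1 (int m) 0 1)" for m
    by (simp add: represents_def reduced_positive_word pos)
  show ?thesis
  proof (cases "n \<ge> 0")
    case True
    then show ?thesis
      using rep[of "nat n"] V[of "nat n"] by auto
  next
    case False
    let ?u = "positive_word (replicate (nat (-n)) True)"
    have "represents (inv_word ?u) (inv\<^bsub>SL2Z\<^esub> (mat2 1 (-n) 0 1))"
      using rep[of "nat (-n)"] False by (intro represents_inv_word) simp_all
    moreover have "U \<notin> set (inv_word ?u)"
      using V[of "nat (-n)"] by (auto simp: inv_word_def dest: arg_cong[of _ _ inv_letter])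
    ultimately show ?thesis
      by (auto simp: inv_SL2Z_mat2)
  qed
qed

lemma signed_count_eq_0:
  assumes "U \<in> set w" "V \<in> set w" "U \<notin> set u \<or> V \<notin> set u"
  shows "signed_count w u = 0"
proof -
  have *: "positions v u = {}" if "U \<in> set v" "V \<in> set v" for v
    using that assms(3) by (auto simp: positions_def)
  have "U \<in> set (inv_word w)" "V \<in> set (inv_word w)"
    using assms(1,2) by (force simp: inv_word_def)+
  then show ?thesis
    using *[OF assms(1,2)] *[of "inv_word w"] by (simp add: signed_count_def)
qed

text \<open>
  The matrices built by \<open>n\<close> steps of the Euclidean algorithm. Their point is twofold: every primitive row
  is the bottom row of such a matrix, and a quasimorphism that is bounded on \<open>S\<close> and on shears grows
  at most linearly in \<open>n\<close> on them.
\<close>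
inductive euclid_product :: "nat \<Rightarrow> int^2^2 \<Rightarrow> bool" where
  "e = 1 \<or> e = -1 \<Longrightarrow> euclid_product 0 (mat2 e 0 0 e)"
| "euclid_product n X \<Longrightarrow> euclid_product (Suc n) (X ** mat2 0 1 (-1) 0 ** mat2 1 q 0 1)"

lemma det_euclid_product: "euclid_product n X \<Longrightarrow> det X = 1"
  by (induction rule: euclid_product.induct) (auto simp: det_mul)

text \<open>
  Division with the remainder of least absolute value halves the first entry in every step, so \<open>k\<close>
  steps suffice for an entry below \<open>2^k\<close>. This makes the bound logarithmic in the size of the row.
\<close>
lemma euclid_product_bottom_row:
  assumes "coprime c d" "\<bar>c\<bar> < 2 ^ k"
  shows "\<exists>n X. n \<le> k \<and> euclid_product n X \<and> X $ 2 $ 1 = c \<and> X $ 2 $ 2 = d"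
  using assms
proof (induction k arbitrary: c d)
  case 0
  then have "c = 0" by simp
  with 0 have "d = 1 \<or> d = -1"
    by (auto simp: abs_if split: if_splits)
  then show ?case
    using euclid_product.intros(1)[of d] \<open>c = 0\<close> by (metis mat2_nth le_refl)
next
  case (Suc k)
  show ?case
  proof (cases "c = 0")
    case True
    then have "d = 1 \<or> d = -1"
      using Suc.prems by (auto simp: abs_if split: if_splits)
    then show ?thesis
      using euclid_product.intros(1)[of d] True by (metis mat2_nth le0)
  next
    case False
    \<comment> \<open>A quotient \<open>q\<close> for which the remainder is at most half of \<open>c\<close> in absolute value.\<close>
    define s where "s = sgn c"
    have s: "s * c = \<bar>c\<bar>" "s * s = 1"
      using False by (auto simp: s_def sgn_if)
    define m where "m = d mod \<bar>c\<bar>"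
    have m: "0 \<le> m" "m < \<bar>c\<bar>" "d = \<bar>c\<bar> * (d div \<bar>c\<bar>) + m"
      using False by (auto simp: m_def)
    obtain q where q: "2 * \<bar>d - q * c\<bar> \<le> \<bar>c\<bar>"
    proof (cases "2 * m \<le> \<bar>c\<bar>")
      case True
      have "d - s * (d div \<bar>c\<bar>) * c = d - (s * c) * (d div \<bar>c\<bar>)"
        by (simp add: algebra_simps)
      also have "\<dots> = m"
        unfolding s(1) using m(3) by linarith
      finally have "d - s * (d div \<bar>c\<bar>) * c = m" .
      then show ?thesis
        using that[of "s * (d div \<bar>c\<bar>)"] True m(1) by (simp only: abs_of_nonneg)
    next
      case False
      have "d - s * (d div \<bar>c\<bar> + 1) * c = d - (s * c) * (d div \<bar>c\<bar>) - s * c"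
        by (simp add: algebra_simps)
      also have "\<dots> = m - \<bar>c\<bar>"
        unfolding s(1) using m(3) by linarith
      finally have "d - s * (d div \<bar>c\<bar> + 1) * c = m - \<bar>c\<bar>" .
      moreover have "\<bar>m - \<bar>c\<bar>\<bar> = \<bar>c\<bar> - m"
        using m(2) by (simp only: abs_of_neg)
      moreover have "2 * (\<bar>c\<bar> - m) \<le> \<bar>c\<bar>"
        using False by (simp only: right_diff_distrib)
      ultimately show ?thesis
        using that[of "s * (d div \<bar>c\<bar> + 1)"] by metis
    qed
    define r where "r = d - q * c"
    have "coprime r (- c)"
      using Suc.prems(1) gcd_add_mult[of c "- q" d]
      by (simp add: r_def coprime_iff_gcd_eq_1 gcd.commute)
    moreover have "\<bar>r\<bar> < 2 ^ k"
      using q Suc.prems(2) by (simp add: r_def)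
    ultimately obtain n X where X: "n \<le> k" "euclid_product n X" "X $ 2 $ 1 = r" "X $ 2 $ 2 = - c"
      using Suc.IH by blast
    \<comment> \<open>The two factors turn the bottom row \<open>(r, -c)\<close> into \<open>(c, r)\<close> and then into \<open>(c, q c + r)\<close>.\<close>
    let ?Y = "X ** mat2 0 1 (-1) 0 ** mat2 1 q 0 1"
    have "?Y $ 2 $ 1 = c" "?Y $ 2 $ 2 = d"
      using X(3,4) by (cases X; simp add: r_def algebra_simps)+
    then show ?thesis
      using X(1) euclid_product.intros(2)[OF X(2), of q] by (metis Suc_le_mono)
  qed
qed

text \<open>
  The factor is the quotient of \<open>g\<close> and \<open>X\<close>, whose bottom row is \<open>(0, 1)\<close>.
\<close>
lemma same_bottom_row:
  assumes "det g = 1" "det X = 1" "g $ 2 $ 1 = X $ 2 $ 1" "g $ 2 $ 2 = X $ 2 $ 2"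
  shows "\<exists>n. g = mat2 1 n 0 1 ** X"
proof -
  obtain a b c d where g: "g = mat2 a b c d" by (cases g)
  obtain a' b' c' d' where X: "X = mat2 a' b' c' d'" by (cases X)
  have c: "c' = c" "d' = d" and d1: "b * c = a * d - 1" and d2: "b' * c = a' * d - 1"
    using assms by (auto simp: g X)
  have "a' + (b * a' - a * b') * c = a' + a' * (b * c) - a * (b' * c)"
    by (simp add: algebra_simps)
  also have "\<dots> = a"
    unfolding d1 d2 by (simp add: algebra_simps)
  finally have "a = a' + (b * a' - a * b') * c" ..
  moreover have "b' + (b * a' - a * b') * d = b' + b * (a' * d) - b' * (a * d)"
    by (simp add: algebra_simps)
  moreover have "\<dots> = b' + b * (b' * c + 1) - b' * (b * c + 1)"
    by (simp add: d1 d2)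
  moreover have "\<dots> = b"
    by (simp add: algebra_simps)
  ultimately have "g = mat2 1 (b * a' - a * b') 0 1 ** X"
    by (simp add: g X c)
  then show ?thesis ..
qed

lemma ex_represents_mult:
  "represents u g \<Longrightarrow> represents v h \<Longrightarrow> \<exists>z. represents z (g ** h)"
  using represents_mult[of "[S]" u g v h] by auto

lemma euclid_product_represents: "euclid_product n X \<Longrightarrow> \<exists>u. represents u X"
proof (induction rule: euclid_product.induct)
  case (1 e)
  then have "represents [] (mat2 e 0 0 e)"
    by (auto simp: represents_def reduced_def eq_up_to_sign_def mat_1_eq_mat2)
  then show ?case ..
next
  case (2 n X q)
  have "represents [S] (mat2 0 1 (-1) 0)"
    by (simp add: represents_def reduced_def eq_up_to_sign_def)
  with 2 show ?case
    using ex_represents_mult represents_shear[of q] by blast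
qed

lemma coprime_bottom_row:
  fixes g :: "int^2^2"
  assumes "det g = 1"
  shows "coprime (g $ 2 $ 1) (g $ 2 $ 2)"
  using assms unfolding det_2
  by (metis coprimeI dvd_diff dvd_mult dvd_mult2 mult.commute)

lemma ex_represents:
  assumes "det g = 1"
  shows "\<exists>u. represents u g"
proof -
  obtain k where k: "\<bar>g $ 2 $ 1\<bar> < 2 ^ k"
  proof
    show "\<bar>g $ 2 $ 1\<bar> < 2 ^ nat \<bar>g $ 2 $ 1\<bar>"
      using of_nat_less_two_power[of "nat \<bar>g $ 2 $ 1\<bar>", where ?'a = int] by simp
  qed
  have "coprime (g $ 2 $ 1) (g $ 2 $ 2)"
    by (rule coprime_bottom_row[OF assms])
  then obtain n X where X: "euclid_product n X" "X $ 2 $ 1 = g $ 2 $ 1" "X $ 2 $ 2 = g $ 2 $ 2"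
    using euclid_product_bottom_row[OF _ k] by blast
  then obtain m where "g = mat2 1 m 0 1 ** X"
    using same_bottom_row[OF assms det_euclid_product] by metis
  then show ?thesis
    using ex_represents_mult represents_shear[of m] euclid_product_represents[OF X(1)] by blast
qed

section \<open>Conjugacy up to sign and cyclic words\<close>

definition conjugate_up_to_sign :: "int^2^2 \<Rightarrow> int^2^2 \<Rightarrow> bool" where
  "conjugate_up_to_sign g k \<longleftrightarrow> (\<exists>x. det x = 1 \<and> x ** g =\<^sub>\<plusminus> k ** x)"

lemma conjugate_up_to_sign_refl: "g =\<^sub>\<plusminus> k \<Longrightarrow> conjugate_up_to_sign g k"
  unfolding conjugate_up_to_sign_def by (intro exI[of _ "mat 1"]) simp

lemma conjugate_up_to_sign_trans [trans]:
  assumes "conjugate_up_to_sign g k" "conjugate_up_to_sign k l"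
  shows "conjugate_up_to_sign g l"
proof -
  obtain x y where x: "det x = 1" "x ** g =\<^sub>\<plusminus> k ** x" and y: "det y = 1" "y ** k =\<^sub>\<plusminus> l ** y"
    using assms by (auto simp: conjugate_up_to_sign_def)
  have "(y ** x) ** g = y ** (x ** g)"
    by (simp add: matrix_mul_assoc)
  also have "\<dots> =\<^sub>\<plusminus> y ** (k ** x)"
    by (intro eq_up_to_sign_mult eq_up_to_sign_refl x)
  also have "\<dots> = (y ** k) ** x"
    by (simp add: matrix_mul_assoc)
  also have "\<dots> =\<^sub>\<plusminus> (l ** y) ** x"
    by (intro eq_up_to_sign_mult eq_up_to_sign_refl y)
  finally have "(y ** x) ** g =\<^sub>\<plusminus> l ** (y ** x)"
    by (simp add: matrix_mul_assoc)
  then show ?thesis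
    unfolding conjugate_up_to_sign_def using x(1) y(1) by (intro exI[of _ "y ** x"]) (simp add: det_mul)
qed

lemma inverse_cancel:
  assumes "det x = 1"
  shows "inv\<^bsub>SL2Z\<^esub> x ** x = mat 1" "x ** inv\<^bsub>SL2Z\<^esub> x = mat 1"
  using SL2Z.l_inv[of x] SL2Z.r_inv[of x] assms by simp_all

lemma conjugate_up_to_sign_sym:
  assumes "conjugate_up_to_sign g k"
  shows "conjugate_up_to_sign k g"
proof -
  obtain x where x: "det x = 1" "x ** g =\<^sub>\<plusminus> k ** x"
    using assms by (auto simp: conjugate_up_to_sign_def)
  let ?y = "inv\<^bsub>SL2Z\<^esub> x"
  have "?y ** k = ?y ** (k ** x) ** ?y"
    by (simp add: matrix_mul_assoc[symmetric] inverse_cancel x(1))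
  also have "\<dots> =\<^sub>\<plusminus> ?y ** (x ** g) ** ?y"
    by (intro eq_up_to_sign_mult eq_up_to_sign_refl eq_up_to_sign_sym[OF x(2)])
  also have "\<dots> = g ** ?y"
    by (simp add: matrix_mul_assoc inverse_cancel x(1))
  finally show ?thesis
    unfolding conjugate_up_to_sign_def using det_inv_SL2Z[OF x(1)] by blast
qed

lemma conjugate_up_to_sign_rotate:
  "conjugate_up_to_sign (word_matrix (u @ v)) (word_matrix (v @ u))"
  unfolding conjugate_up_to_sign_def
  by (intro exI[of _ "word_matrix v"]) (simp add: word_matrix_append matrix_mul_assoc)

lemma abs_trace_conjugate_up_to_sign:
  assumes "conjugate_up_to_sign g k"
  shows "\<bar>trace g\<bar> = \<bar>trace k\<bar>"
proof -
  obtain x where x: "det x = 1" "x ** g =\<^sub>\<plusminus> k ** x"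
    using assms by (auto simp: conjugate_up_to_sign_def)
  let ?y = "inv\<^bsub>SL2Z\<^esub> x"
  have "g = ?y ** (x ** g)"
    by (simp add: matrix_mul_assoc inverse_cancel x(1))
  also have "\<dots> =\<^sub>\<plusminus> ?y ** (k ** x)"
    by (intro eq_up_to_sign_mult eq_up_to_sign_refl x)
  finally have "\<bar>trace g\<bar> = \<bar>trace (?y ** (k ** x))\<bar>"
    by (auto simp: eq_up_to_sign_def trace_def sum_2)
  also have "trace (?y ** (k ** x)) = trace ((k ** x) ** ?y)"
    by (rule trace_mul_sym)
  also have "(k ** x) ** ?y = k"
    by (simp add: matrix_mul_assoc[symmetric] inverse_cancel x(1))
  finally show ?thesis .
qed

lemma conjugate_up_to_sign_inverse:
  assumes "det h = 1" "conjugate_up_to_sign h (word_matrix w)"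
  shows "conjugate_up_to_sign (inv\<^bsub>SL2Z\<^esub> h) (word_matrix (inv_word w))"
proof -
  obtain x where x: "det x = 1" "x ** h =\<^sub>\<plusminus> word_matrix w ** x"
    using assms by (auto simp: conjugate_up_to_sign_def)
  let ?h' = "inv\<^bsub>SL2Z\<^esub> h" and ?w' = "word_matrix (inv_word w)"
  have "x ** ?h' = mat 1 ** (x ** ?h')"
    by simp
  also have "\<dots> =\<^sub>\<plusminus> (?w' ** word_matrix w) ** (x ** ?h')"
    using word_inv_word[of "inv_word w"]
    by (intro eq_up_to_sign_mult eq_up_to_sign_refl) (simp add: eq_up_to_sign_sym)
  also have "\<dots> = ?w' ** ((word_matrix w ** x) ** ?h')"
    by (simp add: matrix_mul_assoc)
  also have "\<dots> =\<^sub>\<plusminus> ?w' ** ((x ** h) ** ?h')"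
    by (intro eq_up_to_sign_mult eq_up_to_sign_refl eq_up_to_sign_sym[OF x(2)])
  also have "\<dots> = ?w' ** x"
    by (simp add: matrix_mul_assoc[symmetric] inverse_cancel assms(1))
  finally show ?thesis
    unfolding conjugate_up_to_sign_def using x(1) by blast
qed

text \<open>
  An element and its inverse have the same trace, so a nonzero trace decides the sign.
\<close>
lemma conjugate_up_to_sign_inverse_imp_conjugate:
  assumes "det h = 1" "conjugate_up_to_sign h (inv\<^bsub>SL2Z\<^esub> h)" "trace h \<noteq> 0"
  shows "conjugate h (inv\<^bsub>SL2Z\<^esub> h)"
proof -
  let ?h' = "inv\<^bsub>SL2Z\<^esub> h"
  obtain y where y: "det y = 1" "y ** h =\<^sub>\<plusminus> ?h' ** y"
    using assms by (auto simp: conjugate_up_to_sign_def)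
  let ?y' = "inv\<^bsub>SL2Z\<^esub> y"
  have h': "?h' = (?h' ** y) ** ?y'"
    by (simp add: matrix_mul_assoc[symmetric] inverse_cancel y(1))
  have "y ** h \<noteq> - (?h' ** y)"
  proof
    assume "y ** h = - (?h' ** y)"
    then have "?h' = - ((y ** h) ** ?y')"
      using h' by (simp add: matrix_mult_uminus_left)
    then have "trace ?h' = - trace ((y ** h) ** ?y')"
      by (simp add: trace_def sum_2)
    also have "trace ((y ** h) ** ?y') = trace (?y' ** (y ** h))"
      by (rule trace_mul_sym)
    also have "?y' ** (y ** h) = h"
      by (simp add: matrix_mul_assoc inverse_cancel y(1))
    finally have "trace ?h' = - trace h" .
    moreover have "trace ?h' = trace h"
      using assms(1) by (cases h) (simp add: inv_SL2Z_mat2)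
    ultimately show False
      using assms(3) by simp
  qed
  then have "?h' = y ** h ** ?y'"
    using y(2) h' by (simp add: eq_up_to_sign_def)
  then show ?thesis
    unfolding conjugate_def using y(1) by (intro bexI[of _ y]) simp_all
qed

text \<open>
  Rotating a word is a conjugation. If the first and last letters of a reduced word come from the
  same factor, a rotation lets them cancel or merge and shortens the word; otherwise the word becomes,
  after at most one rotation, one that starts with \<open>S\<close> and does not end with \<open>S\<close>, and that is a
  positive word.
\<close>
lemma conjugate_to_letter_or_positive:
  assumes "represents u g"
  shows "\<exists>v. conjugate_up_to_sign g (word_matrix v) \<and>
    (v = [] \<or> (\<exists>x. v = [x]) \<or> (\<exists>bs. bs \<noteq> [] \<and> v = positive_word bs))"
  using assms
proof (induction "length u" arbitrary: u g rule: less_induct)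
  case less
  have red: "reduced u" and "word_matrix u =\<^sub>\<plusminus> g"
    using less.prems by (simp_all add: represents_def)
  then have gu: "conjugate_up_to_sign g (word_matrix u)"
    by (intro conjugate_up_to_sign_refl) (rule eq_up_to_sign_sym)
  have shorter: ?case if "reduced v" "length v < length u" "conjugate_up_to_sign g (word_matrix v)" for v
  proof -
    have "represents v (word_matrix v)"
      using that by (simp add: represents_def)
    from less.hyps[OF that(2) this] show ?thesis
      using that(3) conjugate_up_to_sign_trans by blast
  qed
  have pos: ?case if v: "reduced v" "v \<noteq> []" "hd v = S" "last v \<noteq> S"
    and gv: "conjugate_up_to_sign g (word_matrix v)" for v
  proof -
    obtain bs where "v = positive_word bs \<or> v = positive_word bs @ [S]"
      using reduced_starting_with_S[OF v(1-3)] by blast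
    with v(4) have bs: "v = positive_word bs"
      by (metis last_snoc)
    with v(2) have "bs \<noteq> []"
      by auto
    with bs gv show ?thesis
      by blast
  qed
  show ?case
  proof (cases "length u \<le> 1")
    case True
    then have "u = [] \<or> (\<exists>x. u = [x])"
      by (cases u) auto
    with gu show ?thesis by blast
  next
    case False
    then obtain x v y where u: "u = x # v @ [y]"
      by (cases u) (auto, metis append_butlast_last_id)
    have rot: "conjugate_up_to_sign g (word_matrix (y # x # v))"
      using conjugate_up_to_sign_trans[OF gu] conjugate_up_to_sign_rotate[of "x # v" "[y]"]
      by (simp add: u)
    have v: "reduced v" "reduced (x # v)" "v \<noteq> [] \<Longrightarrow> (hd v = S) \<noteq> (x = S)"
      using red by (auto simp: u reduced_def successively_Cons successively_append_iff)
    consider "x = S" "y \<noteq> S" | "x \<noteq> S" "y = S" | "y = inv_letter x" | "y = x" "x \<noteq> S"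
      by (cases x; cases y) auto
    then show ?thesis
    proof cases
      case 1
      then show ?thesis using pos[OF red _ _ _ gu] by (simp add: u)
    next
      case 2
      have "reduced (y # x # v)"
        using v 2 by (simp add: reduced_def)
      moreover have "last (y # x # v) \<noteq> S"
        using red 2 by (auto simp: u reduced_def successively_Cons successively_append_iff)
      ultimately show ?thesis using pos[OF _ _ _ _ rot] 2 by simp
    next
      case 3
      have "word_matrix (y # x # v) =\<^sub>\<plusminus> word_matrix v"
        using word_matrix_cancel[of "[]" "[y]" v] 3 by (simp add: matrix_mul_assoc)
      then have "conjugate_up_to_sign g (word_matrix v)"
        using rot conjugate_up_to_sign_refl conjugate_up_to_sign_trans by blast
      with v show ?thesis by (intro shorter) (simp_all add: u)
    next
      case 4
      have "word_matrix (y # x # v) =\<^sub>\<plusminus> word_matrix (inv_letter x # v)"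
        using word_matrix_merge[of x "[]" "[]" v] 4 by (simp add: matrix_mul_assoc)
      then have "conjugate_up_to_sign g (word_matrix (inv_letter x # v))"
        using rot conjugate_up_to_sign_refl conjugate_up_to_sign_trans by blast
      moreover have "reduced (inv_letter x # v)"
        using v by (auto simp: reduced_def successively_Cons)
      moreover have "length (inv_letter x # v) < length u"
        by (simp add: u)
      ultimately show ?thesis using shorter by blast
    qed
  qed
qed

text \<open>
  A window of one period length in a periodic word is a rotation of the period.
\<close>
lemma periodic_subword:
  assumes "concat (replicate k w) = a @ z @ b" "length z = length w"
  shows "\<exists>c d. w = c @ d \<and> z = d @ c"
  using assms
proof (induction k arbitrary: a)
  case 0
  then show ?case by simp
next
  case (Suc k)
  have eq: "w @ concat (replicate k w) = a @ (z @ b)"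
    using Suc.prems by simp
  then consider d where "w = a @ d" "d @ concat (replicate k w) = z @ b"
    | a' where "a = w @ a'" "concat (replicate k w) = a' @ z @ b"
    by (auto simp: append_eq_append_conv2)
  then show ?case
  proof cases
    case 1
    then obtain z' where z': "z = d @ z'" "concat (replicate k w) = z' @ b"
      using Suc.prems(2) by (auto simp: append_eq_append_conv2)
    show ?thesis
    proof (cases k)
      case 0
      then show ?thesis using z' 1 Suc.prems(2) by auto
    next
      case (Suc m)
      then have "a @ (d @ concat (replicate m w)) = z' @ b"
        using z' 1 by simp
      moreover have "length a = length z'"
        using z' 1 Suc.prems(2) by simp
      ultimately have "a = z'"
        using append_eq_append_conv by blast
      then show ?thesis using z' 1 by blast
    qed
  next
    case 2
    then show ?thesis using Suc by blast
  qed
qed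

section \<open>The quasimorphism of a hyperbolic element\<close>

definition counting_function :: "letter list \<Rightarrow> int^2^2 \<Rightarrow> int" where
  "counting_function w g = signed_count w (THE u. represents u g)"

lemma counting_function_eq: "represents u g \<Longrightarrow> counting_function w g = signed_count w u"
  unfolding counting_function_def
  by (rule arg_cong[of _ _ "signed_count w"]) (blast intro: represents_unique)

lemma counting_function_mult:
  assumes "w \<noteq> []" "det g = 1" "det h = 1"
  shows "\<bar>counting_function w (g ** h) - counting_function w g - counting_function w h\<bar>
    \<le> 6 * int (length w) + 3"
proof -
  obtain u v where uv: "represents u g" "represents v h"
    using ex_represents assms by blast
  then show ?thesis
    using represents_mult[OF assms(1) uv] by (auto simp: counting_function_eq)
qed

lemma counting_function_inverse:
  assumes "det g = 1"
  shows "counting_function w (inv\<^bsub>SL2Z\<^esub> g) = - counting_function w g"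
proof -
  obtain u where u: "represents u g"
    using ex_represents assms by blast
  show ?thesis
    using represents_inv_word[OF assms u] u by (simp add: counting_function_eq signed_count_inv_word)
qed

lemma counting_function_eq_up_to_sign:
  assumes "g =\<^sub>\<plusminus> h" "det g = 1"
  shows "counting_function w g = counting_function w h"
proof -
  obtain u where u: "represents u g"
    using ex_represents assms by blast
  then have "represents u h"
    using assms(1) eq_up_to_sign_trans by (auto simp: represents_def)
  then show ?thesis
    using u by (simp add: counting_function_eq)
qed

lemma counting_function_conjugate:
  assumes "w \<noteq> []" "det g = 1" "det k = 1" "conjugate_up_to_sign g k"
  shows "\<bar>counting_function w g - counting_function w k\<bar> \<le> 12 * int (length w) + 6"
proof -
  obtain x where x: "det x = 1" "x ** g =\<^sub>\<plusminus> k ** x"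
    using assms by (auto simp: conjugate_up_to_sign_def)
  have "counting_function w (x ** g) = counting_function w (k ** x)"
    using x assms by (intro counting_function_eq_up_to_sign) (simp_all add: det_mul)
  then show ?thesis
    using counting_function_mult[OF assms(1) x(1) assms(2)]
      counting_function_mult[OF assms(1,3) x(1)] by linarith
qed


text \<open>
  Elliptic and parabolic elements and \<open>\<plusminus>1\<close>. A positive word whose trace is at most 2 has a unipotent
  triangular matrix: its diagonal entries are positive, hence equal to 1, and the determinant forces one
  of the other two entries to vanish. Upper triangular ones have count 0 by \<open>represents_shear\<close>, and lower
  triangular ones are conjugate to upper triangular ones by \<open>S\<close>.
\<close>
lemma counting_function_small_trace:
  assumes "U \<in> set w" "V \<in> set w" "det g = 1" "\<bar>trace g\<bar> \<le> 2"
  shows "\<bar>counting_function w g\<bar> \<le> 12 * int (length w) + 7"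
proof -
  have w: "w \<noteq> []" using assms(1) by auto
  obtain u where "represents u g"
    using ex_represents assms(3) by blast
  then obtain v where v: "conjugate_up_to_sign g (word_matrix v)"
    "v = [] \<or> (\<exists>x. v = [x]) \<or> (\<exists>bs. bs \<noteq> [] \<and> v = positive_word bs)"
    using conjugate_to_letter_or_positive by blast
  obtain k where k: "conjugate_up_to_sign g k" "det k = 1" "\<bar>counting_function w k\<bar> \<le> 1"
  proof -
    from v(2) consider "v = []" | x where "v = [x]" | bs where "v = positive_word bs"
      by blast
    then show ?thesis
    proof cases
      case 1
      have "represents v (word_matrix v)"
        by (simp add: represents_def reduced_def 1)
      moreover have "signed_count w v = 0"
        using signed_count_inv_word[of w v] by (simp add: 1)
      ultimately show ?thesis
        using that[OF v(1)] by (simp add: counting_function_eq)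
    next
      case 2
      have "represents v (word_matrix v)"
        by (simp add: represents_def reduced_def 2)
      moreover have "\<bar>signed_count w v\<bar> \<le> 1"
        using signed_count_letter[OF w] by (simp add: 2)
      ultimately show ?thesis
        using that[OF v(1)] by (simp add: counting_function_eq)
    next
      case 3
      obtain a b c d where m: "word_matrix v = mat2 a b c d" "a \<ge> 1" "b \<ge> 0" "c \<ge> 0" "d \<ge> 1"
        using positive_word_matrix[of bs] 3 by blast
      have "\<bar>a + d\<bar> \<le> 2"
        using abs_trace_conjugate_up_to_sign[OF v(1)] assms(4) by (simp add: m)
      then have ad: "a = 1" "d = 1"
        using m by simp_all
      then have bc: "b = 0 \<or> c = 0"
        using det_word_matrix[of v] by (simp add: m)
      have shear: "counting_function w (mat2 1 n 0 1) = 0" for n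
        using represents_shear[of n] signed_count_eq_0[OF assms(1,2)] counting_function_eq by metis
      show ?thesis
      proof (cases "c = 0")
        case True
        then show ?thesis
          using that[OF v(1)] shear[of b] by (simp add: m ad)
      next
        case False
        have "mat2 0 (-1) 1 0 ** mat2 1 0 c 1 =\<^sub>\<plusminus> mat2 1 (- c) 0 1 ** mat2 0 (-1) 1 0"
          by simp
        moreover have "det (mat2 0 (-1) 1 0) = 1"
          by simp
        ultimately have "conjugate_up_to_sign (mat2 1 0 c 1) (mat2 1 (- c) 0 1)"
          unfolding conjugate_up_to_sign_def by blast
        then have "conjugate_up_to_sign g (mat2 1 (- c) 0 1)"
          using conjugate_up_to_sign_trans[OF v(1)] bc False by (simp add: m ad)
        then show ?thesis
          using that shear[of "- c"] by simp
      qed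
    qed
  qed
  show ?thesis
    using counting_function_conjugate[OF w assms(3) k(2,1)] k(3) by linarith
qed

text \<open>
  Trace at most 2 in absolute value comprises the elliptic and parabolic elements and \<open>\<plusminus>1\<close>.
\<close>
locale bounded_quasimorphism =
  fixes \<phi> :: "int^2^2 \<Rightarrow> int" and D :: int
  assumes mult: "det g = 1 \<Longrightarrow> det h = 1 \<Longrightarrow> \<bar>\<phi> (g ** h) - \<phi> g - \<phi> h\<bar> \<le> D"
    and inverse: "det g = 1 \<Longrightarrow> \<phi> (inv\<^bsub>SL2Z\<^esub> g) = - \<phi> g"
    and small_trace: "det g = 1 \<Longrightarrow> \<bar>trace g\<bar> \<le> 2 \<Longrightarrow> \<bar>\<phi> g\<bar> \<le> D"

lemma counting_function_bounded_quasimorphism: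
  assumes "U \<in> set w" "V \<in> set w"
  shows "bounded_quasimorphism (counting_function w) (12 * int (length w) + 7)"
proof
  have w: "w \<noteq> []" using assms(1) by auto
  show "\<bar>counting_function w (g ** h) - counting_function w g - counting_function w h\<bar>
      \<le> 12 * int (length w) + 7" if "det g = 1" "det h = 1" for g h
    using counting_function_mult[OF w that] by linarith
qed (use assms in \<open>auto intro: counting_function_inverse counting_function_small_trace\<close>)

text \<open>
  The counted word is a cyclically reduced word \<open>w\<close> of \<open>h\<close> itself, so that it occurs at least \<open>k\<close> times in
  the \<open>k\<close>-th power. An occurrence of the inverse word would be a rotation of \<open>w\<close> by
  \<open>periodic_subword\<close> and make \<open>h\<close> conjugate to its inverse.
\<close>
lemma ex_quasimorphism_unbounded_on_powers:
  assumes hyp: "hyperbolic h" and noninv: "\<not> conjugate h (inv\<^bsub>SL2Z\<^esub> h)"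
  shows "\<exists>\<phi> D. bounded_quasimorphism \<phi> D \<and> (\<forall>k::nat. int k - D \<le> \<phi> (h [^]\<^bsub>SL2Z\<^esub> k))"
proof -
  have det: "det h = 1" and tr: "\<bar>trace h\<bar> > 2"
    using hyp by (simp_all add: hyperbolic_def)
  obtain u where "represents u h"
    using ex_represents det by blast
  then obtain w where w: "conjugate_up_to_sign h (word_matrix w)"
    "w = [] \<or> (\<exists>x. w = [x]) \<or> (\<exists>bs. bs \<noteq> [] \<and> w = positive_word bs)"
    using conjugate_to_letter_or_positive by blast
  have trw: "\<bar>trace (word_matrix w)\<bar> > 2"
    using abs_trace_conjugate_up_to_sign[OF w(1)] tr by simp
  have "\<bar>trace (letter_matrix x)\<bar> \<le> 2" for x
    by (cases x) simp_all
  then have "w \<noteq> [x]" for x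
    using trw by (auto simp: not_less[symmetric])
  moreover have "w \<noteq> []"
    using trw by (auto simp: mat_1_eq_mat2)
  ultimately obtain bs where bs: "w = positive_word bs"
    using w(2) by blast
  \<comment> \<open>Both letters \<open>U\<close> and \<open>V\<close> occur in \<open>w\<close>, since otherwise \<open>w\<close> would be unipotent and not hyperbolic.\<close>
  have const: "word_matrix (positive_word (replicate n e)) =
      (if e then mat2 1 (int n) 0 1 else mat2 1 0 (int n) 1)" for n e
    by (induction n) (simp_all add: mat_1_eq_mat2)
  have "bs \<noteq> replicate (length bs) e" for e
  proof
    assume "bs = replicate (length bs) e"
    then have "word_matrix w = (if e then mat2 1 (int (length bs)) 0 1 else mat2 1 0 (int (length bs)) 1)"
      using const[of "length bs" e] bs by simp
    then show False using trw by (simp split: if_splits)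
  qed
  then have "True \<in> set bs" "False \<in> set bs"
    by (metis (full_types) replicate_length_same)+
  moreover have "(True \<in> set bs \<longrightarrow> U \<in> set (positive_word bs)) \<and> (False \<in> set bs \<longrightarrow> V \<in> set (positive_word bs))"
    by (induction bs) auto
  ultimately have UV: "U \<in> set w" "V \<in> set w"
    by (simp_all add: bs)
  have w_ne: "w \<noteq> []" using UV by auto
  define W where "W k = concat (replicate k w)" for k
  have "W k = positive_word (concat (replicate k bs))" for k
    by (induction k) (simp_all add: W_def bs positive_word_append)
  then have redW: "reduced (W k)" for k
    by (simp add: reduced_positive_word)
  obtain x where x: "det x = 1" "x ** h =\<^sub>\<plusminus> word_matrix w ** x"
    using w(1) by (auto simp: conjugate_up_to_sign_def)
  have conj: "x ** (h [^]\<^bsub>SL2Z\<^esub> k) =\<^sub>\<plusminus> word_matrix (W k) ** x" for k :: nat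
  proof (induction k)
    case 0
    then show ?case by (simp add: W_def)
  next
    case (Suc k)
    have "x ** (h [^]\<^bsub>SL2Z\<^esub> Suc k) = (x ** (h [^]\<^bsub>SL2Z\<^esub> k)) ** h"
      by (simp add: matrix_mul_assoc)
    also have "\<dots> =\<^sub>\<plusminus> (word_matrix (W k) ** x) ** h"
      by (intro eq_up_to_sign_mult eq_up_to_sign_refl Suc)
    also have "\<dots> = word_matrix (W k) ** (x ** h)"
      by (simp add: matrix_mul_assoc)
    also have "\<dots> =\<^sub>\<plusminus> word_matrix (W k) ** (word_matrix w ** x)"
      by (intro eq_up_to_sign_mult eq_up_to_sign_refl x)
    also have "\<dots> = word_matrix (W k @ w) ** x"
      by (simp add: word_matrix_append matrix_mul_assoc)
    also have "W k @ w = W (Suc k)"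
      by (induction k) (simp_all add: W_def)
    finally show ?case .
  qed
  have powers: "conjugate_up_to_sign (h [^]\<^bsub>SL2Z\<^esub> k) (word_matrix (W k))" for k :: nat
    unfolding conjugate_up_to_sign_def using x(1) conj by blast
  have many: "int (card (positions w (W k))) \<ge> int k" for k
  proof (induction k)
    case (Suc k)
    have "0 \<in> positions w w"
      by (auto simp: positions_def)
    then have "card (positions w w) \<ge> 1"
      by (metis One_nat_def Suc_leI card_gt_0_iff empty_iff finite_positions)
    then show ?case
      using Suc card_positions_append(1)[OF w_ne, of w "W k"] by (simp add: W_def)
  qed simp
  have none: "positions (inv_word w) (W k) = {}" for k
  proof (rule ccontr)
    assume "positions (inv_word w) (W k) \<noteq> {}"
    then obtain a b where "concat (replicate k w) = a @ inv_word w @ b"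
      by (auto simp: positions_def W_def)
    then obtain c d where cd: "w = c @ d" "inv_word w = d @ c"
      using periodic_subword[of k w a "inv_word w" b] by auto
    then have "conjugate_up_to_sign h (word_matrix (inv_word w))"
      using conjugate_up_to_sign_trans[OF w(1)] conjugate_up_to_sign_rotate[of c d] cd by simp
    also have "conjugate_up_to_sign (word_matrix (inv_word w)) (inv\<^bsub>SL2Z\<^esub> h)"
      by (rule conjugate_up_to_sign_sym[OF conjugate_up_to_sign_inverse[OF det w(1)]])
    finally have "conjugate_up_to_sign h (inv\<^bsub>SL2Z\<^esub> h)" .
    moreover have "trace h \<noteq> 0"
      using tr by auto
    ultimately show False
      using conjugate_up_to_sign_inverse_imp_conjugate[OF det] noninv by blast
  qed
  have "int k - (12 * int (length w) + 7) \<le> counting_function w (h [^]\<^bsub>SL2Z\<^esub> k)" for k :: nat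
  proof -
    have "int k \<le> signed_count w (W k)"
      using many[of k] none[of k] by (simp add: signed_count_def)
    also have "\<dots> = counting_function w (word_matrix (W k))"
      using redW[of k] by (intro counting_function_eq[symmetric]) (simp add: represents_def)
    finally have "int k \<le> counting_function w (word_matrix (W k))" .
    moreover have "det (h [^]\<^bsub>SL2Z\<^esub> k) = 1"
      using SL2Z.nat_pow_closed[of h k] det by simp
    ultimately show ?thesis
      using counting_function_conjugate[OF w_ne _ _ powers[of k]] by fastforce
  qed
  then show ?thesis
    using counting_function_bounded_quasimorphism[OF UV] by blast
qed

section \<open>From the biinvariant metric to frequencies\<close>

text \<open>
  The matrix acts on frequencies as row vectors, \<open>(a, b)\<close> being mapped to \<open>(a, b) A\<close>, because composing a
  character of the torus with the action multiplies its frequency by the transposed matrix.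
\<close>
definition separates_frequencies :: "int \<Rightarrow> int^2^2 \<Rightarrow> bool" where
  "separates_frequencies N A \<longleftrightarrow> (\<forall>a b. (a, b) \<noteq> (0, 0) \<longrightarrow> \<bar>a\<bar> < N \<longrightarrow> \<bar>b\<bar> < N \<longrightarrow>
     \<not> (\<bar>A$1$1 * a + A$2$1 * b\<bar> < N \<and> \<bar>A$1$2 * a + A$2$2 * b\<bar> < N))"

context bounded_quasimorphism
begin

lemma D_nonneg: "D \<ge> 0"
  using small_trace[of "mat2 1 1 0 1"] by simp

lemma simple_commutator_bound:
  assumes "simple_commutator g"
  shows "\<bar>\<phi> g\<bar> \<le> 3 * D"
proof -
  obtain a b where ab: "det a = 1" "det b = 1" "g = a ** b ** inv\<^bsub>SL2Z\<^esub> a ** inv\<^bsub>SL2Z\<^esub> b"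
    using assms by (auto simp: simple_commutator_def)
  have "det (inv\<^bsub>SL2Z\<^esub> a) = 1" "det (inv\<^bsub>SL2Z\<^esub> b) = 1"
    using ab by (simp_all add: det_inv_SL2Z)
  then have "\<bar>\<phi> g - \<phi> (a ** b ** inv\<^bsub>SL2Z\<^esub> a) - \<phi> (inv\<^bsub>SL2Z\<^esub> b)\<bar> \<le> D"
    "\<bar>\<phi> (a ** b ** inv\<^bsub>SL2Z\<^esub> a) - \<phi> (a ** b) - \<phi> (inv\<^bsub>SL2Z\<^esub> a)\<bar> \<le> D"
    "\<bar>\<phi> (a ** b) - \<phi> a - \<phi> b\<bar> \<le> D"
    unfolding ab(3) using ab by (intro mult; simp add: det_mul)+
  then show ?thesis
    using inverse[OF ab(1)] inverse[OF ab(2)] unfolding abs_le_iff by linarith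
qed

text \<open>
  Each factor of a decomposition contributes at most \<open>3 D\<close>, the bound for commutators, and each
  product one more \<open>D\<close>.
\<close>
lemma decomposition_bound:
  assumes "as \<in> decompositions g"
  shows "\<bar>\<phi> g\<bar> \<le> D + 4 * D * int (length as)"
proof -
  have "det (foldr (**) as (mat 1)) = 1 \<and> \<bar>\<phi> (foldr (**) as (mat 1))\<bar> \<le> D + 4 * D * int (length as)"
    if "\<forall>a\<in>set as. elliptic a \<or> parabolic a \<or> simple_commutator a"
    using that
  proof (induction as)
    case Nil
    show ?case using small_trace[of "mat 1"] by (simp add: mat_1_eq_mat2)
  next
    case (Cons a as)
    have a: "det a = 1 \<and> \<bar>\<phi> a\<bar> \<le> 3 * D"
    proof -
      consider "det a = 1" "\<bar>trace a\<bar> \<le> 2" | "simple_commutator a"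
        using Cons.prems by (auto simp: elliptic_def parabolic_def)
      then show ?thesis
      proof cases
        case 1
        then show ?thesis using small_trace[of a] D_nonneg by linarith
      next
        case 2
        then show ?thesis using simple_commutator_bound[of a]
          by (auto simp: simple_commutator_def det_mul det_inv_SL2Z)
      qed
    qed
    from Cons have IH: "det (foldr (**) as (mat 1)) = 1"
      "\<bar>\<phi> (foldr (**) as (mat 1))\<bar> \<le> D + 4 * D * int (length as)" by simp_all
    have "4 * D * int (length (a # as)) = 4 * D * int (length as) + 4 * D"
      by (simp add: algebra_simps)
    then have "\<bar>\<phi> (a ** foldr (**) as (mat 1))\<bar> \<le> D + 4 * D * int (length (a # as))"
      using mult[OF _ IH(1), of a] a IH(2) by linarith
    then show ?case using a IH(1) by (simp add: det_mul)
  qed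
  then show ?thesis
    using assms by (auto simp: decompositions_def SL2Z_def)
qed

lemma rho_bound:
  fixes r :: real
  assumes "det f = 1" "det g = 1" "rho f g < ereal r"
  shows "real_of_int \<bar>\<phi> f - \<phi> g\<bar> \<le> 2 * real_of_int D + 4 * real_of_int D * r"
proof -
  have dg: "det (inv\<^bsub>SL2Z\<^esub> g) = 1"
    using assms by (simp add: det_inv_SL2Z)
  obtain as where as: "as \<in> decompositions (f ** inv\<^bsub>SL2Z\<^esub> g)" "real (length as) < r"
    using assms(3) unfolding rho_def rho_one_def by (auto simp: INF_less_iff)
  have "\<bar>\<phi> f - \<phi> g\<bar> \<le> 2 * D + 4 * D * int (length as)"
    using decomposition_bound[OF as(1)] mult[OF assms(1) dg] inverse[OF assms(2)] by linarith
  then have "real_of_int \<bar>\<phi> f - \<phi> g\<bar> \<le> real_of_int (2 * D + 4 * D * int (length as))"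
    by (simp only: of_int_le_iff)
  also have "\<dots> = 2 * real_of_int D + 4 * real_of_int D * real (length as)"
    by simp
  also have "\<dots> \<le> 2 * real_of_int D + 4 * real_of_int D * r"
    using as(2) D_nonneg by (intro add_left_mono mult_left_mono) simp_all
  finally show ?thesis .
qed

lemma euclid_product_bound:
  assumes "euclid_product n X"
  shows "\<bar>\<phi> X\<bar> \<le> D + 4 * D * int n"
  using assms
proof (induction rule: euclid_product.induct)
  case (1 e)
  then show ?case using small_trace[of "mat2 e 0 0 e"] by auto
next
  case (2 n X q)
  have X: "det X = 1" using 2 det_euclid_product by blast
  have "\<bar>\<phi> (mat2 0 1 (-1) 0)\<bar> \<le> D" "\<bar>\<phi> (mat2 1 q 0 1)\<bar> \<le> D"
    by (intro small_trace; simp)+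
  moreover have "\<bar>\<phi> (X ** mat2 0 1 (-1) 0) - \<phi> X - \<phi> (mat2 0 1 (-1) 0)\<bar> \<le> D"
    using X by (intro mult) simp_all
  moreover have "\<bar>\<phi> (X ** mat2 0 1 (-1) 0 ** mat2 1 q 0 1) - \<phi> (X ** mat2 0 1 (-1) 0) - \<phi> (mat2 1 q 0 1)\<bar> \<le> D"
    using X by (intro mult) (simp_all add: det_mul)
  moreover have "4 * D * int (Suc n) = 4 * D * int n + 4 * D"
    by (simp add: algebra_simps)
  ultimately show ?case
    using 2 unfolding abs_le_iff by linarith
qed

text \<open>
  The contrapositive: if \<open>A\<close> maps a small nonzero row to a small row, then after division by the greatest
  common divisor both rows are bottom rows of matrices \<open>X\<close> and \<open>Y\<close> from the Euclidean algorithm, \<open>X A\<close>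
  equals \<open>Y\<close> up to a shear on the left, and hence \<open>\<phi> A\<close> is small.
\<close>
lemma separates_frequencies_if_large:
  assumes A: "det A = 1" and large: "5 * D + 8 * D * int j < \<bar>\<phi> A\<bar>"
  shows "separates_frequencies (2 ^ j) A"
  unfolding separates_frequencies_def
proof (intro allI impI notI; elim conjE)
  fix a b :: int
  assume ne: "(a, b) \<noteq> (0, 0)" and small: "\<bar>a\<bar> < 2 ^ j" "\<bar>b\<bar> < 2 ^ j"
    and small': "\<bar>A$1$1 * a + A$2$1 * b\<bar> < 2 ^ j" "\<bar>A$1$2 * a + A$2$2 * b\<bar> < 2 ^ j"
  define g where "g = gcd a b"
  define a' b' where "a' = a div g" and "b' = b div g"
  have ab: "a = g * a'" "b = g * b'" "coprime a' b'" and g: "g > 0"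
    using ne div_gcd_coprime[of a b] by (auto simp: g_def a'_def b'_def)
  have le_mult: "\<bar>x\<bar> \<le> \<bar>g * x\<bar>" for x
    using g mult_right_mono[of 1 g "\<bar>x\<bar>"] by (simp add: abs_mult)
  have "\<bar>a'\<bar> < 2 ^ j"
    using le_mult[of a'] small(1) ab by linarith
  then obtain n X where X: "n \<le> j" "euclid_product n X" "X $ 2 $ 1 = a'" "X $ 2 $ 2 = b'"
    using euclid_product_bottom_row[OF ab(3)] by blast
  have dX: "det X = 1" using X det_euclid_product by blast
  let ?XA = "X ** A"
  have dXA: "det ?XA = 1" using dX A by (simp add: det_mul)
  have row: "?XA $ 2 $ 1 = A$1$1 * a' + A$2$1 * b'" "?XA $ 2 $ 2 = A$1$2 * a' + A$2$2 * b'"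
    using X(3,4) by (cases X, cases A; simp)+
  have "A$1$1 * a + A$2$1 * b = g * ?XA $ 2 $ 1"
    by (simp add: row ab(1,2) algebra_simps)
  then have "\<bar>?XA $ 2 $ 1\<bar> < 2 ^ j"
    using le_mult[of "?XA $ 2 $ 1"] small'(1) by linarith
  moreover have "coprime (?XA $ 2 $ 1) (?XA $ 2 $ 2)"
    using dXA by (rule coprime_bottom_row)
  ultimately obtain m Y where Y: "m \<le> j" "euclid_product m Y" "Y $ 2 $ 1 = ?XA $ 2 $ 1" "Y $ 2 $ 2 = ?XA $ 2 $ 2"
    using euclid_product_bottom_row by blast
  have dY: "det Y = 1" using Y det_euclid_product by blast
  obtain t where t: "?XA = mat2 1 t 0 1 ** Y"
    using same_bottom_row[OF dXA dY] Y by auto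
  have "\<bar>\<phi> (X ** A) - \<phi> X - \<phi> A\<bar> \<le> D"
    using dX A by (rule mult)
  moreover have "\<bar>\<phi> (X ** A) - \<phi> (mat2 1 t 0 1) - \<phi> Y\<bar> \<le> D"
    unfolding t using dY by (intro mult) simp_all
  moreover have "\<bar>\<phi> (mat2 1 t 0 1)\<bar> \<le> D"
    by (rule small_trace) simp_all
  moreover have "\<bar>\<phi> X\<bar> \<le> D + 4 * D * int j" "\<bar>\<phi> Y\<bar> \<le> D + 4 * D * int j"
    using euclid_product_bound[OF X(2)] euclid_product_bound[OF Y(2)] X(1) Y(1) D_nonneg
      mult_left_mono[of "int n" "int j" "4 * D"] mult_left_mono[of "int m" "int j" "4 * D"]
    by linarith+
  ultimately show False
    using large unfolding abs_le_iff by linarith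
qed

end

text \<open>
  The radius \<open>\<epsilon>\<close> is chosen such that moving from the \<open>k\<close>-th power of \<open>h\<close> to \<open>f k\<close> loses at most half of the
  growth of \<open>\<phi>\<close>, up to a constant; \<open>\<delta>\<close> is chosen such that frequencies below \<open>2^j\<close> with \<open>j \<le> \<delta> k\<close> use
  up at most another quarter of \<open>k\<close>.
\<close>
lemma ball_separates_frequencies:
  assumes "hyperbolic h" "\<not> conjugate h (inv\<^bsub>SL2Z\<^esub> h)"
  obtains \<epsilon> \<delta> :: real and k0 :: nat where "\<epsilon> > 0" "\<delta> > 0"
    "\<And>f k j. f \<in> G_infinity \<Longrightarrow> rho_bar (\<lambda>k. h [^]\<^bsub>SL2Z\<^esub> k) f < ereal \<epsilon> \<Longrightarrow> k \<ge> k0 \<Longrightarrow>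
       real j \<le> \<delta> * real k \<Longrightarrow> separates_frequencies (2 ^ j) (f k)"
proof -
  obtain \<phi> D where "bounded_quasimorphism \<phi> D"
    and growth: "int k - D \<le> \<phi> (h [^]\<^bsub>SL2Z\<^esub> k)" for k :: nat
    using ex_quasimorphism_unbounded_on_powers[OF assms] by blast
  interpret bounded_quasimorphism \<phi> D by fact
  define \<epsilon> \<delta> where "\<epsilon> = 1 / (8 * real_of_int D + 8)" and "\<delta> = 1 / (32 * real_of_int D + 32)"
  have pos: "\<epsilon> > 0" "\<delta> > 0"
    using D_nonneg by (auto simp: \<epsilon>_def \<delta>_def intro!: divide_pos_pos)
  have "separates_frequencies (2 ^ j) (f k)"
    if f: "f \<in> G_infinity" "rho_bar (\<lambda>k. h [^]\<^bsub>SL2Z\<^esub> k) f < ereal \<epsilon>"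
      and k: "k \<ge> nat (32 * D + 1)" and j: "real j \<le> \<delta> * real k" for f k j
  proof -
    have k1: "k \<ge> 1" using k D_nonneg by linarith
    have det: "det (f k) = 1" "det (h [^]\<^bsub>SL2Z\<^esub> k) = 1"
      using f(1) k1 SL2Z.nat_pow_closed[of h k] assms(1) by (auto simp: G_infinity_def hyperbolic_def)
    have "rho (h [^]\<^bsub>SL2Z\<^esub> k) (f k) / ereal (real k) \<le> rho_bar (\<lambda>k. h [^]\<^bsub>SL2Z\<^esub> k) f"
      unfolding rho_bar_def using k1 by (intro SUP_upper) simp
    also note f(2)
    finally have "rho (h [^]\<^bsub>SL2Z\<^esub> k) (f k) < ereal (\<epsilon> * real k)"
      using k1 by (subst (asm) ereal_divide_less_pos) (auto simp: mult.commute)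
    then have "real_of_int \<bar>\<phi> (h [^]\<^bsub>SL2Z\<^esub> k) - \<phi> (f k)\<bar> \<le> 2 * real_of_int D + 4 * real_of_int D * (\<epsilon> * real k)"
      using det by (intro rho_bound) auto
    moreover have "4 * real_of_int D * (\<epsilon> * real k) \<le> real k / 2"
      using D_nonneg by (simp add: \<epsilon>_def field_simps)
    moreover have "8 * real_of_int D * real j \<le> 8 * real_of_int D * (\<delta> * real k)"
      using j D_nonneg by (intro mult_left_mono) auto
    moreover have "8 * real_of_int D * (\<delta> * real k) \<le> real k / 4"
      using D_nonneg by (simp add: \<delta>_def field_simps)
    moreover have "real k > 32 * real_of_int D"
      using k D_nonneg by linarith
    moreover have "real k - real_of_int D \<le> real_of_int (\<phi> (h [^]\<^bsub>SL2Z\<^esub> k))"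
      using growth[of k] by linarith
    ultimately have "5 * real_of_int D + 8 * real_of_int D * real j < real_of_int \<bar>\<phi> (f k)\<bar>"
      by linarith
    also have "5 * real_of_int D + 8 * real_of_int D * real j = real_of_int (5 * D + 8 * D * int j)"
      by simp
    finally show ?thesis
      using det by (intro separates_frequencies_if_large) (simp_all only: of_int_less_iff)
  qed
  then show thesis
    using that pos by blast
qed

section \<open>Characters of the torus\<close>

lemma abs_torus_eq_iff: "abs_torus x = abs_torus y \<longleftrightarrow> (\<forall>i. x $ i - y $ i \<in> \<int>)"
  using torus.abs_eq_iff by (simp add: same_mod_Z2_def)

lemma space_torus_measure [simp]: "space torus_measure = UNIV"
  by (simp add: torus_measure_def space_measure_of_conv)

text \<open>
  The measurable sets of the torus are by definition those with Borel preimage in the plane.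
\<close>
lemma measurable_torus_iff:
  "F \<in> measurable torus_measure M \<longleftrightarrow> (\<lambda>x. F (abs_torus x)) \<in> measurable borel M"
proof -
  have "abs_torus -` (F -` B) = (\<lambda>x. F (abs_torus x)) -` B" for B
    by auto
  moreover have "(\<forall>x. F x \<in> space M) \<longleftrightarrow> (\<forall>x. F (abs_torus x) \<in> space M)"
    by (metis Quotient_abs_rep[OF Quotient_torus])
  ultimately show ?thesis
    by (simp add: measurable_def sets_torus_measure Pi_iff)
qed

lemma torus_action_abs: "torus_action A (abs_torus x) = abs_torus (map_matrix real_of_int A *v x)"
  by (rule torus_action.abs_eq)

lemma measurable_torus_action [measurable]:
  "torus_action A \<in> measurable torus_measure torus_measure"
  unfolding measurable_torus_iff torus_action_abs
proof -
  have "(\<lambda>x. map_matrix real_of_int A *v x) \<in> borel_measurable borel"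
    by (intro borel_measurable_continuous_onI matrix_vector_mult_linear_continuous_on)
  moreover have "abs_torus \<in> measurable borel torus_measure"
    by (auto simp: measurable_def sets_torus_measure)
  ultimately show "(\<lambda>x. abs_torus (map_matrix real_of_int A *v x)) \<in> measurable borel torus_measure"
    by (rule measurable_compose)
qed

interpretation torus: finite_measure torus_measure
  by (rule finite_measureI) (simp add: emeasure_torus_measure_UNIV)

lemma measure_torus_UNIV: "measure torus_measure UNIV = 1"
  by (simp add: measure_def emeasure_torus_measure_UNIV)

lemma integral_torus:
  fixes F :: "torus \<Rightarrow> complex"
  assumes "F \<in> borel_measurable torus_measure"
  shows "(\<integral>x. F x \<partial>torus_measure) =
    (\<integral>x. indicator {x. \<forall>i. 0 \<le> x $ i \<and> x $ i < 1} x *\<^sub>R F (abs_torus x) \<partial>lborel)"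
proof -
  let ?Q = "{x :: real^2. \<forall>i. 0 \<le> x$i \<and> x$i < 1}"
  let ?S = "sigma UNIV {A. abs_torus -` A \<in> sets borel}"
  have S: "sets ?S = sets torus_measure"
    by (simp add: torus_measure_def)
  have Q: "?Q \<in> sets borel"
    by measurable
  have abs: "abs_torus \<in> measurable (restrict_space lborel ?Q) ?S"
    using Q by (intro measurable_restrict_space1 measurableI)
      (auto simp: S sets_torus_measure space_measure_of_conv)
  have F: "F \<in> borel_measurable ?S"
    using assms measurable_cong_sets[OF S refl] by blast
  have "(\<integral>x. F x \<partial>torus_measure) = (\<integral>x. F (abs_torus x) \<partial>restrict_space lborel ?Q)"
    unfolding torus_measure_def by (rule integral_distr[OF abs F])
  also have "\<dots> = (\<integral>x. indicator ?Q x *\<^sub>R F (abs_torus x) \<partial>lborel)"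
    using Q by (intro integral_restrict_space) simp
  finally show ?thesis .
qed

lemma cis_add_int: "cis (2 * pi * (of_int n + t)) = cis (2 * pi * t)"
  by (simp add: distrib_left cis_mult[symmetric])

text \<open>
  Frequencies are pairs, so that they form an additive group and characters turn sums into products.
\<close>
lift_definition character :: "int \<times> int \<Rightarrow> torus \<Rightarrow> complex"
  is "\<lambda>p x. cis (2 * pi * (of_int (fst p) * x $ 1 + of_int (snd p) * x $ 2))"
proof -
  fix p :: "int \<times> int" and x y :: "real^2"
  assume "same_mod_Z2 x y"
  then have "of_int (fst p) * (x$1 - y$1) + of_int (snd p) * (x$2 - y$2) \<in> \<int>"
    unfolding same_mod_Z2_def by (intro Ints_add Ints_mult) auto
  then obtain n where "of_int (fst p) * (x$1 - y$1) + of_int (snd p) * (x$2 - y$2) = real_of_int n"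
    by (elim Ints_cases)
  then have "of_int (fst p) * x$1 + of_int (snd p) * x$2 =
      real_of_int n + (of_int (fst p) * y$1 + of_int (snd p) * y$2)"
    by (simp add: algebra_simps)
  then show "cis (2 * pi * (of_int (fst p) * x $ 1 + of_int (snd p) * x $ 2)) =
      cis (2 * pi * (of_int (fst p) * y $ 1 + of_int (snd p) * y $ 2))"
    by (simp only: cis_add_int)
qed

lemma norm_character [simp]: "norm (character p x) = 1"
  by transfer simp

lemma character_0 [simp]: "character 0 x = 1"
  by transfer simp

lemma character_add: "character (p + q) x = character p x * character q x"
  by transfer (simp add: cis_mult algebra_simps)

lemma cnj_character: "cnj (character p x) = character (- p) x"
  by transfer (simp add: cis_cnj algebra_simps)

lemma character_diff: "character (p - q) x = character p x * cnj (character q x)"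
  unfolding cnj_character character_add[symmetric] by simp

text \<open>
  The product of the row vector \<open>p\<close> with \<open>A\<close>.
\<close>
definition dual_action :: "int^2^2 \<Rightarrow> int \<times> int \<Rightarrow> int \<times> int" where
  "dual_action A p = (A$1$1 * fst p + A$2$1 * snd p, A$1$2 * fst p + A$2$2 * snd p)"

lemma character_torus_action: "character p (torus_action A x) = character (dual_action A p) x"
  by transfer (simp add: dual_action_def matrix_vector_mult_def sum_2 algebra_simps)

lemma measurable_character [measurable]: "character p \<in> borel_measurable torus_measure"
  unfolding measurable_torus_iff character.abs_eq
  by (intro borel_measurable_continuous_onI continuous_intros)

lemma integral_unit_interval_cis:
  "(\<integral>t. indicator {0..<1} t *\<^sub>R cis (2 * pi * (of_int n * t)) \<partial>lborel) = (if n = 0 then 1 else 0)"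
proof (cases "n = 0")
  case True
  then show ?thesis by simp
next
  case False
  let ?f = "\<lambda>t. cis (2 * pi * (of_int n * t))"
  let ?F = "\<lambda>t. ?f t / (\<i> * of_real (2 * pi * of_int n))"
  have "(\<integral>t. indicator {0..<1} t *\<^sub>R ?f t \<partial>lborel) = (\<integral>t. indicator {0..1} t *\<^sub>R ?f t \<partial>lborel)"
  proof (rule integral_cong_AE)
    have "AE t in lborel. t \<noteq> (1::real)"
      by (rule AE_lborel_singleton)
    then show "AE t in lborel. indicator {0..<1} t *\<^sub>R ?f t = indicator {0..1} t *\<^sub>R ?f t"
      by eventually_elim (auto simp: indicator_def)
  qed (measurable; intro borel_measurable_continuous_onI continuous_intros)+
  also have "\<dots> = ?F 1 - ?F 0"
  proof (rule integral_FTC_Icc)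
    show "(?F has_vector_derivative ?f t) (at t within {0..1})" for t
      unfolding cis_conv_exp has_real_derivative_iff_has_vector_derivative[symmetric]
      using False
      by (auto intro!: derivative_eq_intros has_vector_derivative_real_field simp: field_simps)
    show "continuous_on {0..1} ?f"
      by (intro continuous_intros)
  qed simp
  also have "\<dots> = 0"
    using cis_add_int[of n 0] by simp
  finally show ?thesis using False by simp
qed

lemma integral_lborel_prod:
  fixes f :: "'a::euclidean_space \<Rightarrow> real \<Rightarrow> complex"
  assumes f: "\<And>b. b \<in> Basis \<Longrightarrow> integrable lborel (f b)"
  shows "(\<integral>x. (\<Prod>b\<in>Basis. f b (x \<bullet> b)) \<partial>lborel) = (\<Prod>b\<in>Basis. \<integral>x. f b x \<partial>lborel)"
proof -
  interpret P: product_sigma_finite "\<lambda>_. lborel :: real measure" ..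
  have [measurable]: "f b \<in> borel_measurable borel" if "b \<in> Basis" for b
    using f[OF that] by (auto dest: borel_measurable_integrable)
  have "(\<integral>x. (\<Prod>b\<in>Basis. f b (x \<bullet> b)) \<partial>lborel) =
      (\<integral>x. (\<Prod>b\<in>Basis. f b ((\<Sum>b\<in>Basis. x b *\<^sub>R b) \<bullet> b)) \<partial>Pi\<^sub>M Basis (\<lambda>b. lborel))"
    by (subst lborel_eq) (rule integral_distr; measurable)
  also have "\<dots> = (\<integral>x. (\<Prod>b\<in>Basis. f b (x b)) \<partial>Pi\<^sub>M Basis (\<lambda>b. lborel))"
    by (intro Bochner_Integration.integral_cong prod.cong refl) (simp add: inner_sum_left inner_Basis if_distrib cong: if_cong)
  also have "\<dots> = (\<Prod>b\<in>Basis. \<integral>x. f b x \<partial>lborel)"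
    by (rule P.product_integral_prod) (use f in auto)
  finally show ?thesis .
qed

lemma prod_Basis_2:
  fixes f :: "real^2 \<Rightarrow> complex"
  shows "(\<Prod>b\<in>Basis. f b) = f (axis 1 1) * f (axis 2 1)"
proof -
  have B: "(Basis :: (real^2) set) = {axis 1 1, axis 2 1}"
    by (auto simp: Basis_vec_def) (metis exhaust_2)
  show ?thesis
    unfolding B by (simp add: axis_eq_axis)
qed

lemma integral_character:
  "(\<integral>x. character p x \<partial>torus_measure) = (if p = 0 then 1 else 0)"
proof -
  define n where "n b = (if b = axis 1 1 then fst p else snd p)" for b :: "real^2"
  define g :: "real^2 \<Rightarrow> real \<Rightarrow> complex" where
    "g b t = indicator {0..<1} t *\<^sub>R cis (2 * pi * (of_int (n b) * t))" for b t
  have "integrable lborel (\<lambda>t. indicator {0..1} t *\<^sub>R cis (2 * pi * (of_int (n b) * t)))" for b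
    by (intro borel_integrable_compact continuous_intros) simp
  then have "integrable lborel (g b)" for b
    unfolding g_def
    by (rule Bochner_Integration.integrable_bound)
      ((measurable; intro borel_measurable_continuous_onI continuous_intros)[1],
        auto simp: indicator_def intro!: AE_I2)
  then have "(\<integral>x. (\<Prod>b\<in>Basis. g b (x \<bullet> b)) \<partial>lborel) = (\<Prod>b\<in>Basis. \<integral>t. g b t \<partial>lborel)"
    by (intro integral_lborel_prod)
  also have "\<dots> = (if p = 0 then 1 else 0)"
    unfolding g_def integral_unit_interval_cis prod_Basis_2
    by (simp add: n_def axis_eq_axis prod_eq_iff)
  finally have *: "(\<integral>x. (\<Prod>b\<in>Basis. g b (x \<bullet> b)) \<partial>lborel) = (if p = 0 then 1 else 0)" .
  have "(\<integral>x. character p x \<partial>torus_measure) = (\<integral>x. (\<Prod>b\<in>Basis. g b (x \<bullet> b)) \<partial>lborel)"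
    unfolding integral_torus[OF measurable_character]
  proof (rule Bochner_Integration.integral_cong[OF refl])
    fix x :: "real^2"
    have "cis (2 * pi * (of_int (fst p) * x $ 1 + of_int (snd p) * x $ 2)) =
        cis (2 * pi * (of_int (fst p) * x $ 1)) * cis (2 * pi * (of_int (snd p) * x $ 2))"
      by (simp add: distrib_left cis_mult)
    then show "indicator {x. \<forall>i. 0 \<le> x $ i \<and> x $ i < 1} x *\<^sub>R character p (abs_torus x) =
        (\<Prod>b\<in>Basis. g b (x \<bullet> b))"
      unfolding prod_Basis_2
      by (auto simp: g_def n_def axis_eq_axis inner_axis character.abs_eq forall_2 indicator_def)
  qed
  with * show ?thesis by simp
qed

section \<open>Fejer means of Hoelder functions\<close>

lemma abs_torus_cases: obtains x where "p = abs_torus x"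
  by (metis Quotient_abs_rep[OF Quotient_torus])

lemma torus_dist_le: "torus_dist (abs_torus x) (abs_torus y) \<le> dist x y"
  unfolding torus_dist_def by (rule cInf_lower) (auto intro!: bdd_belowI[of _ 0])

lemma torus_dist_nonneg: "torus_dist p q \<ge> 0"
proof -
  obtain x y where "p = abs_torus x" "q = abs_torus y"
    by (metis abs_torus_cases)
  then show ?thesis
    unfolding torus_dist_def by (intro cInf_greatest) auto
qed

text \<open>
  With \<open>u = \<bar>pi t\<bar> \<le> 2\<close>, the Taylor bound \<open>u - u^3/6\<close> for the sine is at least \<open>u/3\<close>, and \<open>pi > 3\<close>.
\<close>
lemma abs_le_abs_sin_pi:
  fixes t :: real
  assumes "\<bar>t\<bar> \<le> 1 / 2"
  shows "\<bar>t\<bar> \<le> \<bar>sin (pi * t)\<bar>"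
proof -
  define u where "u = \<bar>pi * t\<bar>"
  have u: "0 \<le> u" "u \<le> 2"
    using assms pi_less_4 mult_mono[of pi 4 "\<bar>t\<bar>" "1/2"] by (auto simp: u_def abs_mult)
  have "\<bar>sin (pi * t) - pi * t\<bar> \<le> u ^ 3 / 6"
    using Maclaurin_sin_bound[of "pi * t" 3]
    by (simp add: u_def sin_coeff_def eval_nat_numeral field_simps)
  then have "u - u ^ 3 / 6 \<le> \<bar>sin (pi * t)\<bar>"
    unfolding u_def by linarith
  moreover have "u ^ 3 / 6 \<le> u * 4 / 6"
    using mult_mono[OF u(2) u(2)] u by (intro divide_right_mono) (auto simp: eval_nat_numeral intro!: mult_left_mono)
  moreover have "3 * \<bar>t\<bar> \<le> u"
    using pi_gt3 mult_right_mono[of 3 pi "\<bar>t\<bar>"] by (simp add: u_def abs_mult)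
  ultimately show ?thesis by linarith
qed

lemma cmod_cis_diff_ge:
  assumes "\<bar>t\<bar> \<le> 1 / 2"
  shows "t\<^sup>2 \<le> (cmod (cis (2 * pi * (s + t)) - cis (2 * pi * s)))\<^sup>2"
proof -
  have "cis (2 * pi * (s + t)) - cis (2 * pi * s) = cis (2 * pi * s) * (cis (2 * pi * t) - 1)"
    by (simp add: distrib_left cis_mult right_diff_distrib)
  then have "(cmod (cis (2 * pi * (s + t)) - cis (2 * pi * s)))\<^sup>2 = (cmod (cis (2 * pi * t) - 1))\<^sup>2"
    by (simp add: norm_mult)
  also have "\<dots> = (cos (2 * (pi * t)) - 1)\<^sup>2 + (sin (2 * (pi * t)))\<^sup>2"
    by (simp add: cmod_power2 mult.assoc)
  also have "\<dots> = 4 * (sin (pi * t))\<^sup>2"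
    using sin_cos_squared_add[of "2 * (pi * t)"] cos_double_sin[of "pi * t"]
    by (simp add: power2_diff)
  finally have "(cmod (cis (2 * pi * (s + t)) - cis (2 * pi * s)))\<^sup>2 = 4 * (sin (pi * t))\<^sup>2" .
  moreover have "t\<^sup>2 \<le> (sin (pi * t))\<^sup>2"
    using abs_le_abs_sin_pi[OF assms] by (simp add: abs_le_square_iff)
  ultimately show ?thesis
    using zero_le_power2[of "sin (pi * t)"] by linarith
qed

text \<open>
  Representatives whose coordinates differ by at most one half bound the distance. The second bound expresses
  the distance by characters, so that its mean against a kernel of known Fourier coefficients can be
  computed exactly, without any estimate of the kernel away from the diagonal.
\<close>
lemma torus_dist_bounds:
  "torus_dist p q \<le> 1"
  "(torus_dist p q)\<^sup>2 \<le> (cmod (character (1, 0) p - character (1, 0) q))\<^sup>2 +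
     (cmod (character (0, 1) p - character (0, 1) q))\<^sup>2"
proof -
  obtain x y where xy: "p = abs_torus x" "q = abs_torus y"
    by (metis abs_torus_cases)
  define t :: "real^2" where "t = (\<chi> i. (x $ i - y $ i) - of_int (round (x $ i - y $ i)))"
  have t: "\<bar>t $ i\<bar> \<le> 1 / 2" for i
    using of_int_round_abs_le[of "x $ i - y $ i"] by (simp add: t_def abs_minus_commute)
  have q: "q = abs_torus (x - t)"
    unfolding xy(2) abs_torus_eq_iff by (simp add: t_def)
  have norm_t: "(norm t)\<^sup>2 = (t $ 1)\<^sup>2 + (t $ 2)\<^sup>2"
    by (simp add: norm_vec_def L2_set_def sum_2)
  have dist: "torus_dist p q \<le> norm t"
    using torus_dist_le[of x "x - t"] by (simp add: xy(1) q dist_norm)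
  have "(t $ i)\<^sup>2 \<le> (1 / 2)\<^sup>2" for i
    using t[of i] by (metis abs_ge_zero power2_abs power_mono)
  then have "(t $ i)\<^sup>2 \<le> 1 / 4" for i
    by (simp add: power_divide)
  from this[of 1] this[of 2] have "(norm t)\<^sup>2 \<le> 1\<^sup>2"
    unfolding norm_t by simp
  then have "norm t \<le> 1"
    by (rule power2_le_imp_le) simp
  with dist show "torus_dist p q \<le> 1"
    by linarith
  have "(torus_dist p q)\<^sup>2 \<le> (norm t)\<^sup>2"
    using dist torus_dist_nonneg by (intro power_mono)
  also have "\<dots> \<le> (cmod (character (1, 0) p - character (1, 0) q))\<^sup>2 +
     (cmod (character (0, 1) p - character (0, 1) q))\<^sup>2"
    unfolding norm_t xy(1) q character.abs_eq
    using cmod_cis_diff_ge[OF t[of 1], of "x $ 1 - t $ 1"] cmod_cis_diff_ge[OF t[of 2], of "x $ 2 - t $ 2"]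
    by (intro add_mono) simp_all
  finally show "(torus_dist p q)\<^sup>2 \<le> (cmod (character (1, 0) p - character (1, 0) q))\<^sup>2 +
     (cmod (character (0, 1) p - character (0, 1) q))\<^sup>2" .
qed

lemma integrable_torus_bounded:
  fixes F :: "torus \<Rightarrow> 'b::{banach, second_countable_topology}"
  assumes "F \<in> borel_measurable torus_measure" "\<And>x. norm (F x) \<le> M"
  shows "integrable torus_measure F"
  using assms by (intro torus.integrable_const_bound) auto

lemma norm_integral_torus_le:
  fixes F :: "torus \<Rightarrow> 'b::{banach, second_countable_topology}"
  assumes "F \<in> borel_measurable torus_measure" "\<And>x. norm (F x) \<le> M"
  shows "norm (\<integral>x. F x \<partial>torus_measure) \<le> M"
proof -
  have "norm (\<integral>x. F x \<partial>torus_measure) \<le> (\<integral>x. norm (F x) \<partial>torus_measure)"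
    by (rule integral_norm_bound)
  also have "\<dots> \<le> (\<integral>x. M \<partial>torus_measure)"
    using assms integrable_torus_bounded[OF assms] by (intro integral_mono) auto
  finally show ?thesis
    by (simp add: measure_torus_UNIV)
qed

definition frequency_box :: "nat \<Rightarrow> (int \<times> int) set" where
  "frequency_box N = {0..<int N} \<times> {0..<int N}"

text \<open>
  The product of two one-dimensional Fejer kernels, evaluated at \<open>x - y\<close>. Written as the square of a Dirichlet
  kernel, it is visibly nonnegative.
\<close>
definition fejer :: "nat \<Rightarrow> torus \<Rightarrow> torus \<Rightarrow> real" where
  "fejer N x y = (cmod (\<Sum>j\<in>frequency_box N. character j x * cnj (character j y)))\<^sup>2 / real N ^ 2"

lemma finite_frequency_box [simp]: "finite (frequency_box N)"
  by (simp add: frequency_box_def)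

lemma card_frequency_box: "card (frequency_box N) = N ^ 2"
  by (simp add: frequency_box_def card_cartesian_product power2_eq_square)

lemma fejer_nonneg: "fejer N x y \<ge> 0"
  by (simp add: fejer_def)

lemma fejer_expand:
  "complex_of_real (fejer N x y) = (\<Sum>z\<in>frequency_box N \<times> frequency_box N.
     character (fst z - snd z) x * cnj (character (fst z - snd z) y)) / of_nat N ^ 2"
proof -
  let ?B = "frequency_box N"
  let ?s = "\<Sum>j\<in>?B. character j x * cnj (character j y)"
  have "?s * cnj ?s = (\<Sum>i\<in>?B. \<Sum>j\<in>?B. (character i x * cnj (character i y)) * cnj (character j x * cnj (character j y)))"
    by (simp only: cnj_sum sum_product)
  also have "\<dots> = (\<Sum>z\<in>?B \<times> ?B. character (fst z - snd z) x * cnj (character (fst z - snd z) y))"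
    unfolding sum.cartesian_product character_diff by (intro sum.cong) (auto simp: mult_ac)
  finally have "complex_of_real ((cmod ?s)\<^sup>2) = \<dots>"
    by (simp only: complex_norm_square)
  then show ?thesis
    by (simp add: fejer_def)
qed

lemma measurable_fejer [measurable]: "fejer N x \<in> borel_measurable torus_measure"
  unfolding fejer_def cnj_character by measurable

lemma fejer_le: "fejer N x y \<le> real N ^ 2"
proof (cases "N = 0")
  case False
  have "cmod (\<Sum>j\<in>frequency_box N. character j x * cnj (character j y)) \<le> real (N ^ 2)"
    using sum_norm_bound[of "frequency_box N" "\<lambda>j. character j x * cnj (character j y)" 1]
    by (simp add: norm_mult card_frequency_box)
  then have "(cmod (\<Sum>j\<in>frequency_box N. character j x * cnj (character j y)))\<^sup>2 \<le> (real N ^ 2)\<^sup>2"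
    by (intro power_mono) auto
  then show ?thesis
    using False by (simp add: fejer_def divide_le_eq power2_eq_square)
qed (simp add: fejer_def)

lemma integral_fejer_character:
  "(\<integral>y. complex_of_real (fejer N x y) * character q y \<partial>torus_measure) =
    of_nat (card {z \<in> frequency_box N \<times> frequency_box N. fst z - snd z = q}) / of_nat N ^ 2 * character q x"
proof -
  let ?B = "frequency_box N \<times> frequency_box N"
  have "(\<integral>y. complex_of_real (fejer N x y) * character q y \<partial>torus_measure) =
      (\<integral>y. (\<Sum>z\<in>?B. character (fst z - snd z) x / of_nat N ^ 2 * character (q - (fst z - snd z)) y) \<partial>torus_measure)"
    unfolding fejer_expand sum_divide_distrib sum_distrib_right character_diff
    by (intro Bochner_Integration.integral_cong sum.cong refl) (simp add: character_diff mult_ac)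
  also have "\<dots> = (\<Sum>z\<in>?B. character (fst z - snd z) x / of_nat N ^ 2 *
      (\<integral>y. character (q - (fst z - snd z)) y \<partial>torus_measure))"
  proof -
    have "integrable torus_measure (\<lambda>y. character (fst z - snd z) x / of_nat N ^ 2 *
        character (q - (fst z - snd z)) y)" for z :: "(int \<times> int) \<times> int \<times> int"
      by (intro integrable_mult_right integrable_torus_bounded[where M = 1]) simp_all
    then show ?thesis
      by (subst Bochner_Integration.integral_sum) (simp_all only: integral_mult_right_zero)
  qed
  also have "\<dots> = (\<Sum>z\<in>?B. if fst z - snd z = q then character q x / of_nat N ^ 2 else 0)"
    unfolding integral_character by (intro sum.cong) auto
  also have "\<dots> = (\<Sum>z\<in>{z \<in> ?B. fst z - snd z = q}. character q x / of_nat N ^ 2)"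
    by (rule sum.inter_filter[symmetric]) simp
  finally show ?thesis by simp
qed

lemma card_frequency_differences:
  assumes "N > 0"
  shows "card {z \<in> frequency_box N \<times> frequency_box N. fst z - snd z = 0} = N ^ 2"
    and "card {z \<in> frequency_box N \<times> frequency_box N. fst z - snd z = (1, 0)} = (N - 1) * N"
    and "card {z \<in> frequency_box N \<times> frequency_box N. fst z - snd z = (0, 1)} = (N - 1) * N"
proof -
  have "{z \<in> frequency_box N \<times> frequency_box N. fst z - snd z = 0} = (\<lambda>j. (j, j)) ` frequency_box N"
    by auto
  then show "card {z \<in> frequency_box N \<times> frequency_box N. fst z - snd z = 0} = N ^ 2"
    by (simp add: card_image inj_on_def card_frequency_box)
  have "{z \<in> frequency_box N \<times> frequency_box N. fst z - snd z = (1, 0)} =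
      (\<lambda>j. (j + (1, 0), j)) ` ({0..<int N - 1} \<times> {0..<int N})"
    by (force simp: frequency_box_def image_iff)
  then show "card {z \<in> frequency_box N \<times> frequency_box N. fst z - snd z = (1, 0)} = (N - 1) * N"
    using assms by (simp add: card_image inj_on_def card_cartesian_product nat_diff_distrib)
  have "{z \<in> frequency_box N \<times> frequency_box N. fst z - snd z = (0, 1)} =
      (\<lambda>j. (j + (0, 1), j)) ` ({0..<int N} \<times> {0..<int N - 1})"
    by (force simp: frequency_box_def image_iff)
  then show "card {z \<in> frequency_box N \<times> frequency_box N. fst z - snd z = (0, 1)} = (N - 1) * N"
    using assms by (simp add: card_image inj_on_def card_cartesian_product nat_diff_distrib mult.commute)
qed


lemma integral_fejer:
  assumes "N > 0"
  shows "(\<integral>y. fejer N x y \<partial>torus_measure) = 1"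
proof -
  have "complex_of_real (\<integral>y. fejer N x y \<partial>torus_measure) = (\<integral>y. complex_of_real (fejer N x y) * character 0 y \<partial>torus_measure)"
    by simp
  also have "\<dots> = 1"
    unfolding integral_fejer_character card_frequency_differences[OF assms] using assms by simp
  finally show ?thesis
    by (simp only: of_real_eq_1_iff)
qed

lemma integrable_fejer_mult:
  fixes G :: "torus \<Rightarrow> real"
  assumes [measurable]: "G \<in> borel_measurable torus_measure" and G: "\<And>y. \<bar>G y\<bar> \<le> M"
  shows "integrable torus_measure (\<lambda>y. fejer N x y * G y)"
proof (rule integrable_torus_bounded[where M = "real N ^ 2 * M"])
  show "norm (fejer N x y * G y) \<le> real N ^ 2 * M" for y
    using mult_mono[OF fejer_le[of N x y] G[of y]] fejer_nonneg[of N x y] by (simp add: abs_mult)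
qed measurable

text \<open>
  The Fourier coefficient of the kernel at a unit frequency is \<open>1 - 1/N\<close>, and the squared distance between
  two points of the unit circle is 2 minus twice a real part.
\<close>
lemma integral_fejer_character_diff:
  assumes "N > 0" "q = (1, 0) \<or> q = (0, 1)"
  shows "(\<integral>y. fejer N x y * (cmod (character q x - character q y))\<^sup>2 \<partial>torus_measure) = 2 / real N"
proof -
  have sq: "(cmod (character q x - character q y))\<^sup>2 = 2 - 2 * Re (cnj (character q x) * character q y)" for y
  proof -
    have 1: "(cmod (character q z))\<^sup>2 = 1" for z by simp
    show ?thesis
      using 1[of x] 1[of y] unfolding cmod_power2 by (simp add: power2_diff algebra_simps)
  qed
  have count: "card {z \<in> frequency_box N \<times> frequency_box N. fst z - snd z = q} = (N - 1) * N"
    using assms(2) card_frequency_differences[OF assms(1)] by auto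
  have int: "integrable torus_measure (\<lambda>y. complex_of_real (fejer N x y) * character q y)"
    by (rule integrable_torus_bounded[where M = "real N ^ 2"])
      (simp_all add: norm_mult fejer_nonneg fejer_le)
  have "(\<integral>y. fejer N x y * (cmod (character q x - character q y))\<^sup>2 \<partial>torus_measure) =
      (\<integral>y. 2 * fejer N x y - 2 * Re (cnj (character q x) * (complex_of_real (fejer N x y) * character q y)) \<partial>torus_measure)"
    unfolding sq by (intro Bochner_Integration.integral_cong) (simp_all add: algebra_simps)
  also have "\<dots> = 2 * (\<integral>y. fejer N x y \<partial>torus_measure) -
      2 * Re (cnj (character q x) * (\<integral>y. complex_of_real (fejer N x y) * character q y \<partial>torus_measure))"
  proof -
    have int1: "integrable torus_measure (\<lambda>y. fejer N x y)"
      using integrable_fejer_mult[of "\<lambda>_. 1" 1 N x] by simp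
    have int2: "integrable torus_measure (\<lambda>y. cnj (character q x) * (complex_of_real (fejer N x y) * character q y))"
      by (rule integrable_mult_right[OF int])
    have Re: "(\<integral>y. Re (cnj (character q x) * (complex_of_real (fejer N x y) * character q y)) \<partial>torus_measure) =
        Re (cnj (character q x) * (\<integral>y. complex_of_real (fejer N x y) * character q y \<partial>torus_measure))"
      by (simp only: integral_Re[OF int2] integral_mult_right_zero)
    show ?thesis
      using int1 integrable_Re[OF int2]
      by (subst Bochner_Integration.integral_diff) (simp_all only: integral_mult_right_zero Re integrable_mult_right)
  qed
  also have "\<dots> = 2 - 2 * (real ((N - 1) * N) / real N ^ 2)"
  proof -
    have "cnj (character q x) * character q x = 1"
      using complex_norm_square[of "character q x"] by (simp add: mult.commute)
    then have "cnj (character q x) * (of_nat m / of_nat N ^ 2 * character q x) = complex_of_real (real m / real N ^ 2)" for m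
      by (simp add: mult.left_commute)
    then show ?thesis
      unfolding integral_fejer_character count integral_fejer[OF assms(1)] by (simp only: Re_complex_of_real)
  qed
  also have "\<dots> = 2 / real N"
    using assms(1) by (simp add: of_nat_diff field_simps power2_eq_square)
  finally show ?thesis .
qed

lemma continuous_hoelder:
  assumes "\<gamma> > 0" "c > 0" "\<And>x y. cmod (F x - F y) \<le> c * torus_dist x y powr \<gamma>"
  shows "continuous_on UNIV (\<lambda>x. F (abs_torus x))"
proof -
  have "((\<lambda>y. F (abs_torus y)) \<longlongrightarrow> F (abs_torus x)) (at x)" for x
  proof -
    have le: "norm (F (abs_torus y) - F (abs_torus x)) \<le> c * dist y x powr \<gamma>" for y
    proof -
      have "c * torus_dist (abs_torus y) (abs_torus x) powr \<gamma> \<le> c * dist y x powr \<gamma>"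
        using assms(1,2) by (intro mult_left_mono powr_mono2 torus_dist_nonneg torus_dist_le) auto
      then show ?thesis
        using assms(3)[of "abs_torus y" "abs_torus x"] by linarith
    qed
    have "((\<lambda>y. dist y x powr \<gamma>) \<longlongrightarrow> 0 powr \<gamma>) (at x)"
      using assms(1) by (intro tendsto_powr' tendsto_dist_iff[THEN iffD1] tendsto_ident_at tendsto_const) auto
    then have "((\<lambda>y. c * dist y x powr \<gamma>) \<longlongrightarrow> 0) (at x)"
      using tendsto_mult_right_zero by force
    then have "((\<lambda>y. F (abs_torus y) - F (abs_torus x)) \<longlongrightarrow> 0) (at x)"
      by (rule Lim_null_comparison[OF always_eventually[OF allI[OF le]]])
    then show ?thesis
      by (rule LIM_zero_cancel)
  qed
  then show ?thesis
    by (simp add: continuous_on_def)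
qed

lemma hoelder_measurable: "F \<in> hoelder_torus \<Longrightarrow> F \<in> borel_measurable torus_measure"
  unfolding measurable_torus_iff hoelder_torus_def
  by (auto intro!: borel_measurable_continuous_onI intro: continuous_hoelder)

lemma hoelder_bounded:
  assumes "F \<in> hoelder_torus"
  obtains M where "M > 0" "\<And>x. cmod (F x) \<le> M"
proof -
  obtain \<gamma> c where F: "\<gamma> > 0" "c > 0" "\<And>x y. cmod (F x - F y) \<le> c * torus_dist x y powr \<gamma>"
    using assms unfolding hoelder_torus_def by auto
  define o' where "o' = abs_torus 0"
  have "cmod (F x) \<le> cmod (F o') + c" for x
  proof -
    have "torus_dist x o' powr \<gamma> \<le> 1 powr \<gamma>"
      using torus_dist_bounds(1) torus_dist_nonneg F(1) by (intro powr_mono2) auto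
    then have "c * torus_dist x o' powr \<gamma> \<le> c * 1"
      using F(2) by (intro mult_left_mono) auto
    then have "cmod (F x - F o') \<le> c * 1"
      using F(3)[of x o'] by linarith
    then show ?thesis
      using norm_triangle_sub[of "F x" "F o'"] by simp
  qed
  then show thesis
    using that[of "cmod (F o') + c"] F(2) by (simp add: add_nonneg_pos)
qed

text \<open>
  Frequencies are written as differences of elements of the box, as they arise from the Fejer kernel;
  these differences are the frequencies with entries below \<open>N\<close> in absolute value, possibly repeated.
\<close>
definition trigonometric_polynomial :: "nat \<Rightarrow> (torus \<Rightarrow> complex) \<Rightarrow> bool" where
  "trigonometric_polynomial N P \<longleftrightarrow>
     (\<exists>a. P = (\<lambda>x. \<Sum>z\<in>frequency_box N \<times> frequency_box N. a z * character (fst z - snd z) x))"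

lemma fejer_mean_trigonometric:
  assumes [measurable]: "F \<in> borel_measurable torus_measure" and F: "\<And>x. cmod (F x) \<le> M"
  shows "trigonometric_polynomial N (\<lambda>x. \<integral>y. complex_of_real (fejer N x y) * F y \<partial>torus_measure)"
proof -
  let ?B = "frequency_box N \<times> frequency_box N"
  let ?a = "\<lambda>z. (\<integral>y. cnj (character (fst z - snd z) y) * F y / of_nat N ^ 2 \<partial>torus_measure)"
  have "(\<integral>y. complex_of_real (fejer N x y) * F y \<partial>torus_measure) = (\<Sum>z\<in>?B. ?a z * character (fst z - snd z) x)" for x
  proof -
    have "(\<integral>y. complex_of_real (fejer N x y) * F y \<partial>torus_measure) =
        (\<integral>y. (\<Sum>z\<in>?B. character (fst z - snd z) x * (cnj (character (fst z - snd z) y) * F y / of_nat N ^ 2)) \<partial>torus_measure)"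
      unfolding fejer_expand sum_divide_distrib sum_distrib_right
      by (intro Bochner_Integration.integral_cong sum.cong refl) (simp add: mult_ac)
    also have "\<dots> = (\<Sum>z\<in>?B. character (fst z - snd z) x * ?a z)"
    proof -
      have "integrable torus_measure (\<lambda>y. character (fst z - snd z) x * (cnj (character (fst z - snd z) y) * F y / of_nat N ^ 2))"
        for z :: "(int \<times> int) \<times> int \<times> int"
        unfolding cnj_character
        by (rule integrable_torus_bounded[where M = "M / real N ^ 2"])
          (auto simp: norm_mult norm_divide norm_power intro!: divide_right_mono F)
      then show ?thesis
        by (subst Bochner_Integration.integral_sum) (simp_all only: integral_mult_right_zero)
    qed
    finally show ?thesis by (simp add: mult.commute)
  qed
  then show ?thesis
    unfolding trigonometric_polynomial_def by (intro exI[of _ ?a]) auto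
qed

text \<open>
  The error of the Fejer mean at \<open>x\<close> is the mean of \<open>F x - F y\<close> against the kernel. For distances \<open>d \<le> 1\<close> and
  any \<open>\<delta> > 0\<close>, the Hoelder bound \<open>d powr \<gamma>\<close> is at most \<open>\<delta> powr \<gamma> + d\<^sup>2/\<delta>\<^sup>2\<close>, and the mean of \<open>d\<^sup>2\<close> is at most
  \<open>4/N\<close>. The choice \<open>\<delta> = N powr (-1/4)\<close> makes both terms negative powers of \<open>N\<close>.
\<close>
lemma hoelder_approximation:
  assumes "F \<in> hoelder_torus"
  obtains C \<beta> where "C > 0" "\<beta> > 0"
    "\<And>N. N > 0 \<Longrightarrow> \<exists>P. trigonometric_polynomial N P \<and> (\<forall>x. cmod (F x - P x) \<le> C * real N powr (- \<beta>))"
proof -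
  obtain \<gamma> c where F: "\<gamma> > 0" "c > 0" "\<And>x y. cmod (F x - F y) \<le> c * torus_dist x y powr \<gamma>"
    using assms unfolding hoelder_torus_def by auto
  obtain M where M: "\<And>x. cmod (F x) \<le> M"
    using hoelder_bounded[OF assms] by blast
  have [measurable]: "F \<in> borel_measurable torus_measure"
    using assms by (rule hoelder_measurable)
  define \<beta> where "\<beta> = min (\<gamma> / 4) (1 / 2)"
  have "cmod (F x - (\<integral>y. complex_of_real (fejer N x y) * F y \<partial>torus_measure)) \<le> 5 * c * real N powr (- \<beta>)"
    if N: "N > 0" for x N
  proof -
    define \<delta> where "\<delta> = real N powr (- 1 / 4)"
    have \<delta>: "\<delta> > 0" using N by (simp add: \<delta>_def)
    define g where "g y = (cmod (character (1, 0) x - character (1, 0) y))\<^sup>2 +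
      (cmod (character (0, 1) x - character (0, 1) y))\<^sup>2" for y
    have g_meas [measurable]: "g \<in> borel_measurable torus_measure"
      unfolding g_def by measurable
    have sq_le: "(cmod (character q x - character q y))\<^sup>2 \<le> 4" for q y
      using power_mono[of "cmod (character q x - character q y)" 2 2]
        norm_triangle_ineq4[of "character q x" "character q y"] by simp
    have "\<bar>g y\<bar> \<le> 8" for y
      using sq_le[of "(1, 0)" y] sq_le[of "(0, 1)" y] by (simp add: g_def)
    then have int_g: "integrable torus_measure (\<lambda>y. fejer N x y * g y)"
      by (intro integrable_fejer_mult) auto
    have "integrable torus_measure (\<lambda>y. fejer N x y * (cmod (character q x - character q y))\<^sup>2)" for q
      using sq_le[of q] by (intro integrable_fejer_mult[where M = 4]) auto
    then have integral_g: "(\<integral>y. fejer N x y * g y \<partial>torus_measure) = 4 / real N"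
      unfolding g_def distrib_left using N by (simp add: integral_fejer_character_diff)
    have int_fejer: "integrable torus_measure (fejer N x)"
      using integrable_fejer_mult[of "\<lambda>_. 1" 1 N x] by simp
    have pointwise: "cmod (F x - F y) \<le> c * \<delta> powr \<gamma> + c / \<delta>\<^sup>2 * g y" for y
    proof -
      let ?d = "torus_dist x y"
      have d: "0 \<le> ?d" "?d \<le> 1" "?d\<^sup>2 \<le> g y"
        using torus_dist_nonneg torus_dist_bounds by (auto simp: g_def)
      have "?d powr \<gamma> \<le> \<delta> powr \<gamma> + g y / \<delta>\<^sup>2"
      proof (cases "?d \<le> \<delta>")
        case True
        then have "?d powr \<gamma> \<le> \<delta> powr \<gamma>"
          using d F(1) by (intro powr_mono2) auto
        moreover have "g y / \<delta>\<^sup>2 \<ge> 0"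
          by (simp add: g_def)
        ultimately show ?thesis by linarith
      next
        case False
        have "?d powr \<gamma> \<le> 1 powr \<gamma>"
          using d F(1) by (intro powr_mono2) auto
        also have "1 powr \<gamma> \<le> ?d\<^sup>2 / \<delta>\<^sup>2"
          using False \<delta> by (simp add: le_divide_eq power_mono)
        also have "\<dots> \<le> g y / \<delta>\<^sup>2"
          using d by (intro divide_right_mono) auto
        finally show ?thesis by (simp add: add_increasing)
      qed
      then have "c * ?d powr \<gamma> \<le> c * (\<delta> powr \<gamma> + g y / \<delta>\<^sup>2)"
        using F(2) by (intro mult_left_mono) auto
      then show ?thesis
        using F(3)[of x y] by (simp add: algebra_simps)
    qed
    have int_F: "integrable torus_measure (\<lambda>y. complex_of_real (fejer N x y) * F y)"
      by (rule integrable_torus_bounded[where M = "real N ^ 2 * M"])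
        (auto simp: norm_mult fejer_nonneg intro!: mult_mono fejer_le M)
    have "F x - (\<integral>y. complex_of_real (fejer N x y) * F y \<partial>torus_measure) =
        (\<integral>y. complex_of_real (fejer N x y) * F x \<partial>torus_measure) - (\<integral>y. complex_of_real (fejer N x y) * F y \<partial>torus_measure)"
      using integral_fejer[OF N, of x] by simp
    also have "\<dots> = (\<integral>y. complex_of_real (fejer N x y) * (F x - F y) \<partial>torus_measure)"
      using int_F int_fejer by (subst Bochner_Integration.integral_diff[symmetric]) (auto simp: right_diff_distrib)
    finally have "cmod (F x - (\<integral>y. complex_of_real (fejer N x y) * F y \<partial>torus_measure)) \<le>
        (\<integral>y. cmod (complex_of_real (fejer N x y) * (F x - F y)) \<partial>torus_measure)"
      by (simp only: integral_norm_bound)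
    also have "\<dots> \<le> (\<integral>y. c * \<delta> powr \<gamma> * fejer N x y + c / \<delta>\<^sup>2 * (fejer N x y * g y) \<partial>torus_measure)"
    proof (rule integral_mono')
      show "cmod (complex_of_real (fejer N x y) * (F x - F y)) \<le>
          c * \<delta> powr \<gamma> * fejer N x y + c / \<delta>\<^sup>2 * (fejer N x y * g y)" for y
      proof -
        have "cmod (complex_of_real (fejer N x y) * (F x - F y)) = fejer N x y * cmod (F x - F y)"
          by (simp only: norm_mult norm_of_real abs_of_nonneg[OF fejer_nonneg])
        also have "\<dots> \<le> fejer N x y * (c * \<delta> powr \<gamma> + c / \<delta>\<^sup>2 * g y)"
          by (rule mult_left_mono[OF pointwise fejer_nonneg])
        finally show "cmod (complex_of_real (fejer N x y) * (F x - F y)) \<le>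
          c * \<delta> powr \<gamma> * fejer N x y + c / \<delta>\<^sup>2 * (fejer N x y * g y)"
          by (simp add: algebra_simps)
      qed
      show "0 \<le> c * \<delta> powr \<gamma> * fejer N x y + c / \<delta>\<^sup>2 * (fejer N x y * g y)" for y
        using F(2) by (simp add: fejer_nonneg g_def)
    qed (use int_fejer int_g in \<open>intro Bochner_Integration.integrable_add integrable_mult_right; simp\<close>)
    also have "\<dots> = c * \<delta> powr \<gamma> + c / \<delta>\<^sup>2 * (4 / real N)"
      using int_fejer int_g integral_fejer[OF N, of x] integral_g by simp
    also have "\<dots> = c * real N powr (- (\<gamma> / 4)) + 4 * c * real N powr (- (1 / 2))"
    proof -
      have "\<delta> powr \<gamma> = real N powr (- (\<gamma> / 4))"
        by (simp add: \<delta>_def powr_powr)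
      moreover have "1 / \<delta>\<^sup>2 / real N = real N powr (- (1 / 2))"
      proof -
        have "\<delta>\<^sup>2 = real N powr (- (1 / 2))"
          using \<delta> by (simp add: \<delta>_def powr_powr flip: powr_numeral)
        moreover have "real N powr (- (1 / 2)) * real N powr (- (1 / 2)) * real N = 1"
          using N unfolding powr_add[symmetric] by (simp add: powr_minus)
        ultimately show ?thesis
          using N \<delta> by (simp add: field_simps)
      qed
      moreover have "c / \<delta>\<^sup>2 * (4 / real N) = 4 * c * (1 / \<delta>\<^sup>2 / real N)"
        by simp
      ultimately show ?thesis
        by (simp only:)
    qed
    also have "\<dots> \<le> c * real N powr (- \<beta>) + 4 * c * real N powr (- \<beta>)"
      using F(2) N by (intro add_mono mult_left_mono powr_mono) (auto simp: \<beta>_def)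
    finally show ?thesis by simp
  qed
  note bound = this
  show thesis
  proof (rule that[of "5 * c" \<beta>])
    show "5 * c > 0" "\<beta> > 0"
      using F(1,2) by (simp_all add: \<beta>_def)
    show "\<exists>P. trigonometric_polynomial N P \<and> (\<forall>x. cmod (F x - P x) \<le> 5 * c * real N powr (- \<beta>))"
      if "N > 0" for N
    proof (intro exI conjI allI)
      show "trigonometric_polynomial N (\<lambda>x. \<integral>y. complex_of_real (fejer N x y) * F y \<partial>torus_measure)"
        by (rule fejer_mean_trigonometric[OF _ M]) measurable
    qed (rule bound[OF that])
  qed
qed

section \<open>Decay of correlations\<close>

definition bounded_measurable :: "(torus \<Rightarrow> complex) \<Rightarrow> bool" where
  "bounded_measurable F \<longleftrightarrow> F \<in> borel_measurable torus_measure \<and> (\<exists>M. \<forall>x. cmod (F x) \<le> M)"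

lemma bounded_measurable_integrable: "bounded_measurable F \<Longrightarrow> integrable torus_measure F"
  unfolding bounded_measurable_def by (auto intro: integrable_torus_bounded)

lemma bounded_measurable_mult:
  assumes "bounded_measurable F" "bounded_measurable G"
  shows "bounded_measurable (\<lambda>x. F x * G x)"
proof -
  obtain a b where ab: "\<And>x. cmod (F x) \<le> a" "\<And>x. cmod (G x) \<le> b"
    using assms by (auto simp: bounded_measurable_def)
  then have "cmod (F x * G x) \<le> a * b" for x
    unfolding norm_mult by (intro mult_mono) (auto intro: order.trans[OF norm_ge_zero])
  then show ?thesis
    using assms by (auto simp: bounded_measurable_def)
qed

lemma bounded_measurable_torus_action:
  "bounded_measurable F \<Longrightarrow> bounded_measurable (\<lambda>x. F (torus_action A x))"
  unfolding bounded_measurable_def by (auto intro: measurable_compose[OF measurable_torus_action])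

lemma hoelder_bounded_measurable: "F \<in> hoelder_torus \<Longrightarrow> bounded_measurable F"
  unfolding bounded_measurable_def by (meson hoelder_bounded hoelder_measurable)

lemma trigonometric_bounded_measurable:
  assumes "trigonometric_polynomial N P"
  shows "bounded_measurable P"
proof -
  obtain a where P: "P = (\<lambda>x. \<Sum>z\<in>frequency_box N \<times> frequency_box N. a z * character (fst z - snd z) x)"
    using assms by (auto simp: trigonometric_polynomial_def)
  have "cmod (P x) \<le> (\<Sum>z\<in>frequency_box N \<times> frequency_box N. cmod (a z))" for x
    unfolding P by (rule sum_norm_le) (simp add: norm_mult)
  moreover have "P \<in> borel_measurable torus_measure"
    unfolding P by measurable
  ultimately show ?thesis
    by (auto simp: bounded_measurable_def)
qed

lemma correlation_split:
  assumes "integrable torus_measure F" "integrable torus_measure P" "integrable torus_measure G" "integrable torus_measure Q"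
    and "integrable torus_measure (\<lambda>x. F (torus_action A x) * G x)"
    and "integrable torus_measure (\<lambda>x. P (torus_action A x) * G x)"
    and "integrable torus_measure (\<lambda>x. P (torus_action A x) * Q x)"
  shows "correlation F G A = correlation (\<lambda>x. F x - P x) G A + correlation P (\<lambda>x. G x - Q x) A + correlation P Q A"
proof -
  have "(\<integral>x. (F (torus_action A x) - P (torus_action A x)) * G x \<partial>torus_measure) =
      (\<integral>x. F (torus_action A x) * G x \<partial>torus_measure) - (\<integral>x. P (torus_action A x) * G x \<partial>torus_measure)"
    unfolding left_diff_distrib using assms by (intro Bochner_Integration.integral_diff)
  moreover have "(\<integral>x. P (torus_action A x) * (G x - Q x) \<partial>torus_measure) =
      (\<integral>x. P (torus_action A x) * G x \<partial>torus_measure) - (\<integral>x. P (torus_action A x) * Q x \<partial>torus_measure)"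
    unfolding right_diff_distrib using assms by (intro Bochner_Integration.integral_diff)
  ultimately show ?thesis
    using assms(1-4) by (simp add: correlation_def algebra_simps)
qed

lemma correlation_bounded:
  assumes "F \<in> borel_measurable torus_measure" "G \<in> borel_measurable torus_measure"
    and "\<And>x. cmod (F x) \<le> a" "\<And>x. cmod (G x) \<le> b"
  shows "cmod (correlation F G A) \<le> 2 * a * b"
proof -
  have [measurable]: "F \<in> borel_measurable torus_measure" "G \<in> borel_measurable torus_measure"
    by fact+
  have a: "0 \<le> a"
    using assms(3) norm_ge_zero order.trans by blast
  have "cmod (\<integral>x. F (torus_action A x) * G x \<partial>torus_measure) \<le> a * b"
    using a by (intro norm_integral_torus_le) (auto simp: norm_mult intro!: mult_mono assms)
  moreover have "cmod ((\<integral>x. F x \<partial>torus_measure) * (\<integral>x. G x \<partial>torus_measure)) \<le> a * b"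
    unfolding norm_mult using a by (intro mult_mono norm_integral_torus_le assms) auto
  ultimately show ?thesis
    unfolding correlation_def
    using norm_triangle_ineq4[of "\<integral>x. F (torus_action A x) * G x \<partial>torus_measure"
        "(\<integral>x. F x \<partial>torus_measure) * (\<integral>x. G x \<partial>torus_measure)"] by simp
qed

lemma frequency_box_diff:
  assumes "z \<in> frequency_box N \<times> frequency_box N"
  shows "\<bar>fst (fst z - snd z)\<bar> < int N" "\<bar>snd (fst z - snd z)\<bar> < int N"
  using assms by (auto simp: frequency_box_def)

lemma separates_frequencies_dual_action:
  assumes "separates_frequencies (int N) A"
    and "\<bar>fst p\<bar> < int N" "\<bar>snd p\<bar> < int N" "\<bar>fst q\<bar> < int N" "\<bar>snd q\<bar> < int N"
  shows "dual_action A p + q = 0 \<longleftrightarrow> p = 0 \<and> q = 0"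
proof
  assume "dual_action A p + q = 0"
  then have q: "q = - dual_action A p"
    by (simp add: eq_neg_iff_add_eq_0 add.commute)
  then have "\<bar>fst (dual_action A p)\<bar> < int N" "\<bar>snd (dual_action A p)\<bar> < int N"
    using assms(4,5) by simp_all
  then have "(fst p, snd p) = (0, 0)"
    using assms(1-3) unfolding separates_frequencies_def dual_action_def fst_conv snd_conv by blast
  then show "p = 0 \<and> q = 0"
    unfolding q by (simp add: dual_action_def zero_prod_def prod_eq_iff)
qed (simp add: dual_action_def zero_prod_def)

lemma integral_character_sum:
  "(\<integral>x. (\<Sum>i\<in>I. a i * character (p i) x) \<partial>torus_measure) = (\<Sum>i\<in>I. a i * (if p i = 0 then 1 else 0))"
proof -
  have "integrable torus_measure (\<lambda>x. a i * character (p i) x)" for i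
    by (intro integrable_mult_right integrable_torus_bounded[where M = 1]) simp_all
  then show ?thesis
    by (subst Bochner_Integration.integral_sum) (simp_all only: integral_mult_right_zero integral_character)
qed

text \<open>
  Expanding both polynomials, the integral of the product collects the pairs of frequencies with
  \<open>p A + q = 0\<close>. If \<open>A\<close> separates the frequencies involved, \<open>p\<close> and \<open>q\<close> vanish, and these terms form the
  product of the two means.
\<close>
lemma correlation_trigonometric:
  assumes "trigonometric_polynomial N P" "trigonometric_polynomial N Q" "separates_frequencies (int N) A"
  shows "correlation P Q A = 0"
proof -
  let ?B = "frequency_box N \<times> frequency_box N"
  let ?d = "\<lambda>z. fst z - snd z :: int \<times> int"
  obtain a where P: "P = (\<lambda>x. \<Sum>z\<in>?B. a z * character (?d z) x)"
    using assms by (auto simp: trigonometric_polynomial_def)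
  obtain b where Q: "Q = (\<lambda>x. \<Sum>z\<in>?B. b z * character (?d z) x)"
    using assms by (auto simp: trigonometric_polynomial_def)
  have "(\<integral>x. P (torus_action A x) * Q x \<partial>torus_measure) =
      (\<integral>x. (\<Sum>w\<in>?B \<times> ?B. a (fst w) * b (snd w) * character (dual_action A (?d (fst w)) + ?d (snd w)) x) \<partial>torus_measure)"
    unfolding P Q sum_product character_torus_action
    by (simp add: sum.cartesian_product character_add case_prod_unfold mult_ac)
  also have "\<dots> = (\<Sum>w\<in>?B \<times> ?B. a (fst w) * b (snd w) *
      (if dual_action A (?d (fst w)) + ?d (snd w) = 0 then 1 else 0))"
    by (rule integral_character_sum)
  also have "\<dots> = (\<Sum>w\<in>?B \<times> ?B. (a (fst w) * (if ?d (fst w) = 0 then 1 else 0)) *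
      (b (snd w) * (if ?d (snd w) = 0 then 1 else 0)))"
  proof (rule sum.cong[OF refl])
    fix w assume "w \<in> ?B \<times> ?B"
    then have "fst w \<in> ?B" "snd w \<in> ?B" by auto
    then show "a (fst w) * b (snd w) * (if dual_action A (?d (fst w)) + ?d (snd w) = 0 then 1 else 0) =
      (a (fst w) * (if ?d (fst w) = 0 then 1 else 0)) * (b (snd w) * (if ?d (snd w) = 0 then 1 else 0))"
      using separates_frequencies_dual_action[OF assms(3)] frequency_box_diff by simp
  qed
  also have "\<dots> = (\<Sum>z\<in>?B. a z * (if ?d z = 0 then 1 else 0)) * (\<Sum>z\<in>?B. b z * (if ?d z = 0 then 1 else 0))"
    unfolding sum_product sum.cartesian_product by (simp add: case_prod_unfold)
  also have "\<dots> = (\<integral>x. P x \<partial>torus_measure) * (\<integral>x. Q x \<partial>torus_measure)"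
    unfolding P Q integral_character_sum ..
  finally show ?thesis
    by (simp add: correlation_def)
qed

lemma hoelder_correlation_bound:
  assumes "F \<in> hoelder_torus" "G \<in> hoelder_torus"
  obtains C \<beta> where "C > 0" "\<beta> > 0"
    "\<And>N A. N > 0 \<Longrightarrow> separates_frequencies (int N) A \<Longrightarrow>
       cmod (correlation F G A) \<le> C * real N powr (- \<beta>)"
proof -
  obtain a \<alpha> where a: "a > 0" "\<alpha> > 0"
    "\<And>N. N > 0 \<Longrightarrow> \<exists>P. trigonometric_polynomial N P \<and> (\<forall>x. cmod (F x - P x) \<le> a * real N powr (- \<alpha>))"
    using hoelder_approximation[OF assms(1)] by metis
  obtain b \<beta> where b: "b > 0" "\<beta> > 0"
    "\<And>N. N > 0 \<Longrightarrow> \<exists>P. trigonometric_polynomial N P \<and> (\<forall>x. cmod (G x - P x) \<le> b * real N powr (- \<beta>))"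
    using hoelder_approximation[OF assms(2)] by metis
  obtain M where M: "M > 0" "\<And>x. cmod (F x) \<le> M"
    using hoelder_bounded[OF assms(1)] by blast
  obtain K where K: "K > 0" "\<And>x. cmod (G x) \<le> K"
    using hoelder_bounded[OF assms(2)] by blast
  let ?m = "min \<alpha> \<beta>"
  have "cmod (correlation F G A) \<le> (2 * a * K + 2 * (M + a) * b) * real N powr (- ?m)"
    if N: "N > 0" and A: "separates_frequencies (int N) A" for N A
  proof -
    obtain P where P: "trigonometric_polynomial N P" "\<And>x. cmod (F x - P x) \<le> a * real N powr (- \<alpha>)"
      using a(3)[OF N] by blast
    obtain Q where Q: "trigonometric_polynomial N Q" "\<And>x. cmod (G x - Q x) \<le> b * real N powr (- \<beta>)"
      using b(3)[OF N] by blast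
    have bm: "bounded_measurable F" "bounded_measurable G" "bounded_measurable P" "bounded_measurable Q"
      using assms P Q hoelder_bounded_measurable trigonometric_bounded_measurable by blast+
    have meas: "F \<in> borel_measurable torus_measure" "G \<in> borel_measurable torus_measure"
      "P \<in> borel_measurable torus_measure" "Q \<in> borel_measurable torus_measure"
      using bm by (auto simp: bounded_measurable_def)
    have "real N powr (- \<alpha>) \<le> 1"
      using powr_mono[of "- \<alpha>" 0 "real N"] N a(2) by simp
    then have "a * real N powr (- \<alpha>) \<le> a * 1"
      using a(1) by (intro mult_left_mono) auto
    then have P_le: "cmod (P x) \<le> M + a" for x
      using norm_triangle_sub[of "P x" "F x"] M(2)[of x] P(2)[of x] by (simp add: norm_minus_commute)
    have "correlation F G A =
        correlation (\<lambda>x. F x - P x) G A + correlation P (\<lambda>x. G x - Q x) A + correlation P Q A"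
      by (intro correlation_split bounded_measurable_integrable bounded_measurable_mult
          bounded_measurable_torus_action bm)
    also have "correlation P Q A = 0"
      by (rule correlation_trigonometric[OF P(1) Q(1) A])
    finally have "cmod (correlation F G A) \<le>
        cmod (correlation (\<lambda>x. F x - P x) G A) + cmod (correlation P (\<lambda>x. G x - Q x) A)"
      by (simp add: norm_triangle_ineq)
    also have "cmod (correlation (\<lambda>x. F x - P x) G A) \<le> 2 * (a * real N powr (- \<alpha>)) * K"
      using meas by (intro correlation_bounded P K) auto
    also have "\<dots> \<le> 2 * (a * real N powr (- ?m)) * K"
      using N a K by (intro mult_right_mono mult_left_mono powr_mono) auto
    also have "cmod (correlation P (\<lambda>x. G x - Q x) A) \<le> 2 * (M + a) * (b * real N powr (- \<beta>))"
      using meas by (intro correlation_bounded P_le Q) auto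
    also have "\<dots> \<le> 2 * (M + a) * (b * real N powr (- ?m))"
      using N a b M by (intro mult_left_mono powr_mono) auto
    finally show ?thesis
      by (simp add: algebra_simps)
  qed
  moreover have "2 * a * K + 2 * (M + a) * b > 0"
    using a b M K by (simp add: add_pos_pos)
  ultimately show thesis
    using that[of "2 * a * K + 2 * (M + a) * b" ?m] a(2) b(2) by simp
qed

text \<open>
  The power bound is applied with \<open>N = 2^j\<close> and the largest admissible \<open>j\<close>; the finitely many \<open>k < k0\<close> only
  affect the constant.
\<close>
lemma exponential_decay_if_separates_frequencies:
  fixes \<delta> :: real
  assumes \<delta>: "\<delta> > 0"
    and sep: "\<And>k j. k \<ge> k0 \<Longrightarrow> real j \<le> \<delta> * real k \<Longrightarrow> separates_frequencies (2 ^ j) (f k)"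
  shows "exponential_decay_hoelder f"
  unfolding exponential_decay_hoelder_def
proof (intro ballI)
  fix F G assume FG: "F \<in> hoelder_torus" "G \<in> hoelder_torus"
  obtain C \<beta> where C: "C > 0" "\<beta> > 0"
    "\<And>N A. N > 0 \<Longrightarrow> separates_frequencies (int N) A \<Longrightarrow> cmod (correlation F G A) \<le> C * real N powr (- \<beta>)"
    using hoelder_correlation_bound[OF FG] by metis
  obtain M where M: "M > 0" "\<And>x. cmod (F x) \<le> M"
    using hoelder_bounded[OF FG(1)] by blast
  obtain K where K: "K > 0" "\<And>x. cmod (G x) \<le> K"
    using hoelder_bounded[OF FG(2)] by blast
  define \<gamma> where "\<gamma> = \<beta> * \<delta> * ln 2"
  have \<gamma>: "\<gamma> > 0" using C \<delta> by (simp add: \<gamma>_def)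
  define c where "c = C * exp (\<beta> * ln 2) + 2 * M * K * exp (\<gamma> * real k0)"
  have "cmod (correlation F G (f k)) \<le> c * exp (- \<gamma> * real k)" for k
  proof (cases "k \<ge> k0")
    case True
    define j where "j = nat \<lfloor>\<delta> * real k\<rfloor>"
    have "\<delta> * real k \<ge> 0" using \<delta> by simp
    then have j: "real j \<le> \<delta> * real k" "\<delta> * real k - 1 \<le> real j"
      by (auto simp: j_def)
    have "cmod (correlation F G (f k)) \<le> C * real (2 ^ j) powr (- \<beta>)"
      using sep[OF True j(1)] by (intro C(3)) simp_all
    also have "real (2 ^ j) powr (- \<beta>) = exp (- (\<beta> * ln 2) * real j)"
      by (simp add: powr_def ln_realpow)
    also have "\<dots> \<le> exp (- (\<beta> * ln 2) * (\<delta> * real k - 1))"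
      using j(2) C(2) by (simp add: mult_left_mono)
    also have "- (\<beta> * ln 2) * (\<delta> * real k - 1) = \<beta> * ln 2 + - \<gamma> * real k"
      by (simp add: \<gamma>_def algebra_simps)
    also have "exp (\<beta> * ln 2 + - \<gamma> * real k) = exp (\<beta> * ln 2) * exp (- \<gamma> * real k)"
      by (rule exp_add)
    finally have "cmod (correlation F G (f k)) \<le> C * exp (\<beta> * ln 2) * exp (- \<gamma> * real k)"
      using C(1) by (simp only: mult.assoc mult_left_mono less_imp_le)
    also have "\<dots> \<le> c * exp (- \<gamma> * real k)"
      using M K by (intro mult_right_mono) (simp_all add: c_def)
    finally show ?thesis .
  next
    case False
    have "cmod (correlation F G (f k)) \<le> 2 * M * K"
      by (intro correlation_bounded hoelder_measurable FG M K)
    also have "\<dots> \<le> 2 * M * K * exp (\<gamma> * (real k0 - real k))"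
      using False \<gamma> M K by simp
    also have "\<dots> = 2 * M * K * exp (\<gamma> * real k0) * exp (- \<gamma> * real k)"
      by (simp add: right_diff_distrib exp_diff exp_minus field_simps)
    also have "\<dots> \<le> c * exp (- \<gamma> * real k)"
      using C by (intro mult_right_mono) (simp_all add: c_def)
    finally show ?thesis .
  qed
  moreover have "c > 0"
    using C M K by (simp add: c_def add_pos_pos)
  ultimately show "\<exists>c>0. \<exists>\<gamma>>0. \<forall>k\<ge>1. cmod (correlation F G (f k)) \<le> c * exp (- \<gamma> * real k)"
    using \<gamma> by blast
qed

section \<open>Invariance of the measure\<close>

text \<open>
  The preimage in the plane of the image of \<open>T\<close> in the torus.
\<close>
definition lattice_translates :: "(real^2) set \<Rightarrow> (real^2) set" where
  "lattice_translates T = {x. abs_torus x \<in> abs_torus ` T}"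

lemma lattice_translates_eq: "lattice_translates T = {t + z | t z. t \<in> T \<and> z \<in> {z. \<forall>i. z $ i \<in> \<int>}}"
proof (rule equalityI; rule subsetI)
  fix x assume "x \<in> lattice_translates T"
  then obtain t where "t \<in> T" "\<forall>i. x $ i - t $ i \<in> \<int>"
    by (auto simp: lattice_translates_def abs_torus_eq_iff)
  then have "x = t + (x - t) \<and> t \<in> T \<and> x - t \<in> {z. \<forall>i. z $ i \<in> \<int>}"
    by simp
  then show "x \<in> {t + z | t z. t \<in> T \<and> z \<in> {z. \<forall>i. z $ i \<in> \<int>}}"
    by blast
next
  fix x assume "x \<in> {t + z | t z. t \<in> T \<and> z \<in> {z. \<forall>i. z $ i \<in> \<int>}}"
  then obtain t z where "x = t + z" "t \<in> T" "\<forall>i. z $ i \<in> \<int>"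
    by auto
  then have "abs_torus x = abs_torus t"
    by (simp add: abs_torus_eq_iff)
  then show "x \<in> lattice_translates T"
    using \<open>t \<in> T\<close> by (simp add: lattice_translates_def)
qed

lemma closed_lattice_translates:
  assumes "compact T"
  shows "closed (lattice_translates T)"
proof -
  have "{z :: real^2. \<forall>i. z $ i \<in> \<int>} = (\<Inter>i. (\<lambda>z. z $ i) -` \<int>)"
    by auto
  also have "closed \<dots>"
    by (intro closed_INT ballI closed_vimage closed_Ints continuous_intros)
  finally have "closed {z :: real^2. \<forall>i. z $ i \<in> \<int>}" .
  from compact_closed_sums[OF assms this] show ?thesis
    unfolding lattice_translates_eq by (rule back_subst[of closed]) blast
qed

lemma infdist_lattice_translates:
  assumes "abs_torus x = abs_torus y"
  shows "infdist x (lattice_translates T) = infdist y (lattice_translates T)"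
proof -
  have *: "infdist x S = infdist (x + z) ((+) z ` S)" for x z :: "real^2" and S
    by (auto simp: infdist_def image_image add.commute[of z])
  define z where "z = y - x"
  have z: "\<forall>i. z $ i \<in> \<int>"
    using assms[symmetric] by (simp add: z_def abs_torus_eq_iff)
  have "abs_torus (z + w) = abs_torus w" "abs_torus (w - z) = abs_torus w" for w
    using z by (simp_all add: abs_torus_eq_iff)
  then have "(+) z ` lattice_translates T = lattice_translates T"
    by (force simp: lattice_translates_def image_iff intro: exI[of _ "_ - z"])
  then show ?thesis
    using *[of x "lattice_translates T" z] by (simp add: z_def)
qed

text \<open>
  The functions are \<open>max 0 (1 - n d)\<close>, where \<open>d\<close> is the distance in the plane to the closed periodic set of all
  lattice translates of \<open>T\<close>. They are Lipschitz and depend only on the point of the torus. The set must be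
  nonempty for this, since the distance to the empty set is 0 by convention.
\<close>
lemma bump_functions:
  assumes "compact T"
  obtains G :: "nat \<Rightarrow> torus \<Rightarrow> complex" where
    "\<And>n. G n \<in> hoelder_torus" "\<And>n p. cmod (G n p) \<le> 1"
    "\<And>p. (\<lambda>n. G n p) \<longlonglongrightarrow> indicator (abs_torus ` T) p"
proof (cases "T = {}")
  case True
  have "(\<lambda>p. 0) \<in> hoelder_torus"
    unfolding hoelder_torus_def by (auto intro!: exI[of _ 1])
  then show thesis
    using that[of "\<lambda>n p. 0"] True by simp
next
  case False
  let ?S = "lattice_translates T"
  have S: "?S \<noteq> {}" "closed ?S"
    using False closed_lattice_translates[OF assms] by (auto simp: lattice_translates_def)
  define g where "g n x = max 0 (1 - real (Suc n) * infdist x ?S)" for n x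
  define G where "G n p = complex_of_real (g n (rep_torus p))" for n p
  have G: "G n (abs_torus x) = complex_of_real (g n x)" for n x
    unfolding G_def g_def
    using infdist_lattice_translates[of "rep_torus (abs_torus x)" x T]
    by (simp add: Quotient_abs_rep[OF Quotient_torus])
  have "G n \<in> hoelder_torus" for n
  proof -
    have "cmod (G n p - G n q) \<le> real (Suc n) * torus_dist p q powr 1" for p q
    proof -
      have le: "cmod (G n (abs_torus x) - G n (abs_torus y)) \<le> real (Suc n) * dist x y" for x y
      proof -
        have "\<bar>g n x - g n y\<bar> \<le> \<bar>real (Suc n) * infdist x ?S - real (Suc n) * infdist y ?S\<bar>"
          unfolding g_def by linarith
        also have "\<dots> = real (Suc n) * \<bar>infdist x ?S - infdist y ?S\<bar>"
          by (simp only: right_diff_distrib[symmetric] abs_mult abs_of_nat)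
        also have "\<dots> \<le> real (Suc n) * dist x y"
          by (intro mult_left_mono infdist_triangle_abs) simp
        finally show ?thesis
          unfolding G of_real_diff[symmetric] norm_of_real .
      qed
      have "cmod (G n p - G n q) / real (Suc n) \<le> torus_dist p q"
        unfolding torus_dist_def
      proof (rule cInf_greatest)
        show "{dist x y |x y. abs_torus x = p \<and> abs_torus y = q} \<noteq> {}"
          by (metis (mono_tags, lifting) abs_torus_cases empty_iff mem_Collect_eq)
        show "cmod (G n p - G n q) / real (Suc n) \<le> d"
          if "d \<in> {dist x y |x y. abs_torus x = p \<and> abs_torus y = q}" for d
          using that le by (auto simp: divide_le_eq mult.commute)
      qed
      then show ?thesis
        using torus_dist_nonneg[of p q] by (simp add: divide_le_eq mult.commute)
    qed
    then show ?thesis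
      unfolding hoelder_torus_def
      by (intro CollectI exI[of _ 1] conjI exI[of _ "real (Suc n)"]) auto
  qed
  moreover have "cmod (G n p) \<le> 1" for n p
    using infdist_nonneg[of "rep_torus p" ?S] unfolding G_def norm_of_real g_def
    by (auto simp: abs_if not_less intro!: mult_nonneg_nonneg)
  moreover have "(\<lambda>n. G n p) \<longlonglongrightarrow> indicator (abs_torus ` T) p" for p
  proof -
    obtain x where p: "p = abs_torus x" by (rule abs_torus_cases)
    show ?thesis
    proof (cases "x \<in> ?S")
      case True
      then have "G n p = 1" for n
        by (simp add: p G g_def)
      then show ?thesis
        using True by (simp add: p lattice_translates_def)
    next
      case False
      then have pos: "infdist x ?S > 0"
        using S by (metis in_closed_iff_infdist_zero infdist_nonneg order_le_less)
      have "eventually (\<lambda>n. G n p = 0) sequentially"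
      proof -
        obtain m :: nat where m: "1 / infdist x ?S < real m"
          using reals_Archimedean2 by blast
        have "1 \<le> real (Suc n) * infdist x ?S" if "n \<ge> m" for n
        proof -
          have "1 / infdist x ?S \<le> real (Suc n)"
            using m that by linarith
          then show ?thesis
            using pos by (simp only: divide_le_eq if_True)
        qed
        then show ?thesis
          by (intro eventually_sequentiallyI[of m]) (simp add: p G g_def)
      qed
      then have "(\<lambda>n. G n p) \<longlonglongrightarrow> 0"
        by (rule tendsto_eventually)
      then show ?thesis
        using False by (simp add: p lattice_translates_def)
    qed
  qed
  ultimately show thesis
    using that by blast
qed

lemma torus_inner_regular:
  assumes E: "E \<in> sets torus_measure" and e: "e > 0"
  obtains T where "compact T" "abs_torus ` T \<subseteq> E" "abs_torus ` T \<in> sets torus_measure"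
    "measure torus_measure (E - abs_torus ` T) < e"
proof -
  let ?Q = "{x :: real^2. \<forall>i. 0 \<le> x$i \<and> x$i < 1}"
  let ?B = "abs_torus -` E \<inter> ?Q"
  have Q: "?Q \<in> sets borel"
    by measurable
  have B: "?B \<in> sets borel"
    using E Q by (auto simp: sets_torus_measure)
  then have "?B \<in> sets lebesgue"
    by simp
  then obtain T where T: "closed T" "T \<subseteq> ?B" "?B - T \<in> lmeasurable" "emeasure lebesgue (?B - T) < ennreal e"
    by (rule sets_lebesgue_inner_closed[OF _ e])
  have "?Q \<subseteq> cbox 0 1"
    by (auto simp: mem_box_cart less_imp_le)
  then have "T \<subseteq> cbox 0 1"
    using T(2) by (simp add: subset_eq)
  then have "bounded T"
    by (rule bounded_subset[OF bounded_cbox])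
  with T(1) have "compact T"
    by (simp add: compact_eq_bounded_closed)
  moreover have "abs_torus ` T \<subseteq> E"
    using T(2) by auto
  moreover have ET: "abs_torus ` T \<in> sets torus_measure"
    using closed_lattice_translates[OF \<open>compact T\<close>]
    by (auto simp: sets_torus_measure lattice_translates_def vimage_def)
  moreover have "measure torus_measure (E - abs_torus ` T) < e"
  proof -
    have "emeasure torus_measure (E - abs_torus ` T) = emeasure lborel (abs_torus -` (E - abs_torus ` T) \<inter> ?Q)"
      using E ET by (intro emeasure_torus_measure) auto
    also have "\<dots> \<le> emeasure lborel (?B - T)"
      using B T(1) by (intro emeasure_mono) auto
    also have "\<dots> = emeasure lebesgue (?B - T)"
      using B T(1) by (simp add: emeasure_completion main_part_sets)
    also have "\<dots> < ennreal e" by fact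
    finally show ?thesis
      using e by (simp add: torus.emeasure_eq_measure ennreal_less_iff)
  qed
  ultimately show thesis
    using that by blast
qed

lemma dual_action_eq_0_iff:
  assumes "det A = 1"
  shows "dual_action A p = 0 \<longleftrightarrow> p = 0"
proof
  obtain a b c d where A: "A = mat2 a b c d" by (cases A)
  assume "dual_action A p = 0"
  then have 0: "a * fst p + c * snd p = 0" "b * fst p + d * snd p = 0"
    by (simp_all add: A dual_action_def zero_prod_def)
  have "(a * d - b * c) * fst p = d * (a * fst p + c * snd p) - c * (b * fst p + d * snd p)"
    "(a * d - b * c) * snd p = a * (b * fst p + d * snd p) - b * (a * fst p + c * snd p)"
    by (simp_all add: algebra_simps)
  then show "p = 0"
    using assms unfolding 0 A by (simp add: prod_eq_iff)
qed (simp add: dual_action_def zero_prod_def)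

text \<open>
  For trigonometric polynomials the claim is that an invertible matrix maps no nonzero frequency to 0;
  Hoelder functions are uniform limits of these.
\<close>
lemma integral_hoelder_torus_action:
  assumes A: "det A = 1" and F: "F \<in> hoelder_torus"
  shows "(\<integral>x. F (torus_action A x) \<partial>torus_measure) = (\<integral>x. F x \<partial>torus_measure)"
proof -
  obtain C \<beta> where C: "C > 0" "\<beta> > 0"
    "\<And>N. N > 0 \<Longrightarrow> \<exists>P. trigonometric_polynomial N P \<and> (\<forall>x. cmod (F x - P x) \<le> C * real N powr (- \<beta>))"
    using hoelder_approximation[OF F] by metis
  let ?D = "(\<integral>x. F (torus_action A x) \<partial>torus_measure) - (\<integral>x. F x \<partial>torus_measure)"
  have bound: "cmod ?D \<le> 2 * C * real N powr (- \<beta>)" if N: "N > 0" for N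
  proof -
    obtain P where P: "trigonometric_polynomial N P" "\<And>x. cmod (F x - P x) \<le> C * real N powr (- \<beta>)"
      using C(3)[OF N] by blast
    have bm: "bounded_measurable F" "bounded_measurable P"
      using F P hoelder_bounded_measurable trigonometric_bounded_measurable by blast+
    note bmA = this[THEN bounded_measurable_torus_action, of A]
    note int = bm[THEN bounded_measurable_integrable] bmA[THEN bounded_measurable_integrable]
    have PA: "(\<integral>x. P (torus_action A x) \<partial>torus_measure) = (\<integral>x. P x \<partial>torus_measure)"
    proof -
      obtain a where "P = (\<lambda>x. \<Sum>z\<in>frequency_box N \<times> frequency_box N. a z * character (fst z - snd z) x)"
        using P(1) by (auto simp: trigonometric_polynomial_def)
      then show ?thesis
        by (simp only: character_torus_action integral_character_sum dual_action_eq_0_iff[OF A])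
    qed
    have "?D = (\<integral>x. F (torus_action A x) - P (torus_action A x) \<partial>torus_measure) - (\<integral>x. F x - P x \<partial>torus_measure)"
      using int PA by simp
    also have "cmod \<dots> \<le> C * real N powr (- \<beta>) + C * real N powr (- \<beta>)"
      by (rule order.trans[OF norm_triangle_ineq4], intro add_mono norm_integral_torus_le)
        (use bm bmA P(2) in \<open>auto simp: bounded_measurable_def\<close>)
    finally show ?thesis by simp
  qed
  have "(\<lambda>N. 2 * C * real N powr (- \<beta>)) \<longlonglongrightarrow> 2 * C * 0"
    using C(2) by (intro tendsto_mult_left tendsto_neg_powr filterlim_real_sequentially) auto
  then have "cmod ?D \<le> 2 * C * 0"
    by (rule LIMSEQ_le_const) (use bound in \<open>auto intro!: exI[of _ 1]\<close>)
  then show ?thesis by simp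
qed

lemma integral_torus_indicator:
  assumes "E \<in> sets torus_measure"
  shows "(\<integral>x. indicator E x \<partial>torus_measure) = complex_of_real (measure torus_measure E)"
proof -
  have "(\<integral>x. indicator E x \<partial>torus_measure) = (\<integral>x. complex_of_real (indicator E x) \<partial>torus_measure)"
    by (simp add: of_real_indicator)
  also have "\<dots> = complex_of_real (\<integral>x. indicator E x \<partial>torus_measure)"
    by (rule integral_complex_of_real)
  finally show ?thesis
    using assms by simp
qed

text \<open>
  On the image of a compact set, the measure is the limit of integrals of Hoelder functions, for which
  invariance is known. Inner regularity then gives one inequality for all measurable sets, and complements
  give the other.
\<close>
lemma measure_vimage_torus_action:
  assumes A: "det A = 1" and E: "E \<in> sets torus_measure"
  shows "measure torus_measure (torus_action A -` E) = measure torus_measure E"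
proof -
  have sets: "torus_action A -` E \<in> sets torus_measure" if "E \<in> sets torus_measure" for E
    using measurable_sets[OF measurable_torus_action that, of A] by simp
  have le: "measure torus_measure E \<le> measure torus_measure (torus_action A -` E)"
    if E: "E \<in> sets torus_measure" for E
  proof (rule field_le_epsilon)
    fix e :: real assume "e > 0"
    then obtain T where T: "compact T" "abs_torus ` T \<subseteq> E" "abs_torus ` T \<in> sets torus_measure"
      "measure torus_measure (E - abs_torus ` T) < e"
      using torus_inner_regular[OF E] by metis
    let ?K = "abs_torus ` T"
    obtain G :: "nat \<Rightarrow> torus \<Rightarrow> complex" where G: "\<And>n. G n \<in> hoelder_torus" "\<And>n p. cmod (G n p) \<le> 1"
      "\<And>p. (\<lambda>n. G n p) \<longlonglongrightarrow> indicator ?K p"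
      using bump_functions[OF T(1)] by metis
    have meas [measurable]: "G n \<in> borel_measurable torus_measure" for n
      using G(1) by (rule hoelder_measurable)
    have K [measurable]: "?K \<in> sets torus_measure" by fact
    have "(\<lambda>n. \<integral>x. G n x \<partial>torus_measure) \<longlonglongrightarrow> (\<integral>x. indicator ?K x \<partial>torus_measure)"
      using G(2,3) by (intro integral_dominated_convergence[where w = "\<lambda>_. 1"]) auto
    moreover have "(\<lambda>n. \<integral>x. G n (torus_action A x) \<partial>torus_measure) \<longlonglongrightarrow> (\<integral>x. indicator ?K (torus_action A x) \<partial>torus_measure)"
      using G(2,3) by (intro integral_dominated_convergence[where w = "\<lambda>_. 1"]) auto
    ultimately have "(\<integral>x. indicator ?K (torus_action A x) \<partial>torus_measure) = (\<integral>x. indicator ?K x \<partial>torus_measure :: complex)"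
      using LIMSEQ_unique by (simp only: integral_hoelder_torus_action[OF A G(1)]) blast
    also have "(\<lambda>x. indicator ?K (torus_action A x)) = (indicator (torus_action A -` ?K) :: torus \<Rightarrow> complex)"
      by (auto simp: indicator_def)
    finally have eq: "measure torus_measure (torus_action A -` ?K) = measure torus_measure ?K"
      using sets[OF K] K by (simp add: integral_torus_indicator)
    have "measure torus_measure E = measure torus_measure ?K + measure torus_measure (E - ?K)"
      using torus.finite_measure_Diff[OF E K T(2)] by simp
    also have "\<dots> \<le> measure torus_measure ?K + e"
      using T(4) by simp
    also have "measure torus_measure ?K \<le> measure torus_measure (torus_action A -` E)"
      unfolding eq[symmetric] using T(2) sets[OF E] by (intro torus.finite_measure_mono) auto
    finally show "measure torus_measure E \<le> measure torus_measure (torus_action A -` E) + e"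
      by simp
  qed
  have "measure torus_measure (UNIV - E) \<le> measure torus_measure (torus_action A -` (UNIV - E))"
    using E sets.compl_sets[OF E] by (intro le) simp
  also have "torus_action A -` (UNIV - E) = UNIV - torus_action A -` E"
    by auto
  finally have "measure torus_measure (torus_action A -` E) \<le> measure torus_measure E"
    using torus.finite_measure_compl[OF E] torus.finite_measure_compl[OF sets[OF E]] by simp
  with le[OF E] show ?thesis by simp
qed

lemma distr_torus_action:
  assumes "det A = 1"
  shows "distr torus_measure torus_measure (torus_action A) = torus_measure"
proof (rule measure_eqI)
  fix E assume E: "E \<in> sets (distr torus_measure torus_measure (torus_action A))"
  then show "emeasure (distr torus_measure torus_measure (torus_action A)) E = emeasure torus_measure E"
    using measure_vimage_torus_action[OF assms, of E]
    by (simp add: emeasure_distr torus.emeasure_eq_measure)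
qed simp

section \<open>Density of Hoelder functions and mixing\<close>

definition l2_norm_sq :: "(torus \<Rightarrow> complex) \<Rightarrow> real" where
  "l2_norm_sq F = (\<integral>x. (cmod (F x))\<^sup>2 \<partial>torus_measure)"

lemma l2_norm_sq_nonneg: "l2_norm_sq F \<ge> 0"
  by (simp add: l2_norm_sq_def)

lemma bounded_measurable_L2: 
  assumes "bounded_measurable F"
  shows "F \<in> L2_torus"
proof -
  obtain M where M: "\<And>x. cmod (F x) \<le> M" and [measurable]: "F \<in> borel_measurable torus_measure"
    using assms by (auto simp: bounded_measurable_def)
  have "integrable torus_measure (\<lambda>x. (cmod (F x))\<^sup>2)"
    by (rule integrable_torus_bounded[where M = "M\<^sup>2"]) (auto intro!: power_mono M)
  then show ?thesis by (simp add: L2_torus_def)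
qed

lemma L2_mult_integrable:
  assumes "F \<in> L2_torus" "G \<in> L2_torus"
  shows "integrable torus_measure (\<lambda>x. F x * G x)"
proof (rule Bochner_Integration.integrable_bound)
  show "integrable torus_measure (\<lambda>x. (cmod (F x))\<^sup>2 + (cmod (G x))\<^sup>2)"
    using assms by (auto simp: L2_torus_def)
  show "(\<lambda>x. F x * G x) \<in> borel_measurable torus_measure"
    using assms by (auto simp: L2_torus_def)
  have "a * b \<le> a\<^sup>2 + b\<^sup>2" if "a \<ge> 0" "b \<ge> 0" for a b :: real
    using sum_squares_bound[of a b] mult_nonneg_nonneg[OF that] by linarith
  then show "AE x in torus_measure. norm (F x * G x) \<le> norm ((cmod (F x))\<^sup>2 + (cmod (G x))\<^sup>2)"
    by (simp add: norm_mult)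
qed

lemma L2_integrable: "F \<in> L2_torus \<Longrightarrow> integrable torus_measure F"
  using L2_mult_integrable[of F "\<lambda>_. 1"] bounded_measurable_L2[of "\<lambda>_. 1"]
  by (auto simp: bounded_measurable_def)

lemma L2_add:
  assumes "F \<in> L2_torus" "G \<in> L2_torus"
  shows "(\<lambda>x. F x + G x) \<in> L2_torus"
    and "l2_norm_sq (\<lambda>x. F x + G x) \<le> 2 * l2_norm_sq F + 2 * l2_norm_sq G"
proof -
  have [measurable]: "F \<in> borel_measurable torus_measure" "G \<in> borel_measurable torus_measure"
    and int: "integrable torus_measure (\<lambda>x. (cmod (F x))\<^sup>2)" "integrable torus_measure (\<lambda>x. (cmod (G x))\<^sup>2)"
    using assms by (auto simp: L2_torus_def)
  have le: "(cmod (F x + G x))\<^sup>2 \<le> 2 * (cmod (F x))\<^sup>2 + 2 * (cmod (G x))\<^sup>2" for x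
  proof -
    have "(cmod (F x + G x))\<^sup>2 \<le> (cmod (F x) + cmod (G x))\<^sup>2"
      by (intro power_mono norm_triangle_ineq) simp
    also have "\<dots> \<le> 2 * (cmod (F x))\<^sup>2 + 2 * (cmod (G x))\<^sup>2"
      using sum_squares_bound[of "cmod (F x)" "cmod (G x)"] by (simp add: power2_sum)
    finally show ?thesis .
  qed
  have int2: "integrable torus_measure (\<lambda>x. 2 * (cmod (F x))\<^sup>2 + 2 * (cmod (G x))\<^sup>2)"
    using int by simp
  have int3: "integrable torus_measure (\<lambda>x. (cmod (F x + G x))\<^sup>2)"
    using le by (intro Bochner_Integration.integrable_bound[OF int2]) (auto intro!: AE_I2)
  then show "(\<lambda>x. F x + G x) \<in> L2_torus"
    by (simp add: L2_torus_def)
  have "l2_norm_sq (\<lambda>x. F x + G x) \<le> (\<integral>x. 2 * (cmod (F x))\<^sup>2 + 2 * (cmod (G x))\<^sup>2 \<partial>torus_measure)"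
    unfolding l2_norm_sq_def by (intro integral_mono int2 int3 le)
  then show "l2_norm_sq (\<lambda>x. F x + G x) \<le> 2 * l2_norm_sq F + 2 * l2_norm_sq G"
    using int by (simp add: l2_norm_sq_def)
qed

lemma L2_scale:
  assumes "F \<in> L2_torus"
  shows "(\<lambda>x. c * F x) \<in> L2_torus" and "l2_norm_sq (\<lambda>x. c * F x) = (cmod c)\<^sup>2 * l2_norm_sq F"
  using assms by (auto simp: L2_torus_def l2_norm_sq_def norm_mult power_mult_distrib)

lemma L2_diff: "F \<in> L2_torus \<Longrightarrow> G \<in> L2_torus \<Longrightarrow> (\<lambda>x. F x - G x) \<in> L2_torus"
  using L2_add(1)[OF _ L2_scale(1)[of G "-1"], of F] by simp

lemma L2_torus_action:
  assumes "det A = 1" "F \<in> L2_torus"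
  shows "(\<lambda>x. F (torus_action A x)) \<in> L2_torus"
    and "l2_norm_sq (\<lambda>x. F (torus_action A x)) = l2_norm_sq F"
proof -
  have [measurable]: "F \<in> borel_measurable torus_measure"
    and int: "integrable torus_measure (\<lambda>x. (cmod (F x))\<^sup>2)"
    using assms by (auto simp: L2_torus_def)
  have "integrable (distr torus_measure torus_measure (torus_action A)) (\<lambda>x. (cmod (F x))\<^sup>2)"
    unfolding distr_torus_action[OF assms(1)] by (rule int)
  then have "integrable torus_measure (\<lambda>x. (cmod (F (torus_action A x)))\<^sup>2)"
    by (subst (asm) integrable_distr_eq) auto
  then show "(\<lambda>x. F (torus_action A x)) \<in> L2_torus"
    by (simp add: L2_torus_def)
  have "l2_norm_sq F = (\<integral>x. (cmod (F x))\<^sup>2 \<partial>distr torus_measure torus_measure (torus_action A))"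
    unfolding distr_torus_action[OF assms(1)] l2_norm_sq_def ..
  then show "l2_norm_sq (\<lambda>x. F (torus_action A x)) = l2_norm_sq F"
    unfolding l2_norm_sq_def by (subst (asm) integral_distr) auto
qed

text \<open>
  A form of the Cauchy-Schwarz inequality. The free parameter \<open>t\<close> makes up for the missing square roots: it is
  chosen such that one of the two terms is small.
\<close>
lemma norm_integral_mult_le:
  assumes "F \<in> L2_torus" "G \<in> L2_torus" "t > 0"
  shows "2 * cmod (\<integral>x. F x * G x \<partial>torus_measure) \<le> l2_norm_sq F / t + t * l2_norm_sq G"
proof -
  have int: "integrable torus_measure (\<lambda>x. (cmod (F x))\<^sup>2)" "integrable torus_measure (\<lambda>x. (cmod (G x))\<^sup>2)"
    using assms by (auto simp: L2_torus_def)
  have le: "2 * cmod (F x * G x) \<le> (cmod (F x))\<^sup>2 / t + t * (cmod (G x))\<^sup>2" for x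
  proof -
    have "0 \<le> (cmod (F x) - t * cmod (G x))\<^sup>2 / t"
      using assms(3) by simp
    also have "\<dots> = (cmod (F x))\<^sup>2 / t + t * (cmod (G x))\<^sup>2 - 2 * cmod (F x * G x)"
      using assms(3) by (simp add: power2_diff norm_mult field_simps power2_eq_square)
    finally show ?thesis by simp
  qed
  have "2 * cmod (\<integral>x. F x * G x \<partial>torus_measure) \<le> 2 * (\<integral>x. cmod (F x * G x) \<partial>torus_measure)"
    by (intro mult_left_mono integral_norm_bound) simp
  also have "\<dots> = (\<integral>x. 2 * cmod (F x * G x) \<partial>torus_measure)"
    by simp
  also have "\<dots> \<le> (\<integral>x. (cmod (F x))\<^sup>2 / t + t * (cmod (G x))\<^sup>2 \<partial>torus_measure)"
    using int L2_mult_integrable[OF assms(1,2)]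
    by (intro integral_mono le Bochner_Integration.integrable_add integrable_mult_right integrable_norm integrable_divide) auto
  also have "\<dots> = l2_norm_sq F / t + t * l2_norm_sq G"
    using int by (simp add: l2_norm_sq_def)
  finally show ?thesis .
qed

lemma norm_integral_sq_le:
  assumes "F \<in> L2_torus"
  shows "(cmod (\<integral>x. F x \<partial>torus_measure))\<^sup>2 \<le> l2_norm_sq F"
proof (cases "cmod (\<integral>x. F x \<partial>torus_measure) = 0")
  case True
  then show ?thesis by (simp add: l2_norm_sq_nonneg)
next
  case False
  let ?m = "cmod (\<integral>x. F x \<partial>torus_measure)"
  have "(\<lambda>_. 1) \<in> L2_torus"
    by (rule bounded_measurable_L2) (auto simp: bounded_measurable_def)
  from norm_integral_mult_le[OF assms this, of ?m] False
  have "2 * ?m \<le> l2_norm_sq F / ?m + ?m"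
    by (simp add: l2_norm_sq_def measure_torus_UNIV)
  then have "?m \<le> l2_norm_sq F / ?m"
    by simp
  then show ?thesis
    using False by (simp add: le_divide_eq power2_eq_square)
qed

lemma correlation_L2_bound:
  assumes "det A = 1" "F \<in> L2_torus" "G \<in> L2_torus" "t > 0"
  shows "cmod (correlation F G A) \<le> l2_norm_sq F / t + t * l2_norm_sq G"
proof -
  let ?a = "cmod (\<integral>x. F x \<partial>torus_measure)" and ?b = "cmod (\<integral>x. G x \<partial>torus_measure)"
  have "2 * cmod (\<integral>x. F (torus_action A x) * G x \<partial>torus_measure) \<le> l2_norm_sq F / t + t * l2_norm_sq G"
    using norm_integral_mult_le[OF L2_torus_action(1)[OF assms(1,2)] assms(3,4)]
    by (simp add: L2_torus_action(2)[OF assms(1,2)])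
  moreover have "2 * (?a * ?b) \<le> l2_norm_sq F / t + t * l2_norm_sq G"
  proof -
    have "0 \<le> (?a - t * ?b)\<^sup>2 / t"
      using assms(4) by simp
    also have "\<dots> = ?a\<^sup>2 / t + t * ?b\<^sup>2 - 2 * (?a * ?b)"
      using assms(4) by (simp add: power2_diff field_simps power2_eq_square)
    finally have "2 * (?a * ?b) \<le> ?a\<^sup>2 / t + t * ?b\<^sup>2"
      by simp
    also have "\<dots> \<le> l2_norm_sq F / t + t * l2_norm_sq G"
      using assms by (intro add_mono divide_right_mono mult_left_mono norm_integral_sq_le) auto
    finally show ?thesis .
  qed
  ultimately show ?thesis
    unfolding correlation_def
    using norm_triangle_ineq4[of "\<integral>x. F (torus_action A x) * G x \<partial>torus_measure"
        "(\<integral>x. F x \<partial>torus_measure) * (\<integral>x. G x \<partial>torus_measure)"]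
    unfolding norm_mult by linarith
qed

lemma hoelder_L2: "F \<in> hoelder_torus \<Longrightarrow> F \<in> L2_torus"
  by (intro bounded_measurable_L2 hoelder_bounded_measurable)

text \<open>
  The exponents may differ, but distances are at most 1, so the smaller exponent serves for both summands.
\<close>
lemma hoelder_add:
  assumes "F \<in> hoelder_torus" "G \<in> hoelder_torus"
  shows "(\<lambda>x. F x + G x) \<in> hoelder_torus"
proof -
  obtain \<alpha> a where F: "\<alpha> > 0" "a > 0" "\<And>x y. cmod (F x - F y) \<le> a * torus_dist x y powr \<alpha>"
    using assms(1) unfolding hoelder_torus_def by auto
  obtain \<beta> b where G: "\<beta> > 0" "b > 0" "\<And>x y. cmod (G x - G y) \<le> b * torus_dist x y powr \<beta>"
    using assms(2) unfolding hoelder_torus_def by auto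
  have "cmod ((F x + G x) - (F y + G y)) \<le> (a + b) * torus_dist x y powr (min \<alpha> \<beta>)" for x y
  proof -
    have mono: "torus_dist x y powr s \<le> torus_dist x y powr (min \<alpha> \<beta>)" if "min \<alpha> \<beta> \<le> s" for s
      using that torus_dist_bounds(1) torus_dist_nonneg by (intro powr_mono') auto
    have "cmod ((F x + G x) - (F y + G y)) \<le> cmod (F x - F y) + cmod (G x - G y)"
      using norm_triangle_ineq[of "F x - F y" "G x - G y"] by (simp add: algebra_simps)
    also have "\<dots> \<le> a * torus_dist x y powr \<alpha> + b * torus_dist x y powr \<beta>"
      by (intro add_mono F G)
    also have "\<dots> \<le> a * torus_dist x y powr (min \<alpha> \<beta>) + b * torus_dist x y powr (min \<alpha> \<beta>)"
      using F(2) G(2) by (intro add_mono mult_left_mono mono) auto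
    finally show ?thesis by (simp add: algebra_simps)
  qed
  moreover have "min \<alpha> \<beta> > 0" "a + b > 0"
    using F G by auto
  ultimately show ?thesis
    unfolding hoelder_torus_def by blast
qed

lemma hoelder_scale:
  assumes "F \<in> hoelder_torus"
  shows "(\<lambda>x. c * F x) \<in> hoelder_torus"
proof -
  obtain \<alpha> a where F: "\<alpha> > 0" "a > 0" "\<And>x y. cmod (F x - F y) \<le> a * torus_dist x y powr \<alpha>"
    using assms(1) unfolding hoelder_torus_def by auto
  have "cmod (c * F x - c * F y) \<le> (cmod c + 1) * a * torus_dist x y powr \<alpha>" for x y
  proof -
    have "cmod (c * F x - c * F y) = cmod c * cmod (F x - F y)"
      by (simp only: right_diff_distrib[symmetric] norm_mult)
    also have "\<dots> \<le> (cmod c + 1) * (a * torus_dist x y powr \<alpha>)"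
      by (intro mult_mono F) auto
    finally show ?thesis by (simp add: mult.assoc)
  qed
  moreover have "(cmod c + 1) * a > 0"
    using F(2) by (simp add: add_nonneg_pos)
  ultimately show ?thesis
    unfolding hoelder_torus_def using F(1) by blast
qed

definition hoelder_approximable :: "(torus \<Rightarrow> complex) \<Rightarrow> bool" where
  "hoelder_approximable F \<longleftrightarrow> F \<in> L2_torus \<and>
     (\<forall>e>0. \<exists>G\<in>hoelder_torus. l2_norm_sq (\<lambda>x. F x - G x) < e)"

lemma hoelder_approximable_add:
  assumes "hoelder_approximable F" "hoelder_approximable G"
  shows "hoelder_approximable (\<lambda>x. F x + G x)"
  unfolding hoelder_approximable_def
proof (intro conjI allI impI)
  have FG: "F \<in> L2_torus" "G \<in> L2_torus"
    using assms by (auto simp: hoelder_approximable_def)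
  then show "(\<lambda>x. F x + G x) \<in> L2_torus"
    by (rule L2_add)
  fix e :: real assume "e > 0"
  then have "e / 4 > 0" by simp
  then obtain P Q where P: "P \<in> hoelder_torus" "l2_norm_sq (\<lambda>x. F x - P x) < e / 4"
    and Q: "Q \<in> hoelder_torus" "l2_norm_sq (\<lambda>x. G x - Q x) < e / 4"
    using assms unfolding hoelder_approximable_def by blast
  have "l2_norm_sq (\<lambda>x. (F x - P x) + (G x - Q x)) < e"
    using L2_add(2)[OF L2_diff[OF FG(1) hoelder_L2[OF P(1)]] L2_diff[OF FG(2) hoelder_L2[OF Q(1)]]] P(2) Q(2)
    by linarith
  then have "l2_norm_sq (\<lambda>x. F x + G x - (P x + Q x)) < e"
    by (simp add: algebra_simps)
  then show "\<exists>H\<in>hoelder_torus. l2_norm_sq (\<lambda>x. F x + G x - H x) < e"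
    by (rule bexI[OF _ hoelder_add[OF P(1) Q(1)]])
qed

lemma hoelder_approximable_scale:
  assumes "hoelder_approximable F"
  shows "hoelder_approximable (\<lambda>x. c * F x)"
  unfolding hoelder_approximable_def
proof (intro conjI allI impI)
  have F: "F \<in> L2_torus"
    using assms by (auto simp: hoelder_approximable_def)
  then show "(\<lambda>x. c * F x) \<in> L2_torus"
    by (rule L2_scale)
  fix e :: real assume "e > 0"
  then have "e / ((cmod c)\<^sup>2 + 1) > 0"
    by (simp add: add_nonneg_pos)
  then obtain P where P: "P \<in> hoelder_torus" "l2_norm_sq (\<lambda>x. F x - P x) < e / ((cmod c)\<^sup>2 + 1)"
    using assms unfolding hoelder_approximable_def by blast
  have "l2_norm_sq (\<lambda>x. c * F x - c * P x) = (cmod c)\<^sup>2 * l2_norm_sq (\<lambda>x. F x - P x)"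
    using L2_scale(2)[OF L2_diff[OF F hoelder_L2[OF P(1)]], of c] by (simp add: right_diff_distrib)
  also have "\<dots> \<le> ((cmod c)\<^sup>2 + 1) * l2_norm_sq (\<lambda>x. F x - P x)"
    by (intro mult_right_mono l2_norm_sq_nonneg) simp
  also have "\<dots> < e"
    using P(2) by (simp add: less_divide_eq add_nonneg_pos mult.commute)
  finally show "\<exists>H\<in>hoelder_torus. l2_norm_sq (\<lambda>x. c * F x - H x) < e"
    by (rule bexI[OF _ hoelder_scale[OF P(1)]])
qed

lemma hoelder_approximable_limit:
  assumes F: "F \<in> L2_torus" and approx: "\<And>e. e > 0 \<Longrightarrow> \<exists>G. hoelder_approximable G \<and> l2_norm_sq (\<lambda>x. F x - G x) < e"
  shows "hoelder_approximable F"
  unfolding hoelder_approximable_def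
proof (intro conjI allI impI F)
  fix e :: real assume "e > 0"
  then have e4: "e / 4 > 0" by simp
  obtain G where G: "hoelder_approximable G" "l2_norm_sq (\<lambda>x. F x - G x) < e / 4"
    using approx[OF e4] by blast
  then obtain P where P: "P \<in> hoelder_torus" "l2_norm_sq (\<lambda>x. G x - P x) < e / 4"
    using e4 unfolding hoelder_approximable_def by blast
  have "G \<in> L2_torus"
    using G by (simp add: hoelder_approximable_def)
  then have "l2_norm_sq (\<lambda>x. (F x - G x) + (G x - P x)) < e"
    using L2_add(2)[OF L2_diff[OF F] L2_diff[OF _ hoelder_L2[OF P(1)]], of G G] G(2) P(2) by linarith
  then show "\<exists>H\<in>hoelder_torus. l2_norm_sq (\<lambda>x. F x - H x) < e"
    using P(1) by (auto simp: algebra_simps)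
qed

lemma hoelder_approximable_indicator:
  assumes E: "E \<in> sets torus_measure"
  shows "hoelder_approximable (indicator E)"
proof -
  have L2_indicator: "indicator E \<in> L2_torus" if "E \<in> sets torus_measure" for E
    using that by (intro bounded_measurable_L2) (auto simp: bounded_measurable_def indicator_def intro!: exI[of _ 1])
  have compact: "hoelder_approximable (indicator (abs_torus ` T))"
    if T: "compact T" "abs_torus ` T \<in> sets torus_measure" for T
    unfolding hoelder_approximable_def
  proof (intro conjI allI impI L2_indicator T(2))
    fix e :: real assume e: "e > 0"
    let ?K = "abs_torus ` T"
    obtain G :: "nat \<Rightarrow> torus \<Rightarrow> complex" where G: "\<And>n. G n \<in> hoelder_torus" "\<And>n p. cmod (G n p) \<le> 1"
      "\<And>p. (\<lambda>n. G n p) \<longlonglongrightarrow> indicator ?K p"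
      using bump_functions[OF T(1)] by metis
    have [measurable]: "G n \<in> borel_measurable torus_measure" for n
      using G(1) by (rule hoelder_measurable)
    have [measurable]: "?K \<in> sets torus_measure" by fact
    have "(\<lambda>n. l2_norm_sq (\<lambda>x. indicator ?K x - G n x)) \<longlonglongrightarrow> (\<integral>x. 0 \<partial>torus_measure)"
      unfolding l2_norm_sq_def
    proof (rule integral_dominated_convergence[where w = "\<lambda>_. 4"])
      have "(\<lambda>n. (cmod (indicator ?K x - G n x))\<^sup>2) \<longlonglongrightarrow> (cmod (indicator ?K x - indicator ?K x))\<^sup>2" for x
        by (intro tendsto_intros G(3))
      then show "AE x in torus_measure. (\<lambda>n. (cmod (indicator ?K x - G n x))\<^sup>2) \<longlonglongrightarrow> 0"
        by simp
      have "(cmod (indicator ?K x - G n x))\<^sup>2 \<le> 2\<^sup>2" for x n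
      proof (rule power_mono)
        have "cmod (indicator ?K x) \<le> 1"
          by (simp add: indicator_def)
        then show "cmod (indicator ?K x - G n x) \<le> 2"
          using norm_triangle_ineq4[of "indicator ?K x" "G n x"] G(2)[of n x] by linarith
      qed simp
      then show "AE x in torus_measure. norm ((cmod (indicator ?K x - G n x))\<^sup>2) \<le> 4" for n
        by simp
    qed auto
    then have "eventually (\<lambda>n. l2_norm_sq (\<lambda>x. indicator ?K x - G n x) < e) sequentially"
      using e by (intro order_tendstoD(2)) auto
    then obtain n where "l2_norm_sq (\<lambda>x. indicator ?K x - G n x) < e"
      by (auto simp: eventually_sequentially)
    then show "\<exists>G\<in>hoelder_torus. l2_norm_sq (\<lambda>x. indicator ?K x - G x) < e"
      using G(1) by blast
  qed
  show ?thesis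
  proof (rule hoelder_approximable_limit[OF L2_indicator[OF E]])
    fix e :: real assume "e > 0"
    then obtain T where T: "compact T" "abs_torus ` T \<subseteq> E" "abs_torus ` T \<in> sets torus_measure"
      "measure torus_measure (E - abs_torus ` T) < e"
      using torus_inner_regular[OF E] by metis
    have "(cmod (indicator E x - indicator (abs_torus ` T) x))\<^sup>2 = indicator (E - abs_torus ` T) x" for x
      using T(2) by (auto simp: indicator_def)
    then have "l2_norm_sq (\<lambda>x. indicator E x - indicator (abs_torus ` T) x) = measure torus_measure (E - abs_torus ` T)"
      using E T(3) by (simp add: l2_norm_sq_def)
    then show "\<exists>G. hoelder_approximable G \<and> l2_norm_sq (\<lambda>x. indicator E x - G x) < e"
      using compact[OF T(1,3)] T(4) by auto
  qed
qed

lemma hoelder_approximable_sum: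
  assumes "finite I" "\<And>i. i \<in> I \<Longrightarrow> hoelder_approximable (F i)"
  shows "hoelder_approximable (\<lambda>x. \<Sum>i\<in>I. F i x)"
  using assms
proof (induction I rule: finite_induct)
  case empty
  have "(\<lambda>x :: torus. 0 :: complex) = indicator {}"
    by auto
  then show ?case
    using hoelder_approximable_indicator[of "{}"] by simp
next
  case (insert i I)
  then show ?case
    by (simp add: hoelder_approximable_add)
qed

text \<open>
  From compact sets (bump functions) to measurable sets (inner regularity), to simple functions and finally to
  square integrable functions, which are limits of dominated simple functions.
\<close>
lemma L2_hoelder_approximable:
  assumes F: "F \<in> L2_torus"
  shows "hoelder_approximable F"
proof (rule hoelder_approximable_limit[OF F])
  fix e :: real assume e: "e > 0"
  have [measurable]: "F \<in> borel_measurable torus_measure"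
    and int: "integrable torus_measure (\<lambda>x. (cmod (F x))\<^sup>2)"
    using F by (auto simp: L2_torus_def)
  obtain s where s: "\<And>i. simple_function torus_measure (s i)" "\<And>x. (\<lambda>i. s i x) \<longlonglongrightarrow> F x"
    "\<And>i x. cmod (s i x) \<le> 2 * cmod (F x)"
    using borel_measurable_implies_sequence_metric[of F torus_measure 0] by auto
  have [measurable]: "s i \<in> borel_measurable torus_measure" for i
    using s(1) by (rule borel_measurable_simple_function)
  have simple: "hoelder_approximable (s i)" for i
  proof -
    have fin: "finite (range (s i))" and meas: "s i -` {y} \<in> sets torus_measure" for y
      using s(1)[of i] simple_functionD[OF s(1)[of i]] by auto
    have eq: "(\<lambda>x. \<Sum>y\<in>range (s i). y * indicator (s i -` {y}) x) = s i"
    proof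
      fix x
      have "(\<Sum>y\<in>range (s i). y * indicator (s i -` {y}) x) = (\<Sum>y\<in>range (s i). if s i x = y then y else 0)"
        by (intro sum.cong) (auto simp: indicator_def)
      then show "(\<Sum>y\<in>range (s i). y * indicator (s i -` {y}) x) = s i x"
        using fin by simp
    qed
    have "hoelder_approximable (\<lambda>x. \<Sum>y\<in>range (s i). y * indicator (s i -` {y}) x)"
      using fin meas by (intro hoelder_approximable_sum hoelder_approximable_scale hoelder_approximable_indicator)
    then show ?thesis
      unfolding eq .
  qed
  have "(\<lambda>i. l2_norm_sq (\<lambda>x. F x - s i x)) \<longlonglongrightarrow> (\<integral>x. 0 \<partial>torus_measure)"
    unfolding l2_norm_sq_def
  proof (rule integral_dominated_convergence[where w = "\<lambda>x. 9 * (cmod (F x))\<^sup>2"])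
    have "(\<lambda>i. (cmod (F x - s i x))\<^sup>2) \<longlonglongrightarrow> (cmod (F x - F x))\<^sup>2" for x
      by (intro tendsto_intros s(2))
    then show "AE x in torus_measure. (\<lambda>i. (cmod (F x - s i x))\<^sup>2) \<longlonglongrightarrow> 0"
      by simp
    have "(cmod (F x - s i x))\<^sup>2 \<le> (3 * cmod (F x))\<^sup>2" for x i
    proof (rule power_mono)
      show "cmod (F x - s i x) \<le> 3 * cmod (F x)"
        using norm_triangle_ineq4[of "F x" "s i x"] s(3)[of i x] by linarith
    qed simp
    then show "AE x in torus_measure. norm ((cmod (F x - s i x))\<^sup>2) \<le> 9 * (cmod (F x))\<^sup>2" for i
      by (simp add: power_mult_distrib)
  qed (use int in auto)
  then have "eventually (\<lambda>i. l2_norm_sq (\<lambda>x. F x - s i x) < e) sequentially"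
    using e by (intro order_tendstoD(2)) auto
  then obtain i where "l2_norm_sq (\<lambda>x. F x - s i x) < e"
    by (auto simp: eventually_sequentially)
  then show "\<exists>G. hoelder_approximable G \<and> l2_norm_sq (\<lambda>x. F x - G x) < e"
    using simple by blast
qed

text \<open>
  Replacing the two functions one after the other by Hoelder approximations \<open>P\<close> and \<open>Q\<close> changes the
  correlations by a small amount uniformly in \<open>k\<close>, since the action preserves \<open>L\<^sup>2\<close> norms. The second
  approximation has to be chosen after the first, as the required accuracy depends on the norm of \<open>P\<close>.
\<close>
lemma mixing_if_exponential_decay:
  assumes det: "\<And>k. k \<ge> 1 \<Longrightarrow> det (f k) = 1" and decay: "exponential_decay_hoelder f"
  shows "mixing f"
  unfolding mixing_def
proof (intro ballI)
  fix F G assume FG: "F \<in> L2_torus" "G \<in> L2_torus"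
  show "(\<lambda>k. correlation F G (f k)) \<longlonglongrightarrow> 0"
  proof (rule tendstoI)
    fix e :: real assume e: "e > 0"
    have ex_t: "\<exists>t>0. t * a < e / 5" if "a \<ge> 0" for a :: real
    proof -
      have "e / (5 * (a + 1)) * a < e / 5"
        using e that by (simp add: field_simps)
      moreover have "e / (5 * (a + 1)) > 0"
        using e that by simp
      ultimately show ?thesis by blast
    qed
    obtain t where t: "t > 0" "t * l2_norm_sq G < e / 5"
      using ex_t[OF l2_norm_sq_nonneg] by blast
    obtain P where P: "P \<in> hoelder_torus" "l2_norm_sq (\<lambda>x. F x - P x) < t * (e / 5)"
      using L2_hoelder_approximable[OF FG(1)] t(1) e unfolding hoelder_approximable_def
      by (metis divide_pos_pos mult_pos_pos zero_less_numeral)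
    obtain s where s: "s > 0" "s * l2_norm_sq P < e / 5"
      using ex_t[OF l2_norm_sq_nonneg] by blast
    obtain Q where Q: "Q \<in> hoelder_torus" "l2_norm_sq (\<lambda>x. G x - Q x) < s * (e / 5)"
      using L2_hoelder_approximable[OF FG(2)] s(1) e unfolding hoelder_approximable_def
      by (metis divide_pos_pos mult_pos_pos zero_less_numeral)
    have PQ: "P \<in> L2_torus" "Q \<in> L2_torus"
      using P Q hoelder_L2 by auto
    obtain c \<gamma> where c: "c > 0" "\<gamma> > 0" "\<And>k. k \<ge> 1 \<Longrightarrow> cmod (correlation P Q (f k)) \<le> c * exp (- \<gamma> * real k)"
      using decay P(1) Q(1) unfolding exponential_decay_hoelder_def by blast
    have "(\<lambda>k. c * exp (- \<gamma>) ^ k) \<longlonglongrightarrow> c * 0"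
      using c(2) by (intro tendsto_mult_left LIMSEQ_power_zero) simp
    then have "(\<lambda>k. c * exp (- \<gamma> * real k)) \<longlonglongrightarrow> 0"
      by (simp flip: exp_of_nat_mult add: mult.commute)
    then have "eventually (\<lambda>k. c * exp (- \<gamma> * real k) < e / 5) sequentially"
      using e by (intro order_tendstoD(2)) auto
    then show "eventually (\<lambda>k. dist (correlation F G (f k)) 0 < e) sequentially"
      using eventually_ge_at_top[of 1]
    proof eventually_elim
      case (elim k)
      have A: "det (f k) = 1"
        using det elim by simp
      let ?a = "correlation (\<lambda>x. F x - P x) G (f k)"
        and ?b = "correlation P (\<lambda>x. G x - Q x) (f k)" and ?c = "correlation P Q (f k)"
      have split: "correlation F G (f k) = ?a + ?b + ?c"
        by (intro correlation_split L2_integrable L2_mult_integrable L2_torus_action(1) A FG PQ)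
      have "cmod (correlation F G (f k)) \<le> cmod ?a + cmod ?b + cmod ?c"
        unfolding split by (intro order.trans[OF norm_triangle_ineq] add_right_mono norm_triangle_ineq)
      moreover have "cmod (correlation (\<lambda>x. F x - P x) G (f k)) < e / 5 + e / 5"
      proof -
        have "l2_norm_sq (\<lambda>x. F x - P x) / t < e / 5"
          using P(2) t(1) by (simp add: divide_less_eq mult.commute)
        then show ?thesis
          using correlation_L2_bound[OF A L2_diff[OF FG(1) PQ(1)] FG(2) t(1)] t(2) by linarith
      qed
      moreover have "cmod (correlation P (\<lambda>x. G x - Q x) (f k)) < e / 5 + e / 5"
      proof -
        have "1 / s * l2_norm_sq (\<lambda>x. G x - Q x) < e / 5"
          using Q(2) s(1) by (simp add: divide_less_eq mult.commute)
        moreover have "l2_norm_sq P / (1 / s) < e / 5"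
          using s by (simp add: mult.commute)
        moreover have "1 / s > 0"
          using s by simp
        ultimately show ?thesis
          using correlation_L2_bound[OF A PQ(1) L2_diff[OF FG(2) PQ(2)], of "1 / s"] by linarith
      qed
      moreover have "cmod (correlation P Q (f k)) < e / 5"
        using c(3)[of k] elim by linarith
      ultimately show ?case
        by simp
    qed
  qed
qed

theorem theorem9:
  fixes h :: "int^2^2"
  assumes "hyperbolic h"
    and "\<not> conjugate h (inv\<^bsub>SL2Z\<^esub> h)"
  shows "\<exists>\<epsilon>::real. \<epsilon> > 0 \<and>
    (\<forall>f\<in>G_infinity. rho_bar (\<lambda>k. h [^]\<^bsub>SL2Z\<^esub> k) f < ereal \<epsilon> \<longrightarrow>
       mixing f \<and> exponential_decay_hoelder f)"
proof -
  obtain \<epsilon> \<delta> k0 where pos: "\<epsilon> > 0" "\<delta> > 0"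
    and sep: "\<And>f k j. f \<in> G_infinity \<Longrightarrow> rho_bar (\<lambda>k. h [^]\<^bsub>SL2Z\<^esub> k) f < ereal \<epsilon> \<Longrightarrow> k \<ge> k0 \<Longrightarrow>
       real j \<le> \<delta> * real k \<Longrightarrow> separates_frequencies (2 ^ j) (f k)"
    using ball_separates_frequencies[OF assms] by blast
  have "mixing f \<and> exponential_decay_hoelder f"
    if f: "f \<in> G_infinity" "rho_bar (\<lambda>k. h [^]\<^bsub>SL2Z\<^esub> k) f < ereal \<epsilon>" for f
  proof
    show decay: "exponential_decay_hoelder f"
      by (rule exponential_decay_if_separates_frequencies[OF pos(2) sep[OF f]])
    show "mixing f"
      using f(1) by (intro mixing_if_exponential_decay decay) (simp add: G_infinity_def)
  qed
  with pos(1) show ?thesis by blast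
qed

end
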